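(* A matrix $M$ has the $I$-circular property if and only if $M$ contains no matrix in the set \[ \mathcal{F}_{\mathrm{IcircR}}=\{M_I^*(k),\ M_{III}(k),\ M_{II}(k+1) : k\ge 3\}\cup\{0101\oplus M_I^*(4),\ 0100\oplus M_{II}(4),\ M_{IV},\ M_V,\ M_{VI}\} \] as a configuration.
   Context: All matrices are finite and binary (entries in $\{0,1\}$). A row $r$ of a matrix is identified with the set of columns in which it has a $1$; $r\cap s$ is the set of columns having a $1$ in both rows $r$ and $s$. Circular intervals. If $\preccurlyeq$ is a linear order on a set $X$ and $a,b\in X$, then $[a,b]_{\preccurlyeq}$ denotes $\{x\in X: a\preccurlyeq x\preccurlyeq b\}$ if $a\preccurlyeq b$, and $\{x\in X: x\preccurlyeq b\text{ or }a\preccurlyeq x\}$ if $b\preccurlyeq a$. A circular interval of $\preccurlyeq$ is either the empty set or $[a,b]_{\preccurlyeq}$ for some $a,b\in X$. $I$-circular property. $M$ has the $I$-circular property if there is a linear order $\preccurlyeq$ of its columns such that each row of $M$ is a circular interval of $\preccurlyeq$ and $r\cap s$ is also a circular interval of $\preccurlyeq$ for each pair of rows $r,s$ of $M$. Configurations. $M$ contains $M'$ as a configuration if some submatrix of $M$ equals $M'$ up to permutations of rows and of columns. Notation. For a binary sequence $a=a_1\dots a_k$ and a matrix $M$ with $k$ rows, $a\oplus M$ is the matrix obtained from $M$ by complementing (interchanging $0$'s and $1$'s in) every row $i$ with $a_i=1$. $M^*$ is $M$ with an all-zero column appended (as last column); $M_I^*(k)$ means $(M_I(k))^*$. Matrices.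 - $M_I(k)$ ($k\ge3$), size $k\times k$: for $1\le i\le k-1$, row $i$ has $1$'s exactly in columns $i,i+1$; row $k$ has $1$'s exactly in columns $1,k$. - $M_{II}(k)$ ($k\ge4$), size $k\times k$: for $1\le i\le k-2$, row $i$ has $1$'s exactly in columns $i,i+1$; row $k-1$ has $1$'s exactly in columns $1,\dots,k-2$ and $k$; row $k$ has $1$'s exactly in columns $2,\dots,k$. - $M_{III}(k)$ ($k\ge3$), size $k\times(k+1)$: for $1\le i\le k-1$, row $i$ has $1$'s exactly in columns $i,i+1$; row $k$ has $1$'s exactly in columns $2,\dots,k-1$ and $k+1$. - $M_{IV}=\begin{pmatrix}1&1&0&0&0&0\\0&0&1&1&0&0\\0&0&0&0&1&1\\0&1&0&1&0&1\end{pmatrix}$, $M_V=\begin{pmatrix}1&1&0&0&0\\1&1&1&1&0\\0&0&1&1&0\\1&0&0&1&1\end{pmatrix}$, $M_{VI}=\begin{pmatrix}1&1&0&1\\0&1&1&1\\1&0&1&1\end{pmatrix}$. *)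

theory Defs
  imports
    "Jordan_Normal_Form.Matrix"
    "Jordan_Normal_Form.DL_Submatrix"
    "HOL-Combinatorics.Permutations"
    "HOL-Library.Z2"
begin

section \<open>Circular intervals and the I-circular property\<close>

text \<open>
  For \<open>a = b\<close> both clauses of the case distinction would apply; the first one is given priority,
  so the segment is \<open>{a}\<close>. This does not affect which subsets of a finite set are circular
  intervals: if \<open>b\<close> is the immediate predecessor of \<open>a\<close>, then the second clause yields the whole
  of \<open>X\<close>.
\<close>

definition circular_segment :: "'a set \<Rightarrow> 'a rel \<Rightarrow> 'a \<Rightarrow> 'a \<Rightarrow> 'a set" where
  "circular_segment X r a b =
     (if (a, b) \<in> r then {x \<in> X. (a, x) \<in> r \<and> (x, b) \<in> r}
      else {x \<in> X. (x, b) \<in> r \<or> (a, x) \<in> r})"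

definition circular_interval :: "'a set \<Rightarrow> 'a rel \<Rightarrow> 'a set \<Rightarrow> bool" where
  "circular_interval X r S \<longleftrightarrow>
     S = {} \<or> (\<exists>a\<in>X. \<exists>b\<in>X. S = circular_segment X r a b)"

definition row_set :: "bit mat \<Rightarrow> nat \<Rightarrow> nat set" where
  "row_set M i = {j. j < dim_col M \<and> M $$ (i, j) = 1}"

definition I_circular :: "bit mat \<Rightarrow> bool" where
  "I_circular M \<longleftrightarrow>
     (\<exists>r. linear_order_on {..<dim_col M} r \<and>
        (\<forall>i<dim_row M. circular_interval {..<dim_col M} r (row_set M i)) \<and>
        (\<forall>i<dim_row M. \<forall>j<dim_row M.
           circular_interval {..<dim_col M} r (row_set M i \<inter> row_set M j)))"

section \<open>Configurations\<close>

definition permute_mat :: "(nat \<Rightarrow> nat) \<Rightarrow> (nat \<Rightarrow> nat) \<Rightarrow> 'a mat \<Rightarrow> 'a mat" where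
  "permute_mat p q M = mat (dim_row M) (dim_col M) (\<lambda>(i, j). M $$ (p i, q j))"

definition contains_configuration :: "'a mat \<Rightarrow> 'a mat \<Rightarrow> bool" where
  "contains_configuration M M' \<longleftrightarrow>
     (\<exists>I J p q. I \<subseteq> {..<dim_row M} \<and> J \<subseteq> {..<dim_col M} \<and>
        p permutes {..<dim_row (submatrix M I J)} \<and>
        q permutes {..<dim_col (submatrix M I J)} \<and>
        M' = permute_mat p q (submatrix M I J))"

section \<open>The forbidden matrices\<close>

text \<open>The length of \<open>a\<close> is meant to be the number of rows of \<open>M\<close>.\<close>

definition complement_rows :: "bit list \<Rightarrow> bit mat \<Rightarrow> bit mat" where
  "complement_rows a M =
     mat (dim_row M) (dim_col M)
       (\<lambda>(i, j). if a ! i = 1 then 1 - M $$ (i, j) else M $$ (i, j))"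

definition append_zero_col :: "bit mat \<Rightarrow> bit mat" where
  "append_zero_col M =
     mat (dim_row M) (dim_col M + 1) (\<lambda>(i, j). if j < dim_col M then M $$ (i, j) else 0)"

text \<open>
  Here \<open>R i\<close> is the set of columns with a 1 in row \<open>i\<close>, where, unlike in \<^typ>\<open>'a mat\<close>, rows and
  columns are numbered from 1.
\<close>

definition mat_of_row_sets :: "nat \<Rightarrow> nat \<Rightarrow> (nat \<Rightarrow> nat set) \<Rightarrow> bit mat" where
  "mat_of_row_sets m n R = mat m n (\<lambda>(i, j). if j + 1 \<in> R (i + 1) then 1 else 0)"

text \<open>
  The following families are meant for \<open>k \<ge> 3\<close>, \<open>k \<ge> 4\<close> and \<open>k \<ge> 3\<close>, respectively.
\<close>

definition M_I :: "nat \<Rightarrow> bit mat" where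
  "M_I k = mat_of_row_sets k k (\<lambda>i. if i \<le> k - 1 then {i, i + 1} else {1, k})"

definition M_II :: "nat \<Rightarrow> bit mat" where
  "M_II k = mat_of_row_sets k k
     (\<lambda>i. if i \<le> k - 2 then {i, i + 1}
          else if i = k - 1 then {1..k - 2} \<union> {k}
          else {2..k})"

definition M_III :: "nat \<Rightarrow> bit mat" where
  "M_III k = mat_of_row_sets k (k + 1)
     (\<lambda>i. if i \<le> k - 1 then {i, i + 1} else {2..k - 1} \<union> {k + 1})"

definition M_IV :: "bit mat" where
  "M_IV = mat_of_rows_list 6
     [[1, 1, 0, 0, 0, 0],
      [0, 0, 1, 1, 0, 0],
      [0, 0, 0, 0, 1, 1],
      [0, 1, 0, 1, 0, 1]]"

definition M_V :: "bit mat" where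
  "M_V = mat_of_rows_list 5
     [[1, 1, 0, 0, 0],
      [1, 1, 1, 1, 0],
      [0, 0, 1, 1, 0],
      [1, 0, 0, 1, 1]]"

definition M_VI :: "bit mat" where
  "M_VI = mat_of_rows_list 4
     [[1, 1, 0, 1],
      [0, 1, 1, 1],
      [1, 0, 1, 1]]"

definition F_IcircR :: "bit mat set" where
  "F_IcircR =
     (\<Union>k\<in>{3..}. {append_zero_col (M_I k), M_III k, M_II (k + 1)}) \<union>
     {complement_rows [0, 1, 0, 1] (append_zero_col (M_I 4)),
      complement_rows [0, 1, 0, 0] (M_II 4),
      M_IV, M_V, M_VI}"

end

theory Submission
  imports Defs
begin

text \<open>
  Two arcs of a circular order that miss a common column meet in an arc. So only the rows, the
  intersections of two rows that together cover all columns, and the complements of these sets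
  matter; they are the realized sets. Cutting the circle at a column \<open>c\<close>, the I-circular property
  says that the realized sets avoiding \<open>c\<close> have the consecutive-ones property, which holds as soon as
  they have no asteroidal triple.

  Two configurations obstruct every circular order: a cycle of realized pairs with a column outside
  it, and three disjoint realized pairs that are crossed by a realized set. In their absence every
  realized set meets an induced path in an interval, and this excludes asteroidal triples. Both
  obstructions come from forbidden matrices: a chord would shorten a cycle, so each edge of a
  shortest cycle on more than four columns is, with few exceptions, a row or the complement of a row,
  and the arrangements of the complements that can occur are those of the forbidden matrices.
\<close>


section \<open>Consecutive orders and asteroidal triples\<close>

text \<open>Realized sets are not closed under intersection, and this shapes the proof twice. Three
  pairs crossed by a fourth set would reduce to a triangle if the crossing set could be cut with the
  complement of a block, as it can for arcs; since the result need not be realized, crossed blocks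
  are an obstruction of their own. Moreover, two rows that leave out a column may cover everything
  once that column is deleted, so a smaller column set \<open>W\<close> can have realized sets that
  are not traces of realized sets on \<open>X\<close>. Forbidden matrices are therefore looked for
  with \<open>realized\<close> taken on the few columns of an obstruction, and deleting a column is
  itself a way to shorten a cycle. Closure under complements, in contrast, always holds and supplies
  many witnesses: a set through an unwanted column is replaced by its complement. The argument
  concerns families of sets throughout; each forbidden matrix is translated into a set of row
  patterns on numbered columns.\<close>

definition touch :: "'a set set \<Rightarrow> 'a \<Rightarrow> 'a rel" where
  "touch \<T> w = {(u, v). \<exists>t\<in>\<T>. u \<in> t \<and> v \<in> t \<and> w \<notin> t}"

abbreviation linked :: "'a set set \<Rightarrow> 'a \<Rightarrow> 'a \<Rightarrow> 'a \<Rightarrow> bool" where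
  "linked \<T> w a b \<equiv> (a, b) \<in> (touch \<T> w)\<^sup>*"

text \<open>An asteroidal triple of columns in the bipartite graph of columns and sets: any two are
  joined by a path avoiding the neighbours of the third.\<close>

definition asteroidal :: "'a set set \<Rightarrow> 'a \<Rightarrow> 'a \<Rightarrow> 'a \<Rightarrow> bool" where
  "asteroidal \<T> x y z \<longleftrightarrow> distinct [x, y, z] \<and>
     linked \<T> z x y \<and> linked \<T> y x z \<and> linked \<T> x y z"

definition consecutive :: "('a \<Rightarrow> nat) \<Rightarrow> 'a set \<Rightarrow> 'a set \<Rightarrow> bool" where
  "consecutive pos Y t \<longleftrightarrow>
     (\<forall>x\<in>Y. \<forall>y\<in>Y. \<forall>z\<in>Y. x \<in> t \<longrightarrow> z \<in> t \<longrightarrow> pos x < pos y \<longrightarrow> pos y < pos z \<longrightarrow> y \<in> t)"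

definition consecutive_ones :: "'a set \<Rightarrow> 'a set set \<Rightarrow> bool" where
  "consecutive_ones Y \<T> \<longleftrightarrow> (\<exists>pos. inj_on pos Y \<and> (\<forall>t\<in>\<T>. consecutive pos Y t))"

lemma consecutiveD:
  "consecutive pos Y t \<Longrightarrow> x \<in> Y \<Longrightarrow> y \<in> Y \<Longrightarrow> z \<in> Y \<Longrightarrow> x \<in> t \<Longrightarrow> z \<in> t \<Longrightarrow>
    pos x < pos y \<Longrightarrow> pos y < pos z \<Longrightarrow> y \<in> t"
  unfolding consecutive_def by blast

section \<open>Chains of sets avoiding a vertex\<close>

lemma linkedI: "t \<in> \<T> \<Longrightarrow> w \<notin> t \<Longrightarrow> u \<in> t \<Longrightarrow> v \<in> t \<Longrightarrow> linked \<T> w u v"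
  unfolding touch_def by blast

lemma linked_sym: "linked \<T> w u v \<Longrightarrow> linked \<T> w v u"
  by (rule symD[OF sym_rtrancl]) (auto simp: touch_def sym_def)

lemma linked_step:
  "linked \<T> w a u \<Longrightarrow> t \<in> \<T> \<Longrightarrow> w \<notin> t \<Longrightarrow> u \<in> t \<Longrightarrow> v \<in> t \<Longrightarrow> linked \<T> w a v"
  using linkedI rtrancl_trans by metis

lemma linked_induct [consumes 1, case_names base step]:
  assumes "linked \<T> w a b" "P a"
    and "\<And>u v t. linked \<T> w a u \<Longrightarrow> P u \<Longrightarrow> t \<in> \<T> \<Longrightarrow> w \<notin> t \<Longrightarrow> u \<in> t \<Longrightarrow> v \<in> t \<Longrightarrow> P v"
  shows "P b"
  using assms(1)
proof (induction rule: rtrancl_induct)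
  case base
  show ?case by (rule assms(2))
next
  case (step u v)
  from step(2) obtain t where "t \<in> \<T>" "u \<in> t" "v \<in> t" "w \<notin> t"
    by (auto simp: touch_def)
  with step(1,3) show ?case using assms(3) by blast
qed

lemma linked_lift:
  assumes "\<And>t u v. t \<in> \<T>' \<Longrightarrow> w \<notin> t \<Longrightarrow> u \<in> t \<Longrightarrow> v \<in> t \<Longrightarrow> linked \<T> w u v"
    and "linked \<T>' w a b"
  shows "linked \<T> w a b"
  using assms(2)
proof (induction rule: linked_induct)
  case (step u v t)
  then show ?case using assms(1) rtrancl_trans by metis
qed simp

text \<open>Consider the first set containing \<open>y\<close> on a chain that avoids
  \<open>x\<close>: up to there the chain leads to \<open>y\<close>. If there is none, the whole
  chain avoids \<open>y\<close> too.\<close>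

lemma linked_detour:
  assumes "linked \<T> x e z"
  shows "linked \<T> y e z \<or> linked \<T> x e y"
  using assms
proof (induction rule: linked_induct)
  case (step u v t)
  show ?case
  proof (cases "y \<in> t")
    case True
    then show ?thesis using step linked_step by metis
  next
    case False
    then show ?thesis using step linked_step by metis
  qed
qed simp

text \<open>Lets the induction below use a family that is not a subfamily: its sets only have to be
  simulated by chains of the old one.\<close>

lemma asteroidal_lift:
  assumes "\<And>w t u v. w \<in> Y' \<Longrightarrow> t \<in> \<T>' \<Longrightarrow> w \<notin> t \<Longrightarrow> u \<in> t \<Longrightarrow> v \<in> t \<Longrightarrow> linked \<T> w u v"
    and "x \<in> Y'" "y \<in> Y'" "z \<in> Y'" "asteroidal \<T>' x y z"
  shows "asteroidal \<T> x y z"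
proof -
  have "linked \<T> w a b" if "w \<in> Y'" "linked \<T>' w a b" for w a b
    using linked_lift[OF assms(1)[OF that(1)] that(2)] .
  then show ?thesis using assms(2-5) unfolding asteroidal_def by simp
qed

section \<open>Orders composed level by level\<close>

lemma lex_position_less:
  fixes i j a b N :: nat
  assumes "a < N" "b < N"
  shows "i * N + a < j * N + b \<longleftrightarrow> i < j \<or> (i = j \<and> a < b)"
proof -
  have less: "i * N + a < j * N + b" if "i < j" "a < N" for i j a b :: nat
  proof -
    have "i * N + a < Suc i * N" using that by simp
    also have "\<dots> \<le> j * N" using that by (intro mult_le_mono1) simp
    finally show ?thesis by simp
  qed
  show ?thesis
    using less[of i j a b] less[of j i b a] assms by (cases i j rule: linorder_cases) auto
qed

text \<open>Positions are lexicographic: level \<open>f\<close> first, then the order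
  \<open>p\<close> of the level. A vertex between two elements of \<open>t\<close> is covered by
  \<open>between\<close> if it lies on a higher level than the left one. If it lies on the same
  level, the last condition on \<open>p\<close> applies: there \<open>t\<close> is a final segment
  as soon as \<open>t\<close> reaches a higher level.\<close>

lemma consecutive_ones_concat:
  fixes f :: "'a \<Rightarrow> nat"
  assumes "finite Y"
    and between: "\<And>t x y z. t \<in> \<T> \<Longrightarrow> x \<in> t \<Longrightarrow> z \<in> t \<Longrightarrow> x \<in> Y \<Longrightarrow> y \<in> Y \<Longrightarrow> z \<in> Y \<Longrightarrow>
        f x < f y \<Longrightarrow> f y \<le> f z \<Longrightarrow> y \<in> t"
    and classes: "\<And>i. \<exists>p. inj_on p {y \<in> Y. f y = i} \<and>
        (\<forall>t\<in>\<T>. consecutive p {y \<in> Y. f y = i} t) \<and>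
        (\<forall>t\<in>\<T>. \<forall>x\<in>Y. \<forall>y\<in>Y. \<forall>z\<in>Y. x \<in> t \<longrightarrow> z \<in> t \<longrightarrow> f x = i \<longrightarrow> f y = i \<longrightarrow> i < f z \<longrightarrow>
            p x < p y \<longrightarrow> y \<in> t)"
  shows "consecutive_ones Y \<T>"
proof -
  define Q where "Q i p \<longleftrightarrow> inj_on p {y \<in> Y. f y = i} \<and>
        (\<forall>t\<in>\<T>. consecutive p {y \<in> Y. f y = i} t) \<and>
        (\<forall>t\<in>\<T>. \<forall>x\<in>Y. \<forall>y\<in>Y. \<forall>z\<in>Y. x \<in> t \<longrightarrow> z \<in> t \<longrightarrow> f x = i \<longrightarrow> f y = i \<longrightarrow> i < f z \<longrightarrow>
            p x < p y \<longrightarrow> y \<in> t)" for i p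
  have "\<forall>i. \<exists>p. Q i p" unfolding Q_def using classes by (rule allI)
  then obtain p where P: "\<And>i. Q i (p i)" by metis
  have p: "inj_on (p i) {y \<in> Y. f y = i}"
    "t \<in> \<T> \<Longrightarrow> consecutive (p i) {y \<in> Y. f y = i} t" for i t
    using P[of i] unfolding Q_def by blast+
  have p_up: "y \<in> t" if "t \<in> \<T>" "x \<in> Y" "y \<in> Y" "z \<in> Y" "x \<in> t" "z \<in> t" "f x = i"
       "f y = i" "i < f z" "p i x < p i y" for i t x y z
    using P[of i] that unfolding Q_def by blast
  obtain N where N: "\<And>y. y \<in> Y \<Longrightarrow> p (f y) y < N"
  proof
    fix y assume "y \<in> Y"
    then show "p (f y) y < Suc (\<Sum>y\<in>Y. p (f y) y)"
      using \<open>finite Y\<close> member_le_sum[of y Y "\<lambda>y. p (f y) y"] by simp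
  qed
  define pos where "pos y = f y * N + p (f y) y" for y
  have less: "pos x < pos y \<longleftrightarrow> f x < f y \<or> (f x = f y \<and> p (f x) x < p (f y) y)"
    if "x \<in> Y" "y \<in> Y" for x y
    unfolding pos_def using lex_position_less N that by blast
  have "inj_on pos Y"
  proof (rule inj_onI)
    fix x y assume xy: "x \<in> Y" "y \<in> Y" "pos x = pos y"
    then have "f x = f y" "p (f x) x = p (f y) y"
      using less[of x y] less[of y x] by (metis linorder_neqE_nat less_irrefl)+
    then show "x = y" using p(1)[of "f x"] xy by (auto dest: inj_onD)
  qed
  moreover have "consecutive pos Y t" if t: "t \<in> \<T>" for t
    unfolding consecutive_def
  proof (intro ballI impI)
    fix x y z assume A: "x \<in> Y" "y \<in> Y" "z \<in> Y" "x \<in> t" "z \<in> t" "pos x < pos y" "pos y < pos z"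
    then have le: "f x \<le> f y" "f y \<le> f z" using less by force+
    show "y \<in> t"
    proof (cases "f x = f y")
      case True
      show ?thesis
      proof (cases "f y = f z")
        case z: True
        have "p (f y) x < p (f y) y" "p (f y) y < p (f y) z"
          using A less[of x y] less[of y z] z True by simp_all
        then show ?thesis
          using A True z by (intro consecutiveD[OF p(2)[OF t], of x "f y" y z]) simp_all
      next
        case False
        then have "f x < f z" "p (f x) x < p (f x) y" using A True le less[of x y] by simp_all
        then show ?thesis
          using True by (intro p_up[OF t A(1-5) refl]) simp_all
      qed
    next
      case False
      then show ?thesis using between[OF t, of x z y] A le by auto
    qed
  qed
  ultimately show ?thesis unfolding consecutive_ones_def by blast
qed

text \<open>
  A non-separating vertex \<open>e\<close> can be put first, and then \<open>x\<close> precedes \<open>y\<close> whenever \<open>e\<close> and \<open>x\<close> are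
  linked off \<open>y\<close>. This leaves only classes of incomparable vertices to be ordered, each together
  with a representative \<open>w\<close> of the later vertices, which the additional set \<open>K\<close> below keeps at the end.
\<close>

theorem consecutive_ones_if_no_asteroidal:
  assumes "finite Y" "\<And>t. t \<in> \<T> \<Longrightarrow> t \<subseteq> Y"
    and "\<And>x y z. x \<in> Y \<Longrightarrow> y \<in> Y \<Longrightarrow> z \<in> Y \<Longrightarrow> \<not> asteroidal \<T> x y z"
  shows "consecutive_ones Y \<T>"
  using assms
proof (induction "card Y" arbitrary: Y \<T> rule: less_induct)
  case less
  note fin = less.prems(1) and sub = less.prems(2) and noat = less.prems(3)
  have smaller: "consecutive_ones Y' \<T>'"
    if Y': "Y' \<subset> Y" and subs: "\<And>t. t \<in> \<T>' \<Longrightarrow> t \<subseteq> Y'"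
      and link: "\<And>w t u v. w \<in> Y' \<Longrightarrow> t \<in> \<T>' \<Longrightarrow> w \<notin> t \<Longrightarrow> u \<in> t \<Longrightarrow> v \<in> t \<Longrightarrow> linked \<T> w u v"
    for Y' \<T>'
  proof (rule less.hyps)
    show "card Y' < card Y" using Y' fin by (rule psubset_card_mono[rotated])
    show "finite Y'" using Y' fin finite_subset by blast
    show "t \<subseteq> Y'" if "t \<in> \<T>'" for t using that by (rule subs)
    show "\<not> asteroidal \<T>' x y z" if xyz: "x \<in> Y'" "y \<in> Y'" "z \<in> Y'" for x y z
    proof
      assume "asteroidal \<T>' x y z"
      with link xyz have "asteroidal \<T> x y z" by (rule asteroidal_lift[of Y'])
      then show False using noat xyz Y' by blast
    qed
  qed
  have smaller_trace: "\<exists>p. inj_on p Y' \<and> (\<forall>t\<in>\<T>. consecutive p Y' t)" if "Y' \<subset> Y" for Y'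
  proof -
    have "consecutive_ones Y' ((\<inter>) Y' ` \<T>)"
      using that by (intro smaller) (auto intro: linkedI)
    then obtain p where p: "inj_on p Y'" "\<And>t. t \<in> \<T> \<Longrightarrow> consecutive p Y' (Y' \<inter> t)"
      unfolding consecutive_ones_def by auto
    then have "consecutive p Y' t" if "t \<in> \<T>" for t
      using p(2)[OF that] unfolding consecutive_def by blast
    with p(1) show ?thesis by blast
  qed
  show ?case
  proof (cases "\<exists>a\<in>Y. \<exists>b\<in>Y. a \<noteq> b")
    case False
    then have "inj_on (\<lambda>_. 0) Y" "\<forall>t\<in>\<T>. consecutive (\<lambda>_. 0) Y t"
      by (auto simp: consecutive_def inj_on_def)
    then show ?thesis unfolding consecutive_ones_def by blast
  next
    case True
    \<comment> \<open>The component of \<open>a\<close> in the family of sets avoiding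
      \<open>e\<close>. The pair is chosen with this component as large as possible;
      \<open>K_sub\<close> rests on this choice.\<close>
    define comp where "comp e a = {b \<in> Y - {e}. linked \<T> e a b}" for e a
    define M where "M = {(e, a). e \<in> Y \<and> a \<in> Y \<and> e \<noteq> a}"
    have "finite M" by (rule finite_subset[of _ "Y \<times> Y"]) (auto simp: M_def fin)
    have "M \<noteq> {}" using True by (auto simp: M_def)
    define h where "h m = card (comp (fst m) (snd m))" for m
    have "finite (h ` M)" "h ` M \<noteq> {}" using \<open>finite M\<close> \<open>M \<noteq> {}\<close> by auto
    from Max_in[OF this] obtain m where m: "m \<in> M" "h m = Max (h ` M)" by auto
    have h: "h m' \<le> h m" if "m' \<in> M" for m'
      using Max_ge[OF \<open>finite (h ` M)\<close>, of "h m'"] that m by simp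
    obtain e a where [simp]: "m = (e, a)" by (cases m)
    have ea: "e \<in> Y" "a \<in> Y" "e \<noteq> a" using m by (auto simp: M_def)
    have maxi: "card (comp e' a') \<le> card (comp e a)" if "e' \<in> Y" "a' \<in> Y" "e' \<noteq> a'" for e' a'
      using h[of "(e', a')"] that by (simp add: M_def h_def)
    define C where "C = comp e a"
    define K where "K = Y - C"
    have C: "C \<subseteq> Y" "e \<notin> C" "a \<in> C" "finite C"
      using ea fin unfolding C_def comp_def by auto
    have eK: "e \<in> K" using C ea unfolding K_def by auto
    have in_C: "t \<subseteq> C" if "t \<in> \<T>" "b \<in> t" "b \<in> C" "e \<notin> t" for t b
      using that sub[of t] linked_step[of a b \<T> e t] unfolding C_def comp_def by blast
    \<comment> \<open>If \<open>t\<close> missed some \<open>y\<close> in \<open>K\<close>, then the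
      chains inside \<open>C\<close>, which avoid \<open>y\<close> anyway, continued by
      \<open>t\<close>, would put \<open>C\<close> and \<open>e\<close> into one component off
      \<open>y\<close>, larger than the largest.\<close>
    have K_sub: "K \<subseteq> t" if t: "t \<in> \<T>" "b \<in> t" "b \<in> C" "\<not> t \<subseteq> C" for t b
    proof (rule ccontr)
      assume "\<not> K \<subseteq> t"
      then obtain y where y: "y \<in> K" "y \<notin> t" by blast
      have "e \<in> t" using in_C t by blast
      have link: "linked \<T> y a c" if "linked \<T> e a c" for c
        using that
      proof (induction rule: linked_induct)
        case (step u v s)
        have "u \<in> s" "s \<in> \<T>" "e \<notin> s" by fact+
        then have "u \<in> C" using step sub unfolding C_def comp_def by blast
        with step have "s \<subseteq> C" using in_C by blast
        with y step show ?case using linked_step[of a u \<T> y s v] by (auto simp: K_def)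
      qed simp
      have "linked \<T> y a b" using link t(3) unfolding C_def comp_def by blast
      then have "linked \<T> y a e" using linked_step[of a b \<T> y t e] t y \<open>e \<in> t\<close> by blast
      then have "insert e C \<subseteq> comp y a"
        using link y \<open>e \<in> t\<close> ea C unfolding C_def comp_def K_def by auto
      then have "card (insert e C) \<le> card (comp y a)"
        by (rule card_mono[rotated]) (auto simp: comp_def fin)
      moreover have "card (comp y a) \<le> card C"
        unfolding C_def using y C ea by (intro maxi) (auto simp: K_def)
      ultimately show False using C by simp
    qed
    have KY: "K \<subset> Y" "C \<subset> Y" using C ea by (auto simp: K_def)
    show ?thesis
    proof (cases "\<exists>t\<in>\<T>. \<exists>b\<in>t. b \<in> C \<and> \<not> t \<subseteq> C")
      case False
      \<comment> \<open>No set crosses the border of \<open>C\<close>, so \<open>K\<close> and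
        \<open>C\<close> are simply placed one after the other.\<close>
      define f :: "'a \<Rightarrow> nat" where "f y = (if y \<in> C then 1 else 0)" for y
      have f_same: "f x = f z" if "t \<in> \<T>" "x \<in> t" "z \<in> t" for t x z
        using that False by (auto simp: f_def)
      show ?thesis
      proof (rule consecutive_ones_concat[where f = f, OF fin])
        fix i
        have "{y \<in> Y. f y = i} \<subset> Y" using C ea unfolding f_def by (cases "i = 0") auto
        from smaller_trace[OF this] obtain p where
          "inj_on p {y \<in> Y. f y = i}" "\<forall>t\<in>\<T>. consecutive p {y \<in> Y. f y = i} t" by blast
        moreover have "\<not> i < f z" if "t \<in> \<T>" "x \<in> t" "z \<in> t" "f x = i" for t x z
          using f_same[OF that(1-3)] that(4) by simp
        ultimately show "\<exists>p. inj_on p {y \<in> Y. f y = i} \<and> (\<forall>t\<in>\<T>. consecutive p {y \<in> Y. f y = i} t) \<and>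
          (\<forall>t\<in>\<T>. \<forall>x\<in>Y. \<forall>y\<in>Y. \<forall>z\<in>Y. x \<in> t \<longrightarrow> z \<in> t \<longrightarrow> f x = i \<longrightarrow> f y = i \<longrightarrow> i < f z \<longrightarrow>
            p x < p y \<longrightarrow> y \<in> t)"
          by blast
      next
        show "y \<in> t" if "t \<in> \<T>" "x \<in> t" "z \<in> t" "f x < f y" "f y \<le> f z" for t x y z
          using f_same[OF that(1-3)] that(4,5) by simp
      qed
    next
      case joined: True
      define before where "before x y \<longleftrightarrow> linked \<T> y e x" for x y
      have link_C: "linked \<T> e x y" if "x \<in> C" "y \<in> C" for x y
      proof -
        have "linked \<T> e x a" "linked \<T> e a y"
          using that linked_sym by (auto simp: C_def comp_def)
        then show ?thesis by (rule rtrancl_trans)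
      qed
      \<comment> \<open>Any two vertices of \<open>C\<close> are linked off \<open>e\<close>, so a
        mutual relation would make \<open>e\<close>, \<open>x\<close>, \<open>y\<close>
        asteroidal.\<close>
      have anti: "\<not> (before x y \<and> before y x)" if "x \<in> C" "y \<in> C" "x \<noteq> y" for x y
        using noat[of e x y] that link_C[of x y] C ea unfolding asteroidal_def before_def by auto
      \<comment> \<open>By \<open>linked_detour\<close> the sets of predecessors form a chain, so
        their cardinalities rank \<open>C\<close>. Level 0 is kept for \<open>K\<close>.\<close>
      define B where "B x = {y \<in> C. y \<noteq> x \<and> before y x}" for x
      define f where "f x = (if x \<in> C then Suc (card (B x)) else 0)" for x
      have B_sub: "B x \<subseteq> B y" if "x \<in> C" "y \<in> C" "\<not> before y x" for x y
        using that linked_detour[of e _ \<T> x y] unfolding B_def before_def by auto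
      have finB: "finite (B x)" for x using C by (auto simp: B_def)
      have f_less: "f x < f y" if "x \<in> C" "y \<in> C" "x \<noteq> y" "before x y" for x y
      proof -
        have "B x \<subseteq> B y" "x \<in> B y" "x \<notin> B x"
          using B_sub anti that by (auto simp: B_def)
        then have "card (B x) < card (B y)" using finB by (intro psubset_card_mono) auto
        then show ?thesis using that by (simp add: f_def)
      qed
      have f_less_iff: "f x < f y \<longleftrightarrow> before x y" if "x \<in> C" "y \<in> C" "x \<noteq> y" for x y
      proof
        assume "f x < f y"
        then have "\<not> before y x" using f_less[of y x] that by auto
        show "before x y"
        proof (rule ccontr)
          assume "\<not> before x y"
          then have "B y \<subseteq> B x" using B_sub that by blast
          then have "card (B y) \<le> card (B x)" using finB by (intro card_mono)
          then show False using \<open>f x < f y\<close> that by (simp add: f_def)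
        qed
      qed (rule f_less[OF that])
      have inC: "y \<in> C" if "f x < f y" for x y
        using that by (auto simp: f_def split: if_splits)
      have between: "y \<in> t"
        if t: "t \<in> \<T>" "x \<in> t" "z \<in> t" "x \<in> Y" "y \<in> Y" "z \<in> Y" "f x < f y" "f y \<le> f z" for t x y z
      proof (rule ccontr)
        assume y: "y \<notin> t"
        have yC: "y \<in> C" and zC: "z \<in> C" using inC t by (meson order_less_le_trans)+
        \<comment> \<open>Off \<open>y\<close>, the vertex \<open>e\<close> reaches
          \<open>x\<close>, or lies in \<open>t\<close> when \<open>x\<close> is in
          \<open>K\<close>. Through \<open>t\<close> it then reaches \<open>z\<close>, so
          \<open>z\<close> would come before \<open>y\<close>.\<close>
        have "linked \<T> y e x \<or> e \<in> t"
        proof (cases "x \<in> C")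
          case True
          then show ?thesis using f_less_iff[of x y] t yC y by (auto simp: before_def)
        next
          case False
          then show ?thesis using K_sub[of t z] t zC eK by blast
        qed
        then have "before z y"
          using linked_step[of e _ \<T> y t z] t y unfolding before_def by blast
        then show False using f_less_iff[of z y] t y yC zC by auto
      qed
      show ?thesis
      proof (rule consecutive_ones_concat[where f = f, OF fin between])
        fix i
        define L where "L = {y \<in> Y. f y = i}"
        have "\<exists>p. inj_on p L \<and> (\<forall>t\<in>\<T>. consecutive p L t) \<and>
          (\<forall>t\<in>\<T>. \<forall>x\<in>Y. \<forall>y\<in>Y. \<forall>z\<in>Y. x \<in> t \<longrightarrow> z \<in> t \<longrightarrow> f x = i \<longrightarrow> f y = i \<longrightarrow> i < f z \<longrightarrow>
            p x < p y \<longrightarrow> y \<in> t)" (is "\<exists>p. ?Q p")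
        proof (cases "\<exists>z\<in>Y. i < f z")
          case False
          have "L \<subset> Y"
          proof (cases "i = 0")
            case True
            then show ?thesis using KY by (auto simp: L_def f_def K_def split: if_splits)
          next
            case F: False
            then have "e \<notin> L" using C by (auto simp: L_def f_def)
            then show ?thesis using ea by (auto simp: L_def)
          qed
          from smaller_trace[OF this] False show ?thesis by blast
        next
          case ex: True
          show ?thesis
          proof (cases "i = 0")
            case True
            then have LK: "L = K" by (auto simp: L_def K_def f_def)
            obtain p where "inj_on p L" "\<forall>t\<in>\<T>. consecutive p L t"
              using smaller_trace[OF KY(1)] LK by auto
            moreover have "y \<in> t" if "t \<in> \<T>" "x \<in> Y" "y \<in> Y" "z \<in> Y" "x \<in> t" "z \<in> t"
              "f x = i" "f y = i" "i < f z" for t x y z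
            proof -
              have "x \<in> K" "y \<in> K" "z \<in> C"
                using that LK inC[of x z] by (auto simp: L_def)
              then show ?thesis using K_sub[of t z] that by (auto simp: K_def)
            qed
            ultimately show ?thesis by blast
          next
            case i: False
            \<comment> \<open>By \<open>between\<close>, a set reaching from level \<open>i\<close>
              to any higher level contains \<open>w\<close>, whose level is the lowest above
              \<open>i\<close>; so \<open>w\<close> can stand for all later vertices.\<close>
            obtain w where w: "w \<in> Y" "i < f w" and wmin: "\<And>z. z \<in> Y \<Longrightarrow> i < f z \<Longrightarrow> f w \<le> f z"
              using ex_has_least_nat[of "\<lambda>z. z \<in> Y \<and> i < f z" _ f] ex by blast
            have LC: "L \<subseteq> C" using i by (auto simp: L_def f_def split: if_splits)
            have wC: "w \<in> C" using w by (auto simp: f_def split: if_splits)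
            have wL: "w \<notin> L" using w by (auto simp: L_def)
            define Y' where "Y' = insert w L"
            have linkL: "linked \<T> w u v" if "u \<in> L" "v \<in> L" for u v
            proof -
              have "before x w" if "x \<in> L" for x
              proof -
                have "x \<in> C" "x \<noteq> w" "f x < f w" using that LC wL w by (auto simp: L_def)
                then show ?thesis using f_less_iff[OF _ wC] by blast
              qed
              then have "linked \<T> w e u" "linked \<T> w e v"
                using that by (auto simp: before_def)
              from linked_sym[OF this(1)] this(2) show ?thesis by (rule rtrancl_trans)
            qed
            \<comment> \<open>The extra set \<open>L\<close> forces \<open>w\<close> to one end. It
              is admissible in the induction because every vertex of \<open>L\<close> is linked to
              \<open>e\<close> off \<open>w\<close>, hence any two of them are linked.\<close>
            have "consecutive_ones Y' (insert L ((\<inter>) Y' ` \<T>))"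
            proof (rule smaller)
              show "Y' \<subset> Y" using w LC C ea wC by (auto simp: Y'_def L_def)
              show "t \<subseteq> Y'" if "t \<in> insert L ((\<inter>) Y' ` \<T>)" for t
                using that by (auto simp: Y'_def)
              show "linked \<T> w' u v"
                if A: "w' \<in> Y'" "t \<in> insert L ((\<inter>) Y' ` \<T>)" "w' \<notin> t" "u \<in> t" "v \<in> t" for w' t u v
              proof (cases "t = L")
                case True
                then show ?thesis using A linkL by (auto simp: Y'_def)
              next
                case False
                then obtain s where "s \<in> \<T>" "t = Y' \<inter> s" using A(2) by blast
                then show ?thesis using A by (intro linkedI[of s]) auto
              qed
            qed
            then obtain q where q: "inj_on q Y'" "consecutive q Y' L"
              "\<And>t. t \<in> \<T> \<Longrightarrow> consecutive q Y' (Y' \<inter> t)"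
              unfolding consecutive_ones_def by auto
            have wt: "w \<in> t" if "t \<in> \<T>" "x \<in> Y" "z \<in> Y" "x \<in> t" "z \<in> t" "f x = i" "i < f z"
              for t x z
              using between[of t x z w] that w wmin by blast
            have cons: "consecutive q L t" if "t \<in> \<T>" for t
              using q(3)[OF that] unfolding consecutive_def Y'_def by blast
            have ends: "(\<forall>x\<in>L. q x < q w) \<or> (\<forall>x\<in>L. q w < q x)"
            proof (rule ccontr)
              assume "\<not> ?thesis"
              then obtain x y where "x \<in> L" "y \<in> L" "q w \<le> q x" "q y \<le> q w" by (auto simp: not_less)
              moreover have "q w \<noteq> q x" "q w \<noteq> q y"
                using inj_onD[OF q(1), of w] calculation wL by (auto simp: Y'_def)
              ultimately show False
                using q(2) wL unfolding consecutive_def Y'_def by (metis insertCI nat_less_le)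
            qed
            then show ?thesis
            proof
              assume R: "\<forall>x\<in>L. q x < q w"
              have "?Q q"
              proof (intro conjI ballI impI)
                show "inj_on q L" using q(1) by (auto simp: Y'_def)
                fix t x y z assume A: "t \<in> \<T>" "x \<in> Y" "y \<in> Y" "z \<in> Y" "x \<in> t" "z \<in> t"
                  "f x = i" "f y = i" "i < f z" "q x < q y"
                then have "w \<in> t" "x \<in> L" "y \<in> L" using wt by (auto simp: L_def)
                then show "y \<in> t" using q(3)[OF A(1)] R A
                  unfolding consecutive_def Y'_def by blast
              qed (rule cons)
              then show ?thesis by blast
            next
              assume R: "\<forall>x\<in>L. q w < q x"
              have finL: "finite (q ` L)" using fin by (auto simp: L_def)
              \<comment> \<open>Here \<open>w\<close> came out first, so the order is
                reversed.\<close>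
              define p where "p x = Max (q ` L) - q x" for x
              have p_less: "p x < p y \<longleftrightarrow> q y < q x" if "x \<in> L" "y \<in> L" for x y
                using that Max_ge[OF finL, of "q x"] Max_ge[OF finL, of "q y"]
                unfolding p_def by auto
              have "?Q p"
              proof (intro conjI ballI impI)
                have "inj_on q L" using q(1) by (auto simp: Y'_def)
                then show "inj_on p L"
                  unfolding inj_on_def using p_less by (metis less_irrefl linorder_neqE_nat)
                show "consecutive p L t" if "t \<in> \<T>" for t
                  using cons[OF that] p_less unfolding consecutive_def by blast
                fix t x y z assume A: "t \<in> \<T>" "x \<in> Y" "y \<in> Y" "z \<in> Y" "x \<in> t" "z \<in> t"
                  "f x = i" "f y = i" "i < f z" "p x < p y"
                then have "w \<in> t" "x \<in> L" "y \<in> L" using wt by (auto simp: L_def)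
                then show "y \<in> t" using q(3)[OF A(1)] R A p_less[of x y]
                  unfolding consecutive_def Y'_def by blast
              qed
              then show ?thesis by blast
            qed
          qed
        qed
        then show "\<exists>p. inj_on p {y \<in> Y. f y = i} \<and>
            (\<forall>t\<in>\<T>. consecutive p {y \<in> Y. f y = i} t) \<and>
          (\<forall>t\<in>\<T>. \<forall>x\<in>Y. \<forall>y\<in>Y. \<forall>z\<in>Y. x \<in> t \<longrightarrow> z \<in> t \<longrightarrow> f x = i \<longrightarrow> f y = i \<longrightarrow> i < f z \<longrightarrow>
            p x < p y \<longrightarrow> y \<in> t)"
          unfolding L_def .
      qed
    qed
  qed
qed


section \<open>Isolated cycles and crossed blocks\<close>

text \<open>\<open>\<F>\<close> is meant to consist of traces on the cycle and \<open>w\<close>, so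
  a pair in \<open>\<F>\<close> comes from a set missing \<open>w\<close> and all other vertices.
  The cycle has n + 1 vertices.\<close>

definition isolated_cycle :: "'a set set \<Rightarrow> nat \<Rightarrow> (nat \<Rightarrow> 'a) \<Rightarrow> 'a \<Rightarrow> bool" where
  "isolated_cycle \<F> n v w \<longleftrightarrow> 2 \<le> n \<and> inj_on v {..n} \<and> w \<notin> v ` {..n} \<and>
     (\<forall>i<n. {v i, v (Suc i)} \<in> \<F>) \<and> {v 0, v n} \<in> \<F>"

definition crossed_blocks :: "'a set set \<Rightarrow> 'a \<Rightarrow> 'a \<Rightarrow> 'a \<Rightarrow> 'a \<Rightarrow> 'a \<Rightarrow> 'a \<Rightarrow> bool" where
  "crossed_blocks \<F> x1 y1 x2 y2 x3 y3 \<longleftrightarrow> distinct [x1, y1, x2, y2, x3, y3] \<and>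
     {x1, y1} \<in> \<F> \<and> {x2, y2} \<in> \<F> \<and> {x3, y3} \<in> \<F> \<and> {x1, x2, x3} \<in> \<F>"

definition trace :: "'a set set \<Rightarrow> 'a set \<Rightarrow> 'a set set" where
  "trace \<E> W = (\<lambda>S. S \<inter> W) ` \<E>"

text \<open>An induced path in the bipartite graph of columns and sets, with its connecting sets as
  part of the data. Length 0 is allowed.\<close>

definition induced_path :: "'a set set \<Rightarrow> nat \<Rightarrow> (nat \<Rightarrow> 'a) \<Rightarrow> (nat \<Rightarrow> 'a set) \<Rightarrow> bool" where
  "induced_path \<G> p u S \<longleftrightarrow> inj_on u {..p} \<and>
     (\<forall>i<p. S i \<in> \<G> \<and> (\<forall>m\<le>p. u m \<in> S i \<longleftrightarrow> m = i \<or> m = Suc i))"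

lemma induced_pathD:
  assumes "induced_path \<G> p u S"
  shows "i < p \<Longrightarrow> S i \<in> \<G>"
    and "i < p \<Longrightarrow> m \<le> p \<Longrightarrow> u m \<in> S i \<longleftrightarrow> m = i \<or> m = Suc i"
    and "i \<le> p \<Longrightarrow> j \<le> p \<Longrightarrow> u i = u j \<longleftrightarrow> i = j"
  using assms unfolding induced_path_def inj_on_def by auto

lemma induced_path_subset:
  "induced_path \<G> p u S \<Longrightarrow> (\<And>i. i < p \<Longrightarrow> S i \<in> \<H>) \<Longrightarrow> induced_path \<H> p u S"
  unfolding induced_path_def by blast

lemma induced_path_vertex:
  assumes "induced_path \<G> p u S" "m \<le> p" "0 < p"
  obtains i where "i < p" "u m \<in> S i"
proof (cases "m < p")
  case True
  then show ?thesis using induced_pathD(2)[OF assms(1), of m m] that[of m] assms by simp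
next
  case False
  then show ?thesis
    using induced_pathD(2)[OF assms(1), of "p - 1" m] that[of "p - 1"] assms by simp
qed

lemma induced_path_rev:
  assumes "induced_path \<G> p u S"
  shows "induced_path \<G> p (\<lambda>m. u (p - m)) (\<lambda>i. S (p - Suc i))"
  unfolding induced_path_def
proof (intro conjI allI impI)
  show "inj_on (\<lambda>m. u (p - m)) {..p}"
  proof (rule inj_onI)
    fix m n assume mn: "m \<in> {..p}" "n \<in> {..p}" "u (p - m) = u (p - n)"
    then have "p - m = p - n" using induced_pathD(3)[OF assms, of "p - m" "p - n"] by simp
    then show "m = n" using mn by simp
  qed
  fix i assume i: "i < p"
  then show "S (p - Suc i) \<in> \<G>" using induced_pathD(1)[OF assms] by simp
  fix m assume m: "m \<le> p"
  have "u (p - m) \<in> S (p - Suc i) \<longleftrightarrow> p - m = p - Suc i \<or> p - m = Suc (p - Suc i)"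
    using i by (intro induced_pathD(2)[OF assms]) auto
  also have "\<dots> \<longleftrightarrow> m = i \<or> m = Suc i" using i m by arith
  finally show "u (p - m) \<in> S (p - Suc i) \<longleftrightarrow> m = i \<or> m = Suc i" .
qed

text \<open>A shortest chain is induced: a set containing two of its vertices at distance two or
  more would shorten it.\<close>

lemma induced_path_exists:
  assumes "(a, b) \<in> {(u, v). \<exists>t\<in>\<G>. u \<in> t \<and> v \<in> t}\<^sup>*" (is "_ \<in> ?A\<^sup>*")
  obtains p u S where "induced_path \<G> p u S" "u 0 = a" "u p = b"
proof -
  define A where "A = ?A"
  have A: "(x, y) \<in> A \<longleftrightarrow> (\<exists>t\<in>\<G>. x \<in> t \<and> y \<in> t)" for x y by (simp add: A_def)
  define p where "p = (LEAST n. (a, b) \<in> A ^^ n)"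
  obtain n where "(a, b) \<in> A ^^ n"
    using rtrancl_imp_relpow[OF assms] unfolding A_def by blast
  then have "(a, b) \<in> A ^^ p" unfolding p_def by (rule LeastI)
  then obtain u where u: "u 0 = a" "u p = b" "\<And>i. i < p \<Longrightarrow> (u i, u (Suc i)) \<in> A"
    unfolding relpow_fun_conv by blast
  have short: "p \<le> n" if "(a, b) \<in> A ^^ n" for n
    unfolding p_def using that by (rule Least_le)
  have init: "(a, u i) \<in> A ^^ i" if "i \<le> p" for i
    unfolding relpow_fun_conv using u that by (intro exI[of _ u]) simp
  have final: "(u i, b) \<in> A ^^ (p - i)" if "i \<le> p" for i
    unfolding relpow_fun_conv using u that by (intro exI[of _ "\<lambda>m. u (i + m)"]) simp
  have "\<forall>i. \<exists>t. i < p \<longrightarrow> t \<in> \<G> \<and> u i \<in> t \<and> u (Suc i) \<in> t" using u(3) A by blast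
  then obtain S where S: "\<And>i. i < p \<Longrightarrow> S i \<in> \<G> \<and> u i \<in> S i \<and> u (Suc i) \<in> S i"
    by metis
  have inj: "u i \<noteq> u j" if "i < j" "j \<le> p" for i j
  proof
    assume "u i = u j"
    then have "(a, u j) \<in> A ^^ i" using init[of i] that by simp
    then have "(a, b) \<in> A ^^ (i + (p - j))"
      unfolding relpow_add using final[of j] that by blast
    from short[OF this] that show False by simp
  qed
  have jump: "j \<le> Suc i" if "i < j" "j \<le> p" "t \<in> \<G>" "u i \<in> t" "u j \<in> t" for i j t
  proof -
    have "(u i, u j) \<in> A" using that A by blast
    then have "(a, u j) \<in> A ^^ Suc i" using init[of i] that by auto
    then have "(a, b) \<in> A ^^ (Suc i + (p - j))"
      unfolding relpow_add using final[of j] that by blast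
    from short[OF this] that show ?thesis by simp
  qed
  have "m = i \<or> m = Suc i" if "i < p" "m \<le> p" "u m \<in> S i" for i m
    using jump[of i m "S i"] jump[of m "Suc i" "S i"] S[of i] that
    by (cases i m rule: linorder_cases) auto
  moreover have "inj_on u {..p}"
    using inj by (metis inj_onI atMost_iff linorder_neqE_nat)
  ultimately have "induced_path \<G> p u S"
    unfolding induced_path_def using S by blast
  then show thesis using that u by blast
qed

text \<open>What the ordering argument needs of the realized sets, with no reference to
  rows.\<close>

locale cycle_free =
  fixes X :: "'a set" and \<E> :: "'a set set"
  assumes subset: "S \<in> \<E> \<Longrightarrow> S \<subseteq> X"
    and compl: "S \<in> \<E> \<Longrightarrow> X - S \<in> \<E>"
    and no_cycle: "v ` {..n} \<subseteq> X \<Longrightarrow> w \<in> X \<Longrightarrow>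
      \<not> isolated_cycle (trace \<E> (insert w (v ` {..n}))) n v w"
    and no_blocks: "{x1, y1, x2, y2, x3, y3} \<subseteq> X \<Longrightarrow>
      \<not> crossed_blocks (trace \<E> {x1, y1, x2, y2, x3, y3}) x1 y1 x2 y2 x3 y3"
begin

text \<open>The form in which \<open>no_cycle\<close> is applied: the sets live on all of
  \<open>X\<close>, and only their behaviour on the cycle and at \<open>w\<close> is
  checked.\<close>

lemma cycle_absurd:
  assumes "2 \<le> n" "inj_on v {..n}" "v ` {..n} \<subseteq> X" "w \<in> X" "w \<notin> v ` {..n}"
    and edges: "\<And>i. i < n \<Longrightarrow> \<exists>S\<in>\<E>. w \<notin> S \<and> (\<forall>m\<le>n. v m \<in> S \<longleftrightarrow> m = i \<or> m = Suc i)"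
    and close: "\<exists>S\<in>\<E>. w \<notin> S \<and> (\<forall>m\<le>n. v m \<in> S \<longleftrightarrow> m = 0 \<or> m = n)"
  shows False
proof -
  let ?W = "insert w (v ` {..n})"
  have "{v i, v (Suc i)} \<in> trace \<E> ?W" if i: "i < n" for i
  proof -
    obtain S where S: "S \<in> \<E>" "w \<notin> S" "\<And>m. m \<le> n \<Longrightarrow> v m \<in> S \<longleftrightarrow> m = i \<or> m = Suc i"
      using edges[OF i] by blast
    then have "S \<inter> ?W = {v i, v (Suc i)}" using i by auto
    then show ?thesis using S(1) unfolding trace_def by (metis image_eqI)
  qed
  moreover obtain S where S: "S \<in> \<E>" "w \<notin> S" "\<And>m. m \<le> n \<Longrightarrow> v m \<in> S \<longleftrightarrow> m = 0 \<or> m = n"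
    using close by blast
  then have "S \<inter> ?W = {v 0, v n}" by auto
  then have "{v 0, v n} \<in> trace \<E> ?W" using S(1) unfolding trace_def by (metis image_eqI)
  ultimately have "isolated_cycle (trace \<E> ?W) n v w"
    using assms unfolding isolated_cycle_def by simp
  then show False using no_cycle assms by blast
qed

lemma blocks_absurd:
  assumes "distinct [x1, y1, x2, y2, x3, y3]" "{x1, y1, x2, y2, x3, y3} \<subseteq> X"
    and "A \<in> \<E>" "x1 \<in> A" "y1 \<in> A" "x2 \<notin> A" "y2 \<notin> A" "x3 \<notin> A" "y3 \<notin> A"
    and "B \<in> \<E>" "x1 \<notin> B" "y1 \<notin> B" "x2 \<in> B" "y2 \<in> B" "x3 \<notin> B" "y3 \<notin> B"
    and "C \<in> \<E>" "x1 \<notin> C" "y1 \<notin> C" "x2 \<notin> C" "y2 \<notin> C" "x3 \<in> C" "y3 \<in> C"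
    and "D \<in> \<E>" "x1 \<in> D" "y1 \<notin> D" "x2 \<in> D" "y2 \<notin> D" "x3 \<in> D" "y3 \<notin> D"
  shows False
proof -
  let ?W = "{x1, y1, x2, y2, x3, y3}"
  have "A \<inter> ?W = {x1, y1}" "B \<inter> ?W = {x2, y2}" "C \<inter> ?W = {x3, y3}" "D \<inter> ?W = {x1, x2, x3}"
    using assms by auto
  then have "crossed_blocks (trace \<E> ?W) x1 y1 x2 y2 x3 y3"
    using assms unfolding crossed_blocks_def trace_def by (metis (no_types, lifting) image_eqI)
  then show False using no_blocks assms(2) by blast
qed

text \<open>The complements of the three sets miss \<open>w\<close> and contain two of
  \<open>a\<close>, \<open>b\<close>, \<open>c\<close> each: a triangle with \<open>w\<close>
  outside.\<close>

lemma star_absurd: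
  assumes "A \<in> \<E>" "B \<in> \<E>" "C \<in> \<E>" "a \<in> X" "b \<in> X" "c \<in> X" "w \<in> X"
    and "w \<in> A" "w \<in> B" "w \<in> C" "a \<in> A" "a \<notin> B" "a \<notin> C"
    and "b \<notin> A" "b \<in> B" "b \<notin> C" "c \<notin> A" "c \<notin> B" "c \<in> C"
  shows False
proof (rule cycle_absurd[of 2 "(!) [a, b, c]" w])
  have idx: "i = 0 \<or> i = 1" if "i < 2" for i :: nat using that by linarith
  have le2: "(m \<le> 2) = (m = 0 \<or> m = 1 \<or> m = 2)" for m :: nat by linarith
  have W: "{..2::nat} = {0, 1, 2}" by auto
  show "inj_on ((!) [a, b, c]) {..2}" using assms unfolding W by (auto simp: inj_on_def)
  show "(!) [a, b, c] ` {..2} \<subseteq> X" "w \<notin> (!) [a, b, c] ` {..2}"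
    using assms unfolding W by auto
  show "\<exists>S\<in>\<E>. w \<notin> S \<and> (\<forall>m\<le>2. [a, b, c] ! m \<in> S \<longleftrightarrow> m = 0 \<or> m = 2)"
    using assms compl[of B] by (intro bexI[of _ "X - B"]) (auto simp: le2)
  show "\<exists>S\<in>\<E>. w \<notin> S \<and> (\<forall>m\<le>2. [a, b, c] ! m \<in> S \<longleftrightarrow> m = i \<or> m = Suc i)" if "i < 2" for i
    using idx[OF that]
  proof
    assume "i = 0"
    then show ?thesis using assms compl[of C] by (intro bexI[of _ "X - C"]) (auto simp: le2)
  next
    assume "i = 1"
    then show ?thesis using assms compl[of A] by (intro bexI[of _ "X - A"]) (auto simp: le2)
  qed
qed (use assms in auto)

lemma path_subset:
  assumes "induced_path \<E> p u S" "0 < p"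
  shows "u ` {..p} \<subseteq> X"
  using induced_path_vertex[OF assms(1) _ assms(2)] induced_pathD(1)[OF assms(1)] subset by blast

text \<open>A gap of \<open>t\<close> on the path, taken between two consecutive visits
  \<open>u a\<close> and \<open>u b\<close>, would be closed by \<open>t\<close> to a cycle with
  \<open>w\<close> outside.\<close>

lemma path_interval:
  assumes path: "induced_path \<E> p u S" and w: "\<And>i. i < p \<Longrightarrow> w \<notin> S i" "w \<in> X"
    and t: "t \<in> \<E>" "w \<notin> t" and ij: "u i \<in> t" "u j \<in> t" "i \<le> l" "l \<le> j" "j \<le> p"
  shows "u l \<in> t"
proof (rule ccontr)
  assume l: "u l \<notin> t"
  then have "i < l" "l < j" using ij by (metis nat_less_le)+
  define a where "a = (GREATEST a. a < l \<and> u a \<in> t)"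
  have a: "a < l" "u a \<in> t"
    using GreatestI_nat[of "\<lambda>a. a < l \<and> u a \<in> t" i l] \<open>i < l\<close> ij unfolding a_def by auto
  have a_max: "m \<le> a" if "m < l" "u m \<in> t" for m
    using Greatest_le_nat[of "\<lambda>a. a < l \<and> u a \<in> t" m l] that unfolding a_def by auto
  define b where "b = (LEAST b. l < b \<and> u b \<in> t)"
  have b: "l < b" "u b \<in> t"
    using LeastI[of "\<lambda>b. l < b \<and> u b \<in> t" j] \<open>l < j\<close> ij unfolding b_def by auto
  have b_min: "b \<le> m" if "l < m" "u m \<in> t" for m
    using Least_le[of "\<lambda>b. l < b \<and> u b \<in> t" m] that unfolding b_def by auto
  have bp: "b \<le> p" using b_min[of j] ij \<open>l < j\<close> by linarith
  have ut: "u m \<in> t \<longleftrightarrow> m = a \<or> m = b" if "a \<le> m" "m \<le> b" for m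
    using a b a_max[of m] b_min[of m] that l by (cases m l rule: linorder_cases) auto
  show False
  proof (rule cycle_absurd[of "b - a" "\<lambda>m. u (a + m)" w])
    show "2 \<le> b - a" using a b by simp
    show "inj_on (\<lambda>m. u (a + m)) {..b - a}"
      using induced_pathD(3)[OF path] a b bp by (auto simp: inj_on_def)
    show "(\<lambda>m. u (a + m)) ` {..b - a} \<subseteq> X"
      using path_subset[OF path] a b bp by force
    have "w \<noteq> u m" if "m \<le> p" for m
    proof -
      have "0 < p" using \<open>l < j\<close> ij by simp
      with induced_path_vertex[OF path that] obtain i where "i < p" "u m \<in> S i" .
      then show ?thesis using w(1) by blast
    qed
    moreover have "a + m \<le> p" if "m \<le> b - a" for m using that a b bp by simp
    ultimately show "w \<notin> (\<lambda>m. u (a + m)) ` {..b - a}" by blast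
    show "\<exists>S\<in>\<E>. w \<notin> S \<and> (\<forall>m\<le>b - a. u (a + m) \<in> S \<longleftrightarrow> m = i \<or> m = Suc i)" if "i < b - a" for i
      using induced_pathD(1,2)[OF path, of "a + i"] w that a b bp by (intro bexI[of _ "S (a + i)"]) auto
    show "\<exists>S\<in>\<E>. w \<notin> S \<and> (\<forall>m\<le>b - a. u (a + m) \<in> S \<longleftrightarrow> m = 0 \<or> m = b - a)"
      using ut t a b by (intro bexI[of _ t]) auto
  qed (rule w)
qed

text \<open>This is \<open>path_interval\<close> for the complement of \<open>t\<close>, which
  misses \<open>w\<close> and contains both ends of the path.\<close>

lemma path_disjoint:
  assumes path: "induced_path \<E> p u S" "0 < p"
    and w: "\<And>i. i < p \<Longrightarrow> w \<notin> S i" "w \<in> X"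
    and t: "t \<in> \<E>" "w \<in> t" and ends: "u 0 \<notin> t" "u p \<notin> t" and "m \<le> p"
  shows "u m \<notin> t"
proof -
  have X: "u i \<in> X" if "i \<le> p" for i using path_subset[OF path] that by auto
  have "u m \<in> X - t"
    by (rule path_interval[OF path(1) w, of "X - t" 0 p]) (use assms X compl in auto)
  then show ?thesis by simp
qed

end


section \<open>Paths between the vertices of an asteroidal triple\<close>

context cycle_free
begin

text \<open>The route from \<open>u (p - 1)\<close> back along \<open>u\<close> to
  \<open>u 0\<close> and on along \<open>q\<close> to \<open>q k\<close> need not be induced, but a
  shortest route through the same sets is. The set \<open>t\<close> from \<open>q k\<close> to
  \<open>z'\<close> and \<open>S (p - 1)\<close> from \<open>z'\<close> to \<open>u (p - 1)\<close>
  close it to a cycle with \<open>c\<close> outside.\<close>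

lemma detour_absurd:
  assumes u: "induced_path \<E> p u S" "2 \<le> p" "\<And>i. i < p \<Longrightarrow> c \<notin> S i"
    and q: "induced_path \<E> l q Q" "q 0 = u 0" "\<And>i. i < l \<Longrightarrow> c \<notin> Q i" "0 < l"
    and c: "c \<in> X"
    and z': "z' \<in> S (p - 1)" "\<And>i. i < p - 1 \<Longrightarrow> z' \<notin> S i"
    and off: "\<And>m. m \<le> l \<Longrightarrow> q m \<notin> S (p - 1)"
    and t: "t \<in> \<E>" "c \<notin> t" "z' \<in> t" "\<And>m. m \<le> p \<Longrightarrow> u m \<notin> t"
    and k: "k \<le> l" "q k \<in> t" "\<And>m. m < k \<Longrightarrow> q m \<notin> t" "\<And>i. i < k \<Longrightarrow> z' \<notin> Q i"
  shows False
proof -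
  define \<G> where "\<G> = S ` {..<p - 1} \<union> Q ` {..<k}"
  \<comment> \<open>\<open>u p\<close> is left out, since \<open>S (p - 1)\<close> may meet the
    route in \<open>u (p - 1)\<close> only. The sets are cut down to \<open>V\<close> to keep the
    shortest route from using other columns.\<close>
  define V where "V = u ` {..<p} \<union> q ` {..k}"
  define A where "A = {(a, b). \<exists>g\<in>(\<inter>) V ` \<G>. a \<in> g \<and> b \<in> g}"
  have A: "(a, b) \<in> A" if "g \<in> \<G>" "a \<in> g" "b \<in> g" "a \<in> V" "b \<in> V" for a b g
  proof -
    have "V \<inter> g \<in> (\<inter>) V ` \<G>" using that(1) by (rule imageI)
    then show ?thesis using that(2-5) unfolding A_def by auto
  qed
  have G: "g \<in> \<E>" "c \<notin> g" "z' \<notin> g" if "g \<in> \<G>" for g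
    using that u q k z' induced_pathD(1)[OF u(1)] induced_pathD(1)[OF q(1)] by (auto simp: \<G>_def)
  have "(u (p - 1), u (p - 1 - m)) \<in> A\<^sup>*" if "m \<le> p - 1" for m
    using that
  proof (induction m)
    case (Suc m)
    let ?i = "p - 1 - Suc m"
    have i: "Suc ?i = p - 1 - m" "?i < p - 1" using Suc.prems by auto
    have "(u (Suc ?i), u ?i) \<in> A"
      using i induced_pathD(2)[OF u(1), of ?i]
      by (intro A[of "S ?i"]) (auto simp: \<G>_def V_def)
    then show ?case using Suc i by (metis Suc_leD rtrancl.rtrancl_into_rtrancl)
  qed simp
  from this[of "p - 1"] have "(u (p - 1), q 0) \<in> A\<^sup>*" using q(2) by simp
  moreover have "(q 0, q m) \<in> A\<^sup>*" if "m \<le> k" for m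
    using that
  proof (induction m)
    case (Suc m)
    have "(q m, q (Suc m)) \<in> A"
      using Suc.prems k(1) induced_pathD(2)[OF q(1), of m]
      by (intro A[of "Q m"]) (auto simp: \<G>_def V_def)
    then show ?case using Suc by (metis Suc_leD rtrancl.rtrancl_into_rtrancl)
  qed simp
  ultimately have "(u (p - 1), q k) \<in> A\<^sup>*" by (meson order_refl rtrancl_trans)
  then obtain n v M where path: "induced_path ((\<inter>) V ` \<G>) n v M" "v 0 = u (p - 1)" "v n = q k"
    unfolding A_def by (rule induced_path_exists)
  have "0 < n"
    using path t(4)[of "p - 1"] k(2) u(2) by (metis diff_le_self gr_zeroI)
  have vV: "v m \<in> V" if m: "m \<le> n" for m
  proof -
    obtain i where "i < n" "v m \<in> M i"
      using induced_path_vertex[OF path(1) m \<open>0 < n\<close>] .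
    then show ?thesis using induced_pathD(1)[OF path(1), of i] by auto
  qed
  have V_t: "a = q k" if "a \<in> V" "a \<in> t" for a
  proof -
    have "a \<notin> u ` {..<p}" using that t(4) by auto
    with \<open>a \<in> V\<close> obtain m where "m \<le> k" "a = q m" by (auto simp: V_def)
    then show ?thesis using that k(3)[of m] by (cases "m = k") auto
  qed
  have V_last: "a = u (p - 1)" if "a \<in> V" "a \<in> S (p - 1)" for a
  proof -
    have "a \<notin> q ` {..k}" using off that k(1) by auto
    with \<open>a \<in> V\<close> obtain m where "m < p" "a = u m" by (auto simp: V_def)
    then show ?thesis
      using induced_pathD(2)[OF u(1), of "p - 1" m] that u(2) by auto
  qed
  have VX: "V \<subseteq> X"
    using path_subset[OF u(1)] path_subset[OF q(1)] u(2) q(4) k(1) by (force simp: V_def)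
  have cV: "c \<notin> V"
  proof -
    have "c \<noteq> u m" if m: "m < p" for m
      using induced_pathD(2)[OF u(1) m, of m] u(3)[OF m] m by auto
    moreover have "c \<noteq> q m" if m: "m \<le> k" for m
    proof -
      have "m \<le> l" using m k(1) by simp
      then obtain i where "i < l" "q m \<in> Q i" using induced_path_vertex[OF q(1) _ q(4)] by blast
      then show ?thesis using q(3) by blast
    qed
    ultimately show ?thesis by (auto simp: V_def)
  qed
  have z'V: "z' \<notin> V"
    using V_t[of z'] V_last[of z'] t z'(1) u(2) by (metis diff_le_self)
  define w where "w m = (if m \<le> n then v m else z')" for m
  show False
  proof (rule cycle_absurd[of "Suc n" w c])
    show "2 \<le> Suc n" using \<open>0 < n\<close> by simp
    show "inj_on w {..Suc n}"
    proof (rule inj_onI)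
      fix i j assume ij: "i \<in> {..Suc n}" "j \<in> {..Suc n}" "w i = w j"
      have "\<not> (i \<le> n \<and> j = Suc n)" "\<not> (j \<le> n \<and> i = Suc n)"
        using ij(3) vV[of i] vV[of j] z'V by (auto simp: w_def)
      then show "i = j"
        using ij induced_pathD(3)[OF path(1), of i j] by (auto simp: w_def le_Suc_eq)
    qed
    show "w ` {..Suc n} \<subseteq> X"
      using vV VX t(1,3) subset by (auto simp: w_def)
    show "c \<notin> w ` {..Suc n}" using vV cV t(2,3) by (auto simp: w_def)
    show "\<exists>S\<in>\<E>. c \<notin> S \<and> (\<forall>m\<le>Suc n. w m \<in> S \<longleftrightarrow> m = i \<or> m = Suc i)" if "i < Suc n" for i
    proof (cases "i < n")
      case True
      obtain g where g: "g \<in> \<G>" "M i = V \<inter> g" using induced_pathD(1)[OF path(1) True] by blast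
      have "w m \<in> g \<longleftrightarrow> m = i \<or> m = Suc i" if "m \<le> Suc n" for m
      proof (cases "m \<le> n")
        case m: True
        then show ?thesis using induced_pathD(2)[OF path(1) True m] vV[OF m] g by (simp add: w_def)
      next
        case False
        then show ?thesis using G(3)[OF g(1)] True by (simp add: w_def)
      qed
      then show ?thesis using G[OF g(1)] by blast
    next
      case False
      then have i: "i = n" using that by simp
      have "w m \<in> t \<longleftrightarrow> m = i \<or> m = Suc i" if "m \<le> Suc n" for m
      proof (cases "m \<le> n")
        case m: True
        have "v m \<in> t \<longleftrightarrow> m = n"
          using V_t[OF vV[OF m]] path(3) k(2) induced_pathD(3)[OF path(1), of m n] m by auto
        then show ?thesis using i m by (simp add: w_def)
      next
        case False
        then show ?thesis using t(3) i that by (simp add: w_def)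
      qed
      then show ?thesis using t by blast
    qed
    have "w m \<in> S (p - 1) \<longleftrightarrow> m = 0 \<or> m = Suc n" if "m \<le> Suc n" for m
    proof (cases "m \<le> n")
      case m: True
      have "u (p - 1) \<in> S (p - 1)" using induced_pathD(2)[OF u(1), of "p - 1" "p - 1"] u(2) by simp
      then have "v m \<in> S (p - 1) \<longleftrightarrow> m = 0"
        using V_last[OF vV[OF m]] path(2) induced_pathD(3)[OF path(1), of m 0] m by auto
      then show ?thesis using m by (simp add: w_def)
    next
      case False
      then show ?thesis using z'(1) that by (simp add: w_def)
    qed
    then show "\<exists>S\<in>\<E>. c \<notin> S \<and> (\<forall>m\<le>Suc n. w m \<in> S \<longleftrightarrow> m = 0 \<or> m = Suc n)"
      using u induced_pathD(1)[OF u(1), of "p - 1"] by (intro bexI[of _ "S (p - 1)"]) auto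
  qed (rule c)
qed

text \<open>
  A vertex \<open>z\<close> off the path \<open>u\<close> is attached by \<open>T\<close> to a vertex \<open>z'\<close> that the path meets. In
  \<open>attached_end_absurd\<close> the path meets it only in its last set.
\<close>

lemma attached_end_absurd:
  assumes u: "induced_path \<E> p u S" "2 \<le> p" "\<And>i. i < p \<Longrightarrow> c \<notin> S i" "\<And>i. i < p \<Longrightarrow> z \<notin> S i"
    and c: "c \<in> X" "c \<noteq> u 0" and z: "z \<in> X" "z \<noteq> c"
    and linked: "linked {E \<in> \<E>. c \<notin> E} (u p) (u 0) z"
    and T: "T \<in> \<E>" "c \<notin> T" "z \<in> T" "z' \<in> T" "\<And>m. m \<le> p \<Longrightarrow> u m \<notin> T"
    and z': "z' \<in> S (p - 1)" "\<And>i. i < p - 1 \<Longrightarrow> z' \<notin> S i"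
  shows False
proof -
  note uD = induced_pathD[OF u(1)]
  have last: "S (p - 1) \<in> \<E>" "u (p - 1) \<in> S (p - 1)" "u p \<in> S (p - 1)" "u 0 \<notin> S (p - 1)"
    using uD(1)[of "p - 1"] uD(2)[of "p - 1"] u(2) by auto
  have ux: "\<exists>i<p. u m \<in> S i" if "m \<le> p" for m
    using induced_path_vertex[OF u(1) that] u(2) by (metis gr_zeroI not_numeral_le_zero)
  have unz: "u m \<noteq> z" "u m \<noteq> c" if "m \<le> p" for m using ux[OF that] u(3,4) by blast+
  have uX: "u m \<in> X" if "m \<le> p" for m using path_subset[OF u(1)] u(2) that by auto
  have "(u 0, z) \<in> {(a, b). \<exists>t\<in>{E \<in> \<E>. c \<notin> E \<and> u p \<notin> E}. a \<in> t \<and> b \<in> t}\<^sup>*"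
    using linked unfolding touch_def by (rule rtrancl_mono[THEN subsetD, rotated]) blast
  then obtain l q Q where q0: "induced_path {E \<in> \<E>. c \<notin> E \<and> u p \<notin> E} l q Q" "q 0 = u 0" "q l = z"
    by (rule induced_path_exists)
  have q: "induced_path \<E> l q Q" "\<And>i. i < l \<Longrightarrow> c \<notin> Q i" "\<And>i. i < l \<Longrightarrow> u p \<notin> Q i"
    using induced_pathD(1)[OF q0(1)] induced_path_subset[OF q0(1)] by blast+
  note qD = induced_pathD[OF q(1)]
  have l: "0 < l" using q0 unz[of 0] by (metis gr_zeroI le0)
  have qX: "q m \<in> X" if "m \<le> l" for m using path_subset[OF q(1) l] that by auto
  have qQ: "\<exists>i<l. q m \<in> Q i" if m: "m \<le> l" for m
  proof -
    obtain i where "i < l" "q m \<in> Q i" using induced_path_vertex[OF q(1) m l] .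
    then show ?thesis by blast
  qed
  have q_ne: "q m \<noteq> c" "q m \<noteq> u p" if "m \<le> l" for m using qQ[OF that] q(2,3) by metis+
  \<comment> \<open>\<open>S (p - 1)\<close> contains \<open>u p\<close>, which the route
    \<open>q\<close> avoids, and neither end of \<open>q\<close>.\<close>
  have off: "q m \<notin> S (p - 1)" if "m \<le> l" for m
    by (rule path_disjoint[OF q(1) l q(3) uX[of p] last(1,3)]) (use q0 last u(2,4) that in auto)
  then have q_z': "q m \<noteq> z'" if "m \<le> l" for m using z'(1) that by blast
  define k where "k = (LEAST k. q k \<in> T)"
  have "q l \<in> T" using T(3) q0(3) by simp
  then have k: "q k \<in> T" "k \<le> l" unfolding k_def by (rule LeastI, rule Least_le)
  have k_min: "q m \<notin> T" if "m < k" for m using that unfolding k_def by (rule not_less_Least)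
  have detour: False
    if "t \<in> \<E>" "c \<notin> t" "z' \<in> t" "\<And>m. m \<le> p \<Longrightarrow> u m \<notin> t" "k \<le> l" "q k \<in> t"
      "\<And>m. m < k \<Longrightarrow> q m \<notin> t" "\<And>i. i < k \<Longrightarrow> z' \<notin> Q i" for t k
    by (rule detour_absurd[of p u S c l q Q z' t k])
      (assumption | rule u(1-3) q(1,2) q0(2) l c(1) z' off that)+
  \<comment> \<open>Otherwise \<open>T\<close> would complete the detour. The first set of
    \<open>q\<close> through \<open>z'\<close> is taken below.\<close>
  have "\<exists>i<k. z' \<in> Q i" using detour[OF T(1,2,4,5) k(2,1) k_min] by blast
  then obtain i0 where i0: "i0 < k \<and> z' \<in> Q i0" by blast
  define i where "i = (LEAST i. i < k \<and> z' \<in> Q i)"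
  have i: "i < k" "z' \<in> Q i" using LeastI[of "\<lambda>i. i < k \<and> z' \<in> Q i", OF i0] unfolding i_def by auto
  have i_min: "z' \<notin> Q j" if "j < i" for j
    using not_less_Least[of j "\<lambda>i. i < k \<and> z' \<in> Q i"] that i(1) unfolding i_def by simp
  have il: "i < l" using i k by simp
  note Qi = qD(1)[OF il] q(2)[OF il] q(3)[OF il]
  have "z' \<noteq> z" using z'(1) u(2,4) by auto
  have z'X: "z' \<in> X" using T subset by blast
  have z'u: "z' \<noteq> u m" if "m \<le> p" for m using T(4,5) that by blast
  show False
  proof (cases "z \<in> Q i")
    case False
    \<comment> \<open>Following \<open>q\<close> up to \<open>Q i\<close>, then \<open>z'\<close>,
      then \<open>z\<close> by way of \<open>T\<close> is an induced path off \<open>u p\<close>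
      whose ends lie outside \<open>S (p - 1)\<close>, yet \<open>z'\<close> lies inside.\<close>
    define v where "v m = (if m \<le> i then q m else if m = Suc i then z' else z)" for m
    define R where "R j = (if j \<le> i then Q j else T)" for j
    have z_early: "z \<notin> Q j" if "j \<le> i" for j
    proof (cases "j = i")
      case True
      then show ?thesis using False by simp
    next
      case False
      then have "j < l" "l \<noteq> j" "l \<noteq> Suc j" using that il by auto
      then show ?thesis using qD(2)[of j l] q0(3) by simp
    qed
    have "induced_path \<E> (Suc (Suc i)) v R"
      unfolding induced_path_def
    proof (intro conjI allI impI)
      show "inj_on v {..Suc (Suc i)}"
      proof (rule inj_onI)
        fix a b assume ab: "a \<in> {..Suc (Suc i)}" "b \<in> {..Suc (Suc i)}" "v a = v b"
        have "q m \<noteq> z" if "m \<le> i" for m using qD(3)[of m l] q0(3) il that by auto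
        moreover have "q m \<noteq> z'" if "m \<le> i" for m using q_z' il that by simp
        ultimately show "a = b"
          using ab \<open>z' \<noteq> z\<close> qD(3)[of a b] il by (auto simp: v_def le_Suc_eq split: if_splits)
      qed
      fix j assume j: "j < Suc (Suc i)"
      show "R j \<in> \<E>" using qD(1) il T(1) by (simp add: R_def)
      fix m assume m: "m \<le> Suc (Suc i)"
      show "v m \<in> R j \<longleftrightarrow> m = j \<or> m = Suc j"
      proof (cases "j \<le> i")
        case True
        consider "m \<le> i" | "m = Suc i" | "m = Suc (Suc i)" using m by linarith
        then show ?thesis
        proof cases
          case 1
          then show ?thesis using True qD(2)[of j m] il by (simp add: v_def R_def)
        next
          case 2
          then show ?thesis using True i(2) i_min[of j] by (cases "j = i") (auto simp: v_def R_def)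
        next
          case 3
          then show ?thesis using True z_early by (simp add: v_def R_def)
        qed
      next
        case False
        then have "j = Suc i" using j by simp
        then show ?thesis using m T(3,4) k_min[of m] i(1) by (auto simp: v_def R_def)
      qed
    qed
    moreover have "u p \<notin> R j" for j
      using q(3)[of j] il T(5)[of p] by (simp add: R_def)
    ultimately have "v (Suc i) \<notin> S (p - 1)"
      using path_disjoint[of "Suc (Suc i)" v R "u p" "S (p - 1)" "Suc i"] uX[of p] last q0(2) u(2,4)
      by (simp add: v_def)
    then show False using z'(1) by (simp add: v_def)
  next
    case z_in: True
    then have l_eq: "l = Suc i" using qD(2)[OF il, of l] q0(3) il by simp
    show False
    proof (cases "i = 0")
      case False
      \<comment> \<open>Here \<open>Q i\<close>, which joins \<open>q i\<close> to
        \<open>z'\<close>, takes the place of \<open>T\<close> in the detour.\<close>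
      have "q 0 \<notin> Q i" using qD(2)[OF il, of 0] False by simp
      then have Qu: "u m \<notin> Q i" if "m \<le> p" for m
        using path_disjoint[OF u(1) _ u(4) z(1) Qi(1) z_in, of m] u(2) q0(2) Qi(3) that by simp
      have "q m \<notin> Q i" if "m < i" for m using qD(2)[OF il, of m] that il by simp
      then show False
        using detour[OF Qi(1,2) i(2) Qu, of i] il i_min qD(2)[OF il, of i] by simp
    next
      case i0: True
      \<comment> \<open>\<open>Q 0\<close> contains \<open>u 0\<close>, \<open>z'\<close> and
        \<open>z\<close>. If \<open>u j\<close> is its last vertex on the path, the stretch from
        \<open>u j\<close> to \<open>u (p - 1)\<close> together with \<open>z'\<close> is a cycle
        closed by \<open>Q 0\<close>, unless \<open>j = p - 1\<close>.\<close>
      define j where "j = (GREATEST j. j < p \<and> u j \<in> Q 0)"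
      have "u 0 \<in> Q 0" using qD(2)[of 0 0] q0(2) l by simp
      then have j: "j < p" "u j \<in> Q 0" and j_max: "\<And>m. m < p \<Longrightarrow> u m \<in> Q 0 \<Longrightarrow> m \<le> j"
        using GreatestI_nat[of "\<lambda>j. j < p \<and> u j \<in> Q 0" 0 p] u(2)
          Greatest_le_nat[of "\<lambda>j. j < p \<and> u j \<in> Q 0" _ p] unfolding j_def by auto
      have Q0: "Q 0 \<in> \<E>" "c \<notin> Q 0" "u p \<notin> Q 0" "z' \<in> Q 0" "z \<in> Q 0" using Qi i z_in i0 by auto
      show False
      proof (cases "j = p - 1")
        case False
        then have jp: "Suc j \<le> p - 1" using j by simp
        define v where "v m = (if m \<le> p - 1 - j then u (j + m) else z')" for m
        show False
        proof (rule cycle_absurd[of "p - j" v c])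
          show "2 \<le> p - j" using jp by simp
          show "inj_on v {..p - j}"
          proof (rule inj_onI)
            fix a b assume ab: "a \<in> {..p - j}" "b \<in> {..p - j}" "v a = v b"
            then have "j + a \<le> p" "j + b \<le> p" using jp by auto
            then show "a = b"
              using ab z'u[of "j + a"] z'u[of "j + b"] uD(3)[of "j + a" "j + b"]
              by (auto simp: v_def split: if_splits)
          qed
          show "v ` {..p - j} \<subseteq> X" using uX z'X jp by (auto simp: v_def)
          have "v m \<noteq> c" if "m \<le> p - j" for m
            using unz(2)[of "j + m"] T(2,4) that jp by (auto simp: v_def)
          then show "c \<notin> v ` {..p - j}" by auto
          show "\<exists>E\<in>\<E>. c \<notin> E \<and> (\<forall>m\<le>p - j. v m \<in> E \<longleftrightarrow> m = a \<or> m = Suc a)" if "a < p - j" for a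
          proof (cases "a < p - 1 - j")
            case True
            have "v m \<in> S (j + a) \<longleftrightarrow> m = a \<or> m = Suc a" if "m \<le> p - j" for m
            proof (cases "m \<le> p - 1 - j")
              case m: True
              then have "j + m \<le> p" "j + a < p" using True by linarith+
              then have "u (j + m) \<in> S (j + a) \<longleftrightarrow> m = a \<or> m = Suc a"
                using uD(2)[of "j + a" "j + m"] by simp
              then show ?thesis using m by (simp add: v_def)
            next
              case False
              then show ?thesis using z'(2)[of "j + a"] True by (simp add: v_def)
            qed
            then show ?thesis
              using uD(1)[of "j + a"] u(3)[of "j + a"] True by (intro bexI[of _ "S (j + a)"]) simp_all
          next
            case False
            then have a: "a = p - 1 - j" using that by simp
            have "v m \<in> S (p - 1) \<longleftrightarrow> m = a \<or> m = Suc a" if "m \<le> p - j" for m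
              using uD(2)[of "p - 1" "j + m"] z'(1) a that jp by (auto simp: v_def)
            then show ?thesis using last(1) u(3)[of "p - 1"] u(2) by auto
          qed
          have "v m \<in> Q 0 \<longleftrightarrow> m = 0 \<or> m = p - j" if "m \<le> p - j" for m
            using j j_max[of "j + m"] Q0 that jp by (auto simp: v_def)
          then show "\<exists>E\<in>\<E>. c \<notin> E \<and> (\<forall>m\<le>p - j. v m \<in> E \<longleftrightarrow> m = 0 \<or> m = p - j)"
            using Q0 by auto
        qed (rule c(1))
      next
        case True
        have in0: "u (p - 2) \<in> Q 0"
          by (rule path_interval[OF u(1,3) c(1) Q0(1,2), of 0 "p - 1"])
            (use \<open>u 0 \<in> Q 0\<close> j True in auto)
        have S2: "S (p - 2) \<in> \<E>" "u (p - 1) \<in> S (p - 2)" "u (p - 2) \<in> S (p - 2)" "u p \<notin> S (p - 2)"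
          "u (p - 2) \<notin> S (p - 1)"
          using uD(1)[of "p - 2"] uD(2)[of "p - 2"] uD(2)[of "p - 1" "p - 2"] u(2) by auto
        have dist: "u p \<noteq> u (p - 1)" "u p \<noteq> u (p - 2)" "u (p - 1) \<noteq> u (p - 2)"
          using uD(3)[of p "p - 1"] uD(3)[of p "p - 2"] uD(3)[of "p - 1" "p - 2"] u(2) by auto
        have le: "p - 2 < p - 1" "p - 2 < p" "p - 1 < p" "p - 1 \<le> p" "p - 2 \<le> p" using u(2) by linarith+
        have "u (p - 1) \<in> Q 0" using j True by simp
        moreover have "c \<noteq> z'" using T by blast
        \<comment> \<open>The blocks come from \<open>S (p - 2)\<close>, from \<open>T\<close>, and,
          for \<open>u p\<close> and \<open>c\<close>, from the complement of \<open>Q 0\<close>;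
          the crossing set is \<open>S (p - 1)\<close>.\<close>
        ultimately show False
          by (intro blocks_absurd[of "u (p - 1)" "u (p - 2)" z' z "u p" c "S (p - 2)" T "X - Q 0" "S (p - 1)"])
            (simp_all del: One_nat_def add: le S2 dist dist[symmetric] in0 T last Q0 z' z'u z'u[symmetric] z'X unz
              unz[symmetric] uX c z \<open>z' \<noteq> z\<close> \<open>z' \<noteq> z\<close>[symmetric] z(2)[symmetric] u(3,4) compl)
      qed
    qed
  qed
qed

text \<open>Only one set \<open>S k\<close> of the path contains \<open>z'\<close>. If it is the
  last or the first, the previous lemma applies to the path or its reverse; otherwise
  \<open>S k\<close> crosses the blocks given by its two neighbours on the path and by
  \<open>T\<close>.\<close>

lemma attached_absurd:
  assumes u: "induced_path \<E> p u S" "2 \<le> p" "\<And>i. i < p \<Longrightarrow> c \<notin> S i" "\<And>i. i < p \<Longrightarrow> z \<notin> S i"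
    and c: "c \<in> X" and z: "z \<in> X" "z \<noteq> c"
    and linked: "linked {E \<in> \<E>. c \<notin> E} (u p) (u 0) z" "linked {E \<in> \<E>. c \<notin> E} (u 0) (u p) z"
    and T: "T \<in> \<E>" "c \<notin> T" "z \<in> T" "z' \<in> T" "u 0 \<notin> T" "u p \<notin> T"
    and k: "k < p" "z' \<in> S k"
  shows False
proof -
  note uD = induced_pathD[OF u(1)]
  have p: "0 < p" using u(2) by simp
  have uX: "u m \<in> X" if "m \<le> p" for m using path_subset[OF u(1) p] that by auto
  have ux: "\<exists>i<p. u m \<in> S i" if m: "m \<le> p" for m
  proof -
    obtain i where "i < p" "u m \<in> S i" using induced_path_vertex[OF u(1) m p] .
    then show ?thesis by blast
  qed
  have unz: "u m \<noteq> z" "u m \<noteq> c" if "m \<le> p" for m using ux[OF that] u(3,4) by metis+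
  have T_off: "u m \<notin> T" if "m \<le> p" for m
    using path_disjoint[OF u(1) p u(4) z(1) T(1,3,5,6) that] .
  have z'X: "z' \<in> X" using T subset by blast
  \<comment> \<open>Two such sets and \<open>T\<close> form a star centred at \<open>z'\<close>,
    with private columns \<open>u i\<close>, \<open>u (Suc j)\<close> and \<open>z\<close>.\<close>
  have unique: "i = j" if "i \<le> j" "j < p" "z' \<in> S i" "z' \<in> S j" for i j
  proof (rule ccontr)
    assume "i \<noteq> j"
    show False
      by (rule star_absurd[of "S i" "S j" T "u i" "u (Suc j)" z z'])
        (use uD(1)[of i] uD(1)[of j] uD(2)[of i] uD(2)[of j] that \<open>i \<noteq> j\<close> uX z z'X T T_off u(4) in simp_all)
  qed
  consider "k = p - 1" | "k = 0" | "0 < k" "Suc k < p" using k by linarith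
  then show False
  proof cases
    case 1
    show False
    proof (rule attached_end_absurd[OF u(1-4) c _ z linked(1) T(1-4)])
      show "z' \<in> S (p - 1)" using k 1 by simp
      show "z' \<notin> S i" if "i < p - 1" for i
        using unique[of i "p - 1"] k 1 that by auto
    qed (use T_off k 1 unz(2)[of 0] in auto)
  next
    case 2
    show False
    proof (rule attached_end_absurd[of p "\<lambda>m. u (p - m)" "\<lambda>i. S (p - Suc i)" c z T z'])
      show "linked {E \<in> \<E>. c \<notin> E} (u (p - p)) (u (p - 0)) z" using linked(2) by simp
      show "z' \<in> S (p - Suc (p - 1))" using k 2 p by simp
      show "z' \<notin> S (p - Suc i)" if "i < p - 1" for i
        using unique[of 0 "p - Suc i"] k 2 that by auto
    qed (use induced_path_rev[OF u(1)] u(2) T T_off u(3,4) z c unz(2)[of p] in auto)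
  next
    case 3
    define i where "i = k - 1"
    have i: "k = Suc i" "Suc (Suc i) < p" using 3 by (auto simp: i_def)
    have nz: "z' \<notin> S i" "z' \<notin> S (Suc (Suc i))"
      using unique[of i k] unique[of k "Suc (Suc i)"] k i by auto
    have z'u: "z' \<noteq> u m" if "m \<le> p" for m using T_off[OF that] T(4) by blast
    have "z \<noteq> z'" using k u(4) by blast
    show False
      by (rule blocks_absurd[of "u k" "u i" "u (Suc k)" "u (Suc (Suc k))" z' z
            "S i" "S (Suc (Suc i))" T "S k"])
        (use uD(1)[of i] uD(1)[of "Suc i"] uD(1)[of "Suc (Suc i)"] uD(2)[of i] uD(2)[of "Suc i"]
          uD(2)[of "Suc (Suc i)"] uD(3) uX z z'X T T_off u(4) k i nz z'u z'u[symmetric] unz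
          unz[symmetric] \<open>z \<noteq> z'\<close> \<open>z \<noteq> z'\<close>[symmetric] in simp_all)
  qed
qed

text \<open>If \<open>v\<close> met the path \<open>u\<close> again, then the vertex following the last meeting could replace \<open>z\<close>.\<close>

lemma linked_path_interior:
  assumes u: "induced_path \<E> p u S" "2 \<le> p" "\<And>i. i < p \<Longrightarrow> c \<notin> S i" "\<And>i. i < p \<Longrightarrow> z \<notin> S i"
    and c: "c \<in> X" "c \<noteq> z"
    and linked: "linked {E \<in> \<E>. c \<notin> E} (u p) (u 0) z" "linked {E \<in> \<E>. c \<notin> E} (u 0) (u p) z"
    and v: "induced_path {E \<in> \<E>. c \<notin> E \<and> u 0 \<notin> E} l v Q" "v 0 = u p" "v l = z"
    and m: "0 < m" "m \<le> l"
  shows "(\<forall>i<p. v m \<notin> S i) \<and> linked {E \<in> \<E>. c \<notin> E} (u p) (u 0) (v m) \<and>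
    linked {E \<in> \<E>. c \<notin> E} (u 0) (u p) (v m)"
proof -
  note vD = induced_pathD[OF v(1)]
  have fwd: "linked {E \<in> \<E>. c \<notin> E} (u 0) (v 0) (v m)" if "m \<le> l" for m
    using that
  proof (induction m)
    case (Suc m)
    then have "Q m \<in> {E \<in> \<E>. c \<notin> E}" "u 0 \<notin> Q m" "v m \<in> Q m" "v (Suc m) \<in> Q m"
      using vD(1)[of m] vD(2)[of m] by simp_all
    moreover have IH: "linked {E \<in> \<E>. c \<notin> E} (u 0) (v 0) (v m)" using Suc by simp
    ultimately show ?case by (intro linked_step[OF IH, of "Q m"])
  qed simp
  \<comment> \<open>The walk back from \<open>z\<close> ends at \<open>v 1\<close>, since the set
    before it contains \<open>u p\<close>.\<close>
  have bwd: "linked {E \<in> \<E>. c \<notin> E} (u p) (u 0) (v (l - m))" if "m < l" for m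
    using that
  proof (induction m)
    case 0
    then show ?case using linked(1) v(3) by simp
  next
    case (Suc m)
    define i where "i = l - Suc m"
    have i: "l - m = Suc i" "0 < i" "i < l" using Suc.prems by (auto simp: i_def)
    have "linked {E \<in> \<E>. c \<notin> E} (u p) (u 0) (v i)"
    proof (rule linked_step[of _ "v (l - m)" _ _ "Q i"])
      show "linked {E \<in> \<E>. c \<notin> E} (u p) (u 0) (v (l - m))" using Suc by simp
      show "u p \<notin> Q i" using vD(2)[of i 0] i v(2) by simp
    qed (use vD(1)[of i] vD(2)[of i] i in auto)
    then show ?case by (simp add: i_def)
  qed
  have links: "linked {E \<in> \<E>. c \<notin> E} (u p) (u 0) (v m)" "linked {E \<in> \<E>. c \<notin> E} (u 0) (u p) (v m)"
    if "0 < m" "m \<le> l" for m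
    using fwd[of m] bwd[of "l - m"] that v(2) by auto
  moreover have "v m \<notin> S i" if mi: "0 < m" "m \<le> l" "i < p" for m i
  proof
    assume "v m \<in> S i"
    define M where "M = (GREATEST m. m \<le> l \<and> (\<exists>i<p. v m \<in> S i))"
    have ex: "m \<le> l \<and> (\<exists>i<p. v m \<in> S i)" using mi \<open>v m \<in> S i\<close> by blast
    have M: "M \<le> l \<and> (\<exists>i<p. v M \<in> S i)"
      unfolding M_def by (rule GreatestI_nat[of "\<lambda>m. m \<le> l \<and> (\<exists>i<p. v m \<in> S i)" m l]) (use ex in simp_all)
    have M_max: "n \<le> M" if "n \<le> l" "\<exists>i<p. v n \<in> S i" for n
      unfolding M_def by (rule Greatest_le_nat[of "\<lambda>m. m \<le> l \<and> (\<exists>i<p. v m \<in> S i)" n l]) (use that in simp_all)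
    have "0 < M" using M_max[of m] ex mi by auto
    have "M \<noteq> l" using M v(3) u(4) by metis
    then have "M < l" using M by simp
    note T = vD(1)[OF \<open>M < l\<close>] vD(2)[OF \<open>M < l\<close>]
    obtain k where k: "k < p" "v M \<in> S k" using M by blast
    have off: "\<And>i. i < p \<Longrightarrow> v (Suc M) \<notin> S i" using M_max[of "Suc M"] \<open>M < l\<close> by auto
    have "v (Suc M) \<in> X" using T(2)[of "Suc M"] subset[of "Q M"] T(1) \<open>M < l\<close> by auto
    moreover have "v (Suc M) \<noteq> c" using T \<open>M < l\<close> by auto
    moreover have "u p \<notin> Q M" using T(2)[of 0] v(2) \<open>0 < M\<close> by simp
    ultimately show False
      using attached_absurd[OF u(1-3) off c(1) _ _ links[of "Suc M"] _ _ _ _ _ _ k, of "Q M"] T \<open>M < l\<close>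
      by simp
  qed
  ultimately show ?thesis using m by blast
qed

text \<open>\<open>T\<close> joins \<open>u p\<close> to a vertex \<open>y1\<close> off the path,
  and a route \<open>q\<close> from \<open>u 0\<close> to \<open>y1\<close> stays off the path too,
  so path and route ought to close up to a cycle. The difficulty is that \<open>Q 0\<close> and
  \<open>T\<close> contain an initial and a final stretch of the path, and that these may
  overlap.\<close>

lemma long_path_absurd:
  assumes u: "induced_path \<E> p u S" "2 \<le> p" "\<And>i. i < p \<Longrightarrow> c \<notin> S i" "\<And>i. i < p \<Longrightarrow> z \<notin> S i"
    and c: "c \<in> X" "c \<noteq> z" "c \<noteq> u 0" and z: "z \<in> X"
    and linked: "linked {E \<in> \<E>. c \<notin> E} (u p) (u 0) z" "linked {E \<in> \<E>. c \<notin> E} (u 0) (u p) z"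
  shows False
proof -
  note uD = induced_pathD[OF u(1)]
  have p: "0 < p" using u(2) by simp
  have uX: "u m \<in> X" if "m \<le> p" for m using path_subset[OF u(1) p] that by auto
  have ux: "\<exists>i<p. u m \<in> S i" if m: "m \<le> p" for m
  proof -
    obtain i where "i < p" "u m \<in> S i" using induced_path_vertex[OF u(1) m p] .
    then show ?thesis by blast
  qed
  have unc: "u m \<noteq> c" if "m \<le> p" for m using ux[OF that] u(3) by metis
  have touch_eq: "touch {E \<in> \<E>. c \<notin> E} a = {(x, y). \<exists>t\<in>{E \<in> \<E>. c \<notin> E \<and> a \<notin> E}. x \<in> t \<and> y \<in> t}" for a
    unfolding touch_def by blast
  obtain lv v V where v: "induced_path {E \<in> \<E>. c \<notin> E \<and> u 0 \<notin> E} lv v V" "v 0 = u p" "v lv = z"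
    using linked(2) unfolding touch_eq by (rule induced_path_exists)
  have lv: "0 < lv" using v(2,3) ux[of p] u(4) by (metis gr_zeroI order_refl)
  define y1 where "y1 = v 1"
  define T where "T = V 0"
  have T: "T \<in> \<E>" "c \<notin> T" "u 0 \<notin> T" "u p \<in> T" "y1 \<in> T"
    using induced_pathD(1)[OF v(1) lv] induced_pathD(2)[OF v(1) lv, of 0] induced_pathD(2)[OF v(1) lv, of 1]
      v(2) lv by (auto simp: T_def y1_def)
  have y1: "\<forall>i<p. y1 \<notin> S i" "linked {E \<in> \<E>. c \<notin> E} (u p) (u 0) y1"
    "linked {E \<in> \<E>. c \<notin> E} (u 0) (u p) y1"
    using linked_path_interior[OF u c(1,2) linked v, of 1] lv by (auto simp: y1_def)
  have "c \<noteq> y1" using T by blast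
  obtain l q Q where q0: "induced_path {E \<in> \<E>. c \<notin> E \<and> u p \<notin> E} l q Q" "q 0 = u 0" "q l = y1"
    using y1(2) unfolding touch_eq by (rule induced_path_exists)
  have l: "0 < l" using q0(2,3) ux[of 0] y1(1) by (metis gr_zeroI le0)
  have q: "induced_path \<E> l q Q" "\<And>i. i < l \<Longrightarrow> c \<notin> Q i" "\<And>i. i < l \<Longrightarrow> u p \<notin> Q i"
    using induced_pathD(1)[OF q0(1)] induced_path_subset[OF q0(1)] by blast+
  note qD = induced_pathD[OF q(1)]
  have qX: "q m \<in> X" if "m \<le> l" for m using path_subset[OF q(1) l] that by auto
  have q_off: "q m \<notin> S i" if "0 < m" "m \<le> l" "i < p" for m i
  proof -
    have "(\<forall>i<p. q m \<notin> S (p - Suc i)) \<and> linked {E \<in> \<E>. c \<notin> E} (u (p - p)) (u (p - 0)) (q m) \<and>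
      linked {E \<in> \<E>. c \<notin> E} (u (p - 0)) (u (p - p)) (q m)"
      by (rule linked_path_interior[of p "\<lambda>m. u (p - m)" "\<lambda>i. S (p - Suc i)" c y1 l q Q])
        (use induced_path_rev[OF u(1)] u(2,3) y1 c(1) \<open>c \<noteq> y1\<close> q0 that(1,2) in simp_all)
    then have "q m \<notin> S (p - Suc (p - Suc i))" using that(3) by (metis diff_less p zero_less_Suc)
    then show ?thesis using that(3) by simp
  qed
  have q_u: "q m \<noteq> u n" if "0 < m" "m \<le> l" "n \<le> p" for m n
    using ux[OF that(3)] q_off[OF that(1,2)] by metis
  have qc: "q m \<noteq> c" if m: "m \<le> l" for m
  proof -
    obtain i where "i < l" "q m \<in> Q i" using induced_path_vertex[OF q(1) m l] .
    then show ?thesis using q(2) by blast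
  qed
  define k where "k = (LEAST k. q k \<in> T)"
  have "q l \<in> T" using T(5) q0(3) by simp
  then have k: "q k \<in> T" "k \<le> l" unfolding k_def by (rule LeastI, rule Least_le)
  have k_min: "q m \<notin> T" if "m < k" for m using that unfolding k_def by (rule not_less_Least)
  have "0 < k" using k(1) T(3) q0(2) by (metis gr_zeroI)
  have Q_u: "u m \<notin> Q j" if "0 < j" "j < k" "m \<le> p" for j m
  proof -
    have j: "j < l" "0 < j" using that k by auto
    have "\<And>i. i < p \<Longrightarrow> q j \<notin> S i" using q_off j by simp
    moreover have "u 0 \<notin> Q j" using qD(2)[of j 0] j q0(2) by simp
    ultimately show ?thesis
      using path_disjoint[OF u(1) p, of "q j" "Q j" m] qD(1,2)[of j] qX[of j] q(3)[of j] j that(3) by simp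
  qed
  have Q0: "Q 0 \<in> \<E>" "c \<notin> Q 0" "u 0 \<in> Q 0" "u p \<notin> Q 0" "q 1 \<in> Q 0"
    using qD(1)[of 0] qD(2)[of 0 0] qD(2)[of 0 1] q(2,3)[of 0] q0(2) l by auto
  define i where "i = (GREATEST i. i \<le> p \<and> u i \<in> Q 0)"
  have i: "i \<le> p \<and> u i \<in> Q 0"
    unfolding i_def by (rule GreatestI_nat[of "\<lambda>i. i \<le> p \<and> u i \<in> Q 0" 0 p]) (use Q0 in simp_all)
  have i_max: "m \<le> i" if "m \<le> p" "u m \<in> Q 0" for m
    unfolding i_def
    by (rule Greatest_le_nat[of "\<lambda>i. i \<le> p \<and> u i \<in> Q 0" m p]) (use that in simp_all)
  have "i < p" using i Q0(4) by (metis nat_less_le)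
  have uQ0: "u m \<in> Q 0 \<longleftrightarrow> m \<le> i" if "m \<le> p" for m
    using path_interval[OF u(1,3) c(1) Q0(1,2,3), of i m] i i_max that by auto
  define j where "j = (LEAST j. u j \<in> T)"
  have j: "u j \<in> T" "j \<le> p" using T(4) unfolding j_def by (rule LeastI, rule Least_le)
  have j_min: "j \<le> m" if "u m \<in> T" for m using that unfolding j_def by (rule Least_le)
  have "0 < j" using j T(3) by (metis gr_zeroI)
  have uT: "u m \<in> T \<longleftrightarrow> j \<le> m" if "m \<le> p" for m
    using path_interval[OF u(1,3) c(1) T(1,2) j(1) T(4), of m] j_min that by auto
  show False
  proof (cases "i < j \<or> 2 \<le> k")
    case True
    \<comment> \<open>If the stretches are disjoint, the cycle runs from \<open>u i\<close> to
      \<open>u j\<close> and back along \<open>q k\<close>, ..., \<open>q 1\<close>. If they overlap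
      and \<open>2 \<le> k\<close>, the single vertex \<open>u j\<close> lies in both
      \<open>T\<close> and \<open>Q 0\<close>; truncated subtraction then gives
      \<open>d = 0\<close>.\<close>
    define d where "d = j - i"
    define a where "a = (if i < j then i else j)"
    have ad: "a + d \<le> p" "2 \<le> d + k" using True \<open>0 < k\<close> j(2) by (auto simp: a_def d_def)
    have aQ: "u (a + m) \<in> Q 0 \<longleftrightarrow> m = 0" "u (a + m) \<in> T \<longleftrightarrow> m = d" if "m \<le> d" for m
      using uQ0[of "a + m"] uT[of "a + m"] that ad by (auto simp: a_def d_def split: if_splits)
    define w where "w m = (if m \<le> d then u (a + m) else q (Suc (d + k) - m))" for m
    have w_cases: thesis if "m \<le> d + k" "m \<le> d \<Longrightarrow> w m = u (a + m) \<Longrightarrow> a + m \<le> p \<Longrightarrow> thesis"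
      "\<And>r. m = Suc (d + k) - r \<Longrightarrow> 0 < r \<Longrightarrow> r \<le> k \<Longrightarrow> w m = q r \<Longrightarrow> \<not> m \<le> d \<Longrightarrow> thesis" for m thesis
      using that(2) that(3)[of "Suc (d + k) - m"] that(1) ad by (cases "m \<le> d") (auto simp: w_def)
    show False
    proof (rule cycle_absurd[of "d + k" w c])
      show "inj_on w {..d + k}"
      proof (rule inj_onI)
        fix m n assume mn: "m \<in> {..d + k}" "n \<in> {..d + k}" "w m = w n"
        have "m \<le> d + k" "n \<le> d + k" using mn by auto
        then show "m = n"
        proof (cases rule: w_cases[of m, consumes 1, case_names P R])
          case m: P
          show ?thesis using \<open>n \<le> d + k\<close>
          proof (cases rule: w_cases[of n, consumes 1, case_names P R])
            case P
            then show ?thesis using m mn(3) uD(3) by simp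
          next
            case (R r)
            then show ?thesis using m mn(3) q_u[of r "a + m"] k(2) by simp
          qed
        next
          case m: (R r)
          show ?thesis using \<open>n \<le> d + k\<close>
          proof (cases rule: w_cases[of n, consumes 1, case_names P R])
            case P
            then show ?thesis using m mn(3) q_u[of r "a + n"] k(2) by simp
          next
            case (R r')
            then show ?thesis using m mn(3) qD(3)[of r r'] k(2) by simp
          qed
        qed
      qed
      show "w ` {..d + k} \<subseteq> X" using uX qX k(2) ad by (auto simp: w_def)
      have "w m \<noteq> c" if "m \<le> d + k" for m
        using unc[of "a + m"] qc[of "Suc (d + k) - m"] k(2) ad that by (simp add: w_def)
      then show "c \<notin> w ` {..d + k}" by auto
      show "\<exists>E\<in>\<E>. c \<notin> E \<and> (\<forall>m\<le>d + k. w m \<in> E \<longleftrightarrow> m = n \<or> m = Suc n)" if n: "n < d + k" for n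
      proof -
        consider "n < d" | "n = d" | r where "0 < r" "r < k" "n = d + k - r"
          using n that by (metis diff_diff_cancel le_add_diff_inverse less_imp_le_nat linorder_neqE_nat zero_less_diff add_diff_inverse_nat diff_add_inverse less_diff_conv2 not_add_less1 diff_less_mono2)
        then show ?thesis
        proof cases
          case 1
          have "w m \<in> S (a + n) \<longleftrightarrow> m = n \<or> m = Suc n" if "m \<le> d + k" for m
            using that
          proof (cases rule: w_cases[of m, consumes 1, case_names P R])
            case P
            then show ?thesis using uD(2)[of "a + n" "a + m"] 1 ad by simp
          next
            case (R r)
            then show ?thesis using q_off[of r "a + n"] 1 ad k(2) by simp
          qed
          then show ?thesis using uD(1)[of "a + n"] u(3)[of "a + n"] 1 ad by (intro bexI[of _ "S (a + n)"]) simp_all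
        next
          case 2
          have "w m \<in> T \<longleftrightarrow> m = n \<or> m = Suc n" if "m \<le> d + k" for m
            using that
          proof (cases rule: w_cases[of m, consumes 1, case_names P R])
            case P
            then show ?thesis using aQ(2)[of m] 2 by auto
          next
            case (R r)
            have "q r \<in> T \<longleftrightarrow> r = k" using R k(1) k_min[of r] by (cases "r = k") auto
            then show ?thesis using R 2 \<open>0 < k\<close> by auto
          qed
          then show ?thesis using T by blast
        next
          case (3 r)
          have "w m \<in> Q r \<longleftrightarrow> m = n \<or> m = Suc n" if "m \<le> d + k" for m
            using that
          proof (cases rule: w_cases[of m, consumes 1, case_names P R])
            case P
            then show ?thesis using Q_u[of r "a + m"] 3 by auto
          next
            case (R r')
            then show ?thesis using qD(2)[of r r'] 3 k(2) by auto
          qed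
          then show ?thesis using qD(1)[of r] q(2)[of r] 3 k(2) by (intro bexI[of _ "Q r"]) simp_all
        qed
      qed
      have "w m \<in> Q 0 \<longleftrightarrow> m = 0 \<or> m = d + k" if "m \<le> d + k" for m
        using that
      proof (cases rule: w_cases[of m, consumes 1, case_names P R])
        case P
        then show ?thesis using aQ(1)[of m] \<open>0 < k\<close> by auto
      next
        case (R r)
        then show ?thesis using qD(2)[of 0 r] k(2) l by auto
      qed
      then show "\<exists>E\<in>\<E>. c \<notin> E \<and> (\<forall>m\<le>d + k. w m \<in> E \<longleftrightarrow> m = 0 \<or> m = d + k)"
        using Q0 by blast
    qed (use ad c in simp_all)
  next
    case False
    then have ij: "j \<le> i" "k = 1" using \<open>0 < k\<close> by auto
    \<comment> \<open>Now \<open>q 1\<close> lies in both \<open>T\<close> and \<open>Q 0\<close>,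
      which together cover the path and miss \<open>c\<close>. Their complements join
      \<open>c\<close> to \<open>u (j - 1)\<close> and to \<open>u (i + 1)\<close>: a cycle through
      \<open>c\<close> with \<open>q 1\<close> outside.\<close>
    define a where "a = j - 1"
    define n where "n = i - j + 3"
    have an: "j = Suc a" "a + (n - 1) = Suc i" "3 \<le> n" using \<open>0 < j\<close> ij by (auto simp: a_def n_def)
    define w where "w m = (if m = 0 then c else u (a + (m - 1)))" for m
    have wu: "w (Suc m) = u (a + m)" for m by (simp add: w_def)
    have le: "a + m \<le> p" if "Suc m \<le> n" for m using that an \<open>i < p\<close> by simp
    have n_cases: "m = 0 \<or> (\<exists>r. m = Suc r \<and> a + r \<le> p)" if "m \<le> n" for m
      using that le by (cases m) auto
    have q1: "q 1 \<in> T" "q 1 \<in> Q 0" "q 1 \<noteq> c" "q 1 \<in> X" "\<And>m. m \<le> p \<Longrightarrow> q 1 \<noteq> u m" "\<And>m. m < p \<Longrightarrow> q 1 \<notin> S m"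
      using k(1) ij(2) Q0(5) qc[of 1] l qX[of 1] q_u[of 1] q_off[of 1] by auto
    show False
    proof (rule cycle_absurd[of n w "q 1"])
      show "2 \<le> n" using an by simp
      show "inj_on w {..n}"
      proof (rule inj_onI)
        fix r s assume rs: "r \<in> {..n}" "s \<in> {..n}" "w r = w s"
        then show "r = s"
          using n_cases[of r] n_cases[of s] unc[of "a + (s - 1)"] unc[of "a + (r - 1)"] uD(3)
          by (auto simp: w_def)
      qed
      show "w ` {..n} \<subseteq> X" using n_cases uX c(1) by (force simp: w_def)
      show "q 1 \<notin> w ` {..n}" using n_cases q1(3,5) by (force simp: w_def)
      show "\<exists>E\<in>\<E>. q 1 \<notin> E \<and> (\<forall>m\<le>n. w m \<in> E \<longleftrightarrow> m = r \<or> m = Suc r)" if "r < n" for r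
      proof (cases r)
        case 0
        have "w m \<in> X - T \<longleftrightarrow> m = r \<or> m = Suc r" if "m \<le> n" for m
          using n_cases[OF that] uT uX T(2) c(1) 0 an(1) by (auto simp: w_def)
        then show ?thesis using compl[OF T(1)] q1(1) by (intro bexI[of _ "X - T"]) simp_all
      next
        case (Suc s)
        then have s: "a + s < p" using that an \<open>i < p\<close> by simp
        have "w m \<in> S (a + s) \<longleftrightarrow> m = r \<or> m = Suc r" if "m \<le> n" for m
          using n_cases[OF that] uD(2)[OF s] u(3)[OF s] Suc by (auto simp: w_def)
        then show ?thesis using uD(1)[OF s] q1(6)[OF s] by blast
      qed
      have "w m \<in> X - Q 0 \<longleftrightarrow> m = 0 \<or> m = n" if "m \<le> n" for m
        using n_cases[OF that] uQ0 uX Q0(2) c(1) an that by (auto simp: w_def)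
      then show "\<exists>E\<in>\<E>. q 1 \<notin> E \<and> (\<forall>m\<le>n. w m \<in> E \<longleftrightarrow> m = 0 \<or> m = n)"
        using compl[OF Q0(1)] q1(2) by (intro bexI[of _ "X - Q 0"]) simp_all
    qed (rule q1(4))
  qed
qed

text \<open>By \<open>long_path_absurd\<close> any two of the three lie in a single set missing the
  third and \<open>c\<close>. The complements of the three sets form a star centred at
  \<open>c\<close>.\<close>

theorem not_asteroidal:
  assumes c: "c \<in> X" and xyz: "x \<in> X" "y \<in> X" "z \<in> X" "c \<notin> {x, y, z}"
  shows "\<not> asteroidal {E \<in> \<E>. c \<notin> E} x y z"
proof
  have touch_eq: "touch {E \<in> \<E>. c \<notin> E} a = {(x, y). \<exists>t\<in>{E \<in> \<E>. c \<notin> E \<and> a \<notin> E}. x \<in> t \<and> y \<in> t}" for a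
    unfolding touch_def by blast
  have short: "\<exists>E\<in>\<E>. c \<notin> E \<and> z \<notin> E \<and> x \<in> E \<and> y \<in> E"
    if at: "asteroidal {E \<in> \<E>. c \<notin> E} x y z" and xyz: "x \<in> X" "y \<in> X" "z \<in> X" "c \<notin> {x, y, z}" for x y z
  proof -
    have "linked {E \<in> \<E>. c \<notin> E} z x y" using at by (simp add: asteroidal_def)
    then obtain p u S where path: "induced_path {E \<in> \<E>. c \<notin> E \<and> z \<notin> E} p u S" "u 0 = x" "u p = y"
      unfolding touch_eq by (rule induced_path_exists)
    have u: "induced_path \<E> p u S" "\<And>i. i < p \<Longrightarrow> c \<notin> S i" "\<And>i. i < p \<Longrightarrow> z \<notin> S i"
      using induced_pathD(1)[OF path(1)] induced_path_subset[OF path(1)] by blast+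
    have "\<not> 2 \<le> p"
    proof
      assume "2 \<le> p"
      show False
        by (rule long_path_absurd[OF u(1) \<open>2 \<le> p\<close> u(2,3) c])
          (use at xyz path in \<open>auto simp: asteroidal_def\<close>)
    qed
    moreover have "p \<noteq> 0" using path(2,3) at by (metis asteroidal_def distinct_length_2_or_more)
    ultimately have "p = 1" by simp
    then show ?thesis
      using induced_pathD(1)[OF u(1), of 0] induced_pathD(2)[OF u(1), of 0] u(2,3)[of 0] path(2,3)
      by (intro bexI[of _ "S 0"]) auto
  qed
  assume at: "asteroidal {E \<in> \<E>. c \<notin> E} x y z"
  then have at': "asteroidal {E \<in> \<E>. c \<notin> E} y z x" "asteroidal {E \<in> \<E>. c \<notin> E} x z y"
    unfolding asteroidal_def by (auto intro: linked_sym)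
  obtain A where A: "A \<in> \<E>" "c \<notin> A" "z \<notin> A" "x \<in> A" "y \<in> A" using short[OF at] xyz by blast
  obtain B where B: "B \<in> \<E>" "c \<notin> B" "x \<notin> B" "y \<in> B" "z \<in> B" using short[OF at'(1)] xyz by blast
  obtain C where C: "C \<in> \<E>" "c \<notin> C" "y \<notin> C" "x \<in> C" "z \<in> C" using short[OF at'(2)] xyz by blast
  show False
    by (rule star_absurd[of "X - A" "X - B" "X - C" z x y c])
      (use A B C compl xyz c in auto)
qed

end


section \<open>Patterns in families of rows\<close>

text \<open>
  Realized sets have to be arcs. Intersections of rows that leave out a column of \<open>W\<close> are not
  included, because they are arcs anyway (lemma \<open>arc_Int\<close>).
\<close>

definition realized :: "'a set set \<Rightarrow> 'a set \<Rightarrow> 'a set set" where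
  "realized R W = {S. S \<subseteq> W \<and>
     ((\<exists>r\<in>R. r \<inter> W = S \<or> r \<inter> W = W - S) \<or>
      (\<exists>r\<in>R. \<exists>s\<in>R. W \<subseteq> r \<union> s \<and> (r \<inter> s \<inter> W = S \<or> r \<inter> s \<inter> W = W - S)))}"

text \<open>Columns are numbered from 1, as in the matrices. Distinctness of the chosen rows is not
  demanded: patterns that differ on the numbered columns cannot come from the same row.\<close>

definition contains_pattern :: "'a set set \<Rightarrow> 'a set \<Rightarrow> nat \<Rightarrow> nat set set \<Rightarrow> bool" where
  "contains_pattern R X n \<P> \<longleftrightarrow> (\<exists>g. inj_on g {1..n} \<and> g ` {1..n} \<subseteq> X \<and>
     (\<forall>P\<in>\<P>. \<exists>r\<in>R. \<forall>j\<in>{1..n}. g j \<in> r \<longleftrightarrow> j \<in> P))"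

abbreviation path_rows :: "nat \<Rightarrow> nat set set" where
  "path_rows k \<equiv> (\<lambda>i. {i, i + 1}) ` {1..k - 1}"

definition rows_I :: "nat \<Rightarrow> nat set set" where
  "rows_I k = insert {1, k} (path_rows k)"

definition rows_II :: "nat \<Rightarrow> nat set set" where
  "rows_II k = {{1..k - 2} \<union> {k}, {2..k}} \<union> path_rows (k - 1)"

definition rows_III :: "nat \<Rightarrow> nat set set" where
  "rows_III k = insert ({2..k - 1} \<union> {k + 1}) (path_rows k)"

text \<open>\<open>F_IcircR\<close> with every matrix replaced by the set of its rows; the five
  sporadic patterns are in the order of that list.\<close>

definition forbidden :: "'a set set \<Rightarrow> 'a set \<Rightarrow> bool" where
  "forbidden R X \<longleftrightarrow>
     (\<exists>k\<ge>3. contains_pattern R X (k + 1) (rows_I k) \<or> contains_pattern R X (k + 1) (rows_III k) \<or>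
        contains_pattern R X (k + 1) (rows_II (k + 1))) \<or>
     contains_pattern R X 5 {{1, 2}, {1, 4, 5}, {3, 4}, {2, 3, 5}} \<or>
     contains_pattern R X 4 {{1, 2}, {1, 4}, {1, 2, 4}, {2, 3, 4}} \<or>
     contains_pattern R X 6 {{1, 2}, {3, 4}, {5, 6}, {2, 4, 6}} \<or>
     contains_pattern R X 5 {{1, 2}, {1, 2, 3, 4}, {3, 4}, {1, 4, 5}} \<or>
     contains_pattern R X 4 {{1, 2, 4}, {2, 3, 4}, {1, 3, 4}}"

lemma realized_cases [consumes 1, case_names row corow meet comeet]:
  assumes "S \<in> realized R W"
  obtains r where "r \<in> R" "r \<inter> W = S"
  | r where "r \<in> R" "r \<inter> W = W - S"
  | r s where "r \<in> R" "s \<in> R" "W \<subseteq> r \<union> s" "r \<inter> s \<inter> W = S"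
  | r s where "r \<in> R" "s \<in> R" "W \<subseteq> r \<union> s" "r \<inter> s \<inter> W = W - S"
  using assms unfolding realized_def by blast

lemma realized_row: "r \<in> R \<Longrightarrow> r \<inter> W \<in> realized R W"
  unfolding realized_def by blast

lemma realized_corow: "r \<in> R \<Longrightarrow> W - r \<in> realized R W"
  unfolding realized_def by blast

lemma realized_comeet: "r \<in> R \<Longrightarrow> s \<in> R \<Longrightarrow> W \<subseteq> r \<union> s \<Longrightarrow> W - r \<inter> s \<in> realized R W"
  unfolding realized_def by blast

lemma realized_subset: "S \<in> realized R W \<Longrightarrow> S \<subseteq> W"
  unfolding realized_def by blast

lemma realized_compl: "S \<in> realized R W \<Longrightarrow> W - S \<in> realized R W"
  unfolding realized_def by (auto simp: double_diff)

text \<open>Rows covering \<open>W\<close> also cover \<open>W'\<close>, so every kind of realized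
  set is inherited. The converse fails, since rows can cover \<open>W'\<close> without covering
  \<open>W\<close>.\<close>

lemma realized_restrict:
  assumes "S \<in> realized R W" "W' \<subseteq> W"
  shows "S \<inter> W' \<in> realized R W'"
  using assms(1)
proof (cases rule: realized_cases)
  case (row r)
  then have "r \<inter> W' = S \<inter> W'" using assms(2) by blast
  then show ?thesis using realized_row[OF row(1), of W'] by simp
next
  case (corow r)
  then have "W' - r = S \<inter> W'" using assms realized_subset by blast
  then show ?thesis using realized_corow[OF corow(1), of W'] by simp
next
  case (meet r s)
  then have "W' - (W' - r \<inter> s) = S \<inter> W'" "W' \<subseteq> r \<union> s" using assms(2) by blast+
  then show ?thesis using realized_compl[OF realized_comeet[OF meet(1,2)], of W'] by simp
next
  case (comeet r s)
  then have "W' - r \<inter> s = S \<inter> W'" "W' \<subseteq> r \<union> s" using assms realized_subset by blast+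
  then show ?thesis using realized_comeet[OF comeet(1,2), of W'] by simp
qed

lemma realized_restrictI:
  "S \<in> realized R W \<Longrightarrow> W' \<subseteq> W \<Longrightarrow> S \<inter> W' = S' \<Longrightarrow> S' \<in> realized R W'"
  using realized_restrict by blast

definition row_on :: "'a set set \<Rightarrow> 'a set \<Rightarrow> 'a set \<Rightarrow> bool" where
  "row_on R W S \<longleftrightarrow> (\<exists>r\<in>R. r \<inter> W = S)"

lemma row_on_restrict: "row_on R W S \<Longrightarrow> W' \<subseteq> W \<Longrightarrow> S \<inter> W' = S' \<Longrightarrow> row_on R W' S'"
  unfolding row_on_def by blast

lemma row_on_realized: "row_on R W S \<Longrightarrow> S \<in> realized R W"
  unfolding row_on_def using realized_row by blast

lemma corow_on_realized: "row_on R W (W - S) \<Longrightarrow> S \<subseteq> W \<Longrightarrow> S \<in> realized R W"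
  using realized_compl[OF row_on_realized] by (metis double_diff order_refl)

text \<open>Rows with disjoint complements cover \<open>W\<close>, so their intersection counts, and
  with it the complement. The arguments below obtain new realized sets in this way.\<close>

lemma disjoint_corows_realized:
  assumes "row_on R W (W - S)" "row_on R W (W - T)" "S \<inter> T = {}" "S \<subseteq> W" "T \<subseteq> W"
  shows "S \<union> T \<in> realized R W"
proof -
  obtain r s where rs: "r \<in> R" "s \<in> R" "r \<inter> W = W - S" "s \<inter> W = W - T"
    using assms(1,2) unfolding row_on_def by blast
  then have "W \<subseteq> r \<union> s" "W - r \<inter> s = S \<union> T" using assms(3-5) by blast+
  then show ?thesis using realized_comeet[OF rs(1,2)] by metis
qed

lemma contains_pattern_list:
  assumes "distinct cs" "set cs \<subseteq> X" "length cs = n"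
    and "\<And>P. P \<in> \<P> \<Longrightarrow> row_on R (set cs) ((\<lambda>j. cs ! (j - 1)) ` (P \<inter> {1..n}))"
  shows "contains_pattern R X n \<P>"
proof -
  let ?g = "\<lambda>j. cs ! (j - 1)"
  have inj: "inj_on ?g {1..n}"
    using assms(1,3) by (auto simp: inj_on_def nth_eq_iff_index_eq)
  have g: "?g j \<in> set cs" if "j \<in> {1..n}" for j using that assms(3) by auto
  have "\<exists>r\<in>R. \<forall>j\<in>{1..n}. ?g j \<in> r \<longleftrightarrow> j \<in> P" if P: "P \<in> \<P>" for P
  proof -
    obtain r where r: "r \<in> R" "r \<inter> set cs = ?g ` (P \<inter> {1..n})"
      using assms(4)[OF P] unfolding row_on_def by blast
    have "?g j \<in> r \<longleftrightarrow> j \<in> P" if j: "j \<in> {1..n}" for j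
    proof -
      have "?g j \<in> r \<longleftrightarrow> ?g j \<in> ?g ` (P \<inter> {1..n})" using r(2) g[OF j] by blast
      also have "\<dots> \<longleftrightarrow> j \<in> P" using inj j by (auto dest: inj_onD)
      finally show ?thesis .
    qed
    then show ?thesis using r(1) by blast
  qed
  then show ?thesis
    unfolding contains_pattern_def using inj g assms(2) by (intro exI[of _ ?g]) auto
qed

section \<open>The small forbidden matrices on named columns\<close>

lemma atLeastAtMost_4: "{1..4::nat} = {1, 2, 3, 4}"
  and atLeastAtMost_5: "{1..5::nat} = {1, 2, 3, 4, 5}"
  and atLeastAtMost_6: "{1..6::nat} = {1, 2, 3, 4, 5, 6}"
  by auto

lemma forbidden_I_3:
  assumes "distinct [a, b, c, d]" "{a, b, c, d} \<subseteq> X"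
    and "row_on R {a, b, c, d} {a, b}" "row_on R {a, b, c, d} {b, c}" "row_on R {a, b, c, d} {a, c}"
  shows "forbidden R X"
proof -
  have "contains_pattern R X 4 (rows_I 3)"
  proof (rule contains_pattern_list[of "[a, b, c, d]"])
    fix P assume "P \<in> rows_I 3"
    then have "P = {1, 2} \<or> P = {2, 3} \<or> P = {1, 3}"
      by (auto simp: rows_I_def numeral_eq_Suc le_Suc_eq)
    then show "row_on R (set [a, b, c, d]) ((\<lambda>j. [a, b, c, d] ! (j - 1)) ` (P \<inter> {1..4}))"
      using assms by (auto simp: atLeastAtMost_4)
  qed (use assms in auto)
  then show ?thesis unfolding forbidden_def by (intro disjI1 exI[of _ 3]) simp
qed

lemma forbidden_III_3:
  assumes "distinct [a, b, c, d]" "{a, b, c, d} \<subseteq> X"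
    and "row_on R {a, b, c, d} {a, b}" "row_on R {a, b, c, d} {b, c}" "row_on R {a, b, c, d} {b, d}"
  shows "forbidden R X"
proof -
  have "contains_pattern R X 4 (rows_III 3)"
  proof (rule contains_pattern_list[of "[a, b, c, d]"])
    fix P assume "P \<in> rows_III 3"
    then have "P = {1, 2} \<or> P = {2, 3} \<or> P = {2, 4}"
      by (auto simp: rows_III_def numeral_eq_Suc le_Suc_eq)
    then show "row_on R (set [a, b, c, d]) ((\<lambda>j. [a, b, c, d] ! (j - 1)) ` (P \<inter> {1..4}))"
      using assms by (auto simp: atLeastAtMost_4)
  qed (use assms in auto)
  then show ?thesis unfolding forbidden_def by (intro disjI1 exI[of _ 3]) simp
qed

lemma forbidden_II_4:
  assumes "distinct [a, b, c, d]" "{a, b, c, d} \<subseteq> X"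
    and "row_on R {a, b, c, d} {a, b}" "row_on R {a, b, c, d} {b, c}"
      "row_on R {a, b, c, d} {a, b, d}" "row_on R {a, b, c, d} {b, c, d}"
  shows "forbidden R X"
proof -
  have "contains_pattern R X 4 (rows_II 4)"
  proof (rule contains_pattern_list[of "[a, b, c, d]"])
    fix P assume "P \<in> rows_II 4"
    moreover have "{1..2} = {1, 2::nat}" "{2..4} = {2, 3, 4::nat}" by auto
    then have "rows_II 4 = {{1, 2, 4}, {2, 3, 4}, {1, 2}, {2, 3}}"
      by (simp add: rows_II_def insert_commute del: One_nat_def)
    ultimately have "P = {1, 2} \<or> P = {2, 3} \<or> P = {1, 2, 4} \<or> P = {2, 3, 4}" by blast
    then show "row_on R (set [a, b, c, d]) ((\<lambda>j. [a, b, c, d] ! (j - 1)) ` (P \<inter> {1..4}))"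
      using assms by (auto simp: atLeastAtMost_4)
  qed (use assms in auto)
  then show ?thesis unfolding forbidden_def by (intro disjI1 exI[of _ 3]) simp
qed

text \<open>The matrix is \<open>complement_rows [0, 1, 0, 0] (M_II 4)\<close>. In the same way
  \<open>forbidden_I_4'\<close> below belongs to
  \<open>complement_rows [0, 1, 0, 1] (append_zero_col (M_I 4))\<close>.\<close>

lemma forbidden_II_4':
  assumes "distinct [a, b, c, d]" "{a, b, c, d} \<subseteq> X"
    and "row_on R {a, b, c, d} {a, b}" "row_on R {a, b, c, d} {a, d}"
      "row_on R {a, b, c, d} {a, b, d}" "row_on R {a, b, c, d} {b, c, d}"
  shows "forbidden R X"
proof -
  have "contains_pattern R X 4 {{1, 2}, {1, 4}, {1, 2, 4}, {2, 3, 4}}"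
    by (rule contains_pattern_list[of "[a, b, c, d]"]) (use assms in \<open>auto simp: atLeastAtMost_4\<close>)
  then show ?thesis unfolding forbidden_def by blast
qed

lemma forbidden_VI:
  assumes "distinct [a, b, c, d]" "{a, b, c, d} \<subseteq> X"
    and "row_on R {a, b, c, d} {a, b, d}" "row_on R {a, b, c, d} {b, c, d}" "row_on R {a, b, c, d} {a, c, d}"
  shows "forbidden R X"
proof -
  have "contains_pattern R X 4 {{1, 2, 4}, {2, 3, 4}, {1, 3, 4}}"
    by (rule contains_pattern_list[of "[a, b, c, d]"]) (use assms in \<open>auto simp: atLeastAtMost_4\<close>)
  then show ?thesis unfolding forbidden_def by blast
qed

lemma forbidden_V:
  assumes "distinct [a, b, c, d, e]" "{a, b, c, d, e} \<subseteq> X"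
    and "row_on R {a, b, c, d, e} {a, b}" "row_on R {a, b, c, d, e} {a, b, c, d}"
      "row_on R {a, b, c, d, e} {c, d}" "row_on R {a, b, c, d, e} {a, d, e}"
  shows "forbidden R X"
proof -
  have "contains_pattern R X 5 {{1, 2}, {1, 2, 3, 4}, {3, 4}, {1, 4, 5}}"
    by (rule contains_pattern_list[of "[a, b, c, d, e]"]) (use assms in \<open>auto simp: atLeastAtMost_5\<close>)
  then show ?thesis unfolding forbidden_def by blast
qed

lemma forbidden_I_4':
  assumes "distinct [a, b, c, d, e]" "{a, b, c, d, e} \<subseteq> X"
    and "row_on R {a, b, c, d, e} {a, b}" "row_on R {a, b, c, d, e} {a, d, e}"
      "row_on R {a, b, c, d, e} {c, d}" "row_on R {a, b, c, d, e} {b, c, e}"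
  shows "forbidden R X"
proof -
  have "contains_pattern R X 5 {{1, 2}, {1, 4, 5}, {3, 4}, {2, 3, 5}}"
    by (rule contains_pattern_list[of "[a, b, c, d, e]"]) (use assms in \<open>auto simp: atLeastAtMost_5\<close>)
  then show ?thesis unfolding forbidden_def by blast
qed

lemma forbidden_IV:
  assumes "distinct [a, b, c, d, e, f]" "{a, b, c, d, e, f} \<subseteq> X"
    and "row_on R {a, b, c, d, e, f} {a, b}" "row_on R {a, b, c, d, e, f} {c, d}"
      "row_on R {a, b, c, d, e, f} {e, f}" "row_on R {a, b, c, d, e, f} {b, d, f}"
  shows "forbidden R X"
proof -
  have "contains_pattern R X 6 {{1, 2}, {3, 4}, {5, 6}, {2, 4, 6}}"
    by (rule contains_pattern_list[of "[a, b, c, d, e, f]"]) (use assms in \<open>auto simp: atLeastAtMost_6\<close>)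
  then show ?thesis unfolding forbidden_def by blast
qed

text \<open>If the pair is an intersection, \<open>c\<close> and \<open>d\<close> lie in exactly one
  of the two rows each. If both lie in the same row, the other row is the pair; if not, the rows
  miss one column each. The complement is treated alike.\<close>

lemma pair_realized_cases:
  assumes "{a, b} \<in> realized R W" "W = {a, b, c, d}" "distinct [a, b, c, d]"
  shows "row_on R W {a, b} \<or> row_on R W {c, d} \<or>
    (row_on R W (W - {a}) \<and> row_on R W (W - {b})) \<or> (row_on R W (W - {c}) \<and> row_on R W (W - {d}))"
  using assms(1)
proof (cases rule: realized_cases)
  case (row r)
  then show ?thesis unfolding row_on_def by blast
next
  case (corow r)
  then have "r \<inter> W = {c, d}" using assms(2,3) by auto
  then show ?thesis using corow unfolding row_on_def by blast
next
  case (meet r s)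
  have mem: "a \<in> r" "a \<in> s" "b \<in> r" "b \<in> s" "\<not> (c \<in> r \<and> c \<in> s)" "\<not> (d \<in> r \<and> d \<in> s)"
    "c \<in> r \<or> c \<in> s" "d \<in> r \<or> d \<in> s"
    using meet(3,4) assms(2,3) by auto
  consider "c \<in> r" "d \<in> r" | "c \<in> s" "d \<in> s" | "c \<in> r" "d \<in> s" | "c \<in> s" "d \<in> r" using mem by blast
  then show ?thesis
  proof cases
    case 1
    then have "s \<inter> W = {a, b}" using mem assms(2) by auto
    then show ?thesis using meet unfolding row_on_def by blast
  next
    case 2
    then have "r \<inter> W = {a, b}" using mem assms(2) by auto
    then show ?thesis using meet unfolding row_on_def by blast
  next
    case 3
    then have "r \<inter> W = W - {d}" "s \<inter> W = W - {c}" using mem assms(2,3) by auto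
    then show ?thesis using meet unfolding row_on_def by blast
  next
    case 4
    then have "r \<inter> W = W - {c}" "s \<inter> W = W - {d}" using mem assms(2,3) by auto
    then show ?thesis using meet unfolding row_on_def by blast
  qed
next
  case (comeet r s)
  have mem: "c \<in> r" "c \<in> s" "d \<in> r" "d \<in> s" "\<not> (a \<in> r \<and> a \<in> s)" "\<not> (b \<in> r \<and> b \<in> s)"
    "a \<in> r \<or> a \<in> s" "b \<in> r \<or> b \<in> s"
    using comeet(3,4) assms(2,3) by auto
  consider "a \<in> r" "b \<in> r" | "a \<in> s" "b \<in> s" | "a \<in> r" "b \<in> s" | "a \<in> s" "b \<in> r" using mem by blast
  then show ?thesis
  proof cases
    case 1
    then have "s \<inter> W = {c, d}" using mem assms(2) by auto
    then show ?thesis using comeet unfolding row_on_def by blast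
  next
    case 2
    then have "r \<inter> W = {c, d}" using mem assms(2) by auto
    then show ?thesis using comeet unfolding row_on_def by blast
  next
    case 3
    then have "r \<inter> W = W - {b}" "s \<inter> W = W - {a}" using mem assms(2,3) by auto
    then show ?thesis using comeet unfolding row_on_def by blast
  next
    case 4
    then have "r \<inter> W = W - {a}" "s \<inter> W = W - {b}" using mem assms(2,3) by auto
    then show ?thesis using comeet unfolding row_on_def by blast
  qed
qed

text \<open>Four columns split into two pairs in three ways, and the hypotheses say that all three
  splits are realized. The matrices on four columns exclude every combination of the possibilities
  in \<open>pair_realized_cases\<close>, which is a propositional check.\<close>

lemma forbidden_four_columns:
  assumes dist: "distinct [a, b, c, d]" and X: "{a, b, c, d} \<subseteq> X"
    and pairs: "{a, b} \<in> realized R {a, b, c, d}" "{b, c} \<in> realized R {a, b, c, d}"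
      "{a, c} \<in> realized R {a, b, c, d}"
  shows "forbidden R X"
proof (rule ccontr)
  assume no: "\<not> forbidden R X"
  define W where "W = {a, b, c, d}"
  define P where "P p q \<longleftrightarrow> row_on R W {p, q}" for p q
  define co where "co p \<longleftrightarrow> row_on R W (W - {p})" for p
  have P_sym: "P p q \<longleftrightarrow> P q p" for p q by (simp add: P_def insert_commute)
  have W: "W = {p, q, r, s}" if "{p, q, r, s} \<subseteq> W" "distinct [p, q, r, s]" for p q r s
  proof -
    have "card {p, q, r, s} = card W" "finite W" using that(2) dist by (simp_all add: W_def)
    with that(1) show ?thesis using card_subset_eq by metis
  qed
  \<comment> \<open>In this order: \<open>append_zero_col (M_I 3)\<close>, \<open>M_III 3\<close>,
    \<open>M_II 4\<close>, \<open>complement_rows [0, 1, 0, 0] (M_II 4)\<close>,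
    \<open>M_VI\<close>.\<close>
  have avoid: "\<not> (P p q \<and> P q r \<and> P p r)" "\<not> (P p q \<and> P q r \<and> P q s)"
      "\<not> (P p q \<and> P q r \<and> co p \<and> co r)" "\<not> (P p q \<and> P p s \<and> co p \<and> co r)"
      "\<not> (co p \<and> co q \<and> co r)"
    if sub: "{p, q, r, s} \<subseteq> W" and d: "distinct [p, q, r, s]" for p q r s
  proof -
    note W = W[OF sub d]
    have coP: "co p \<longleftrightarrow> row_on R W {q, r, s}" "co q \<longleftrightarrow> row_on R W {p, r, s}"
      "co r \<longleftrightarrow> row_on R W {p, q, s}"
      using d by (auto simp: co_def W insert_Diff_if)
    have WX: "{p, q, r, s} \<subseteq> X" using X sub by (auto simp: W_def)
    show "\<not> (P p q \<and> P q r \<and> P p r)"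
      using forbidden_I_3[OF d WX] no unfolding P_def W by blast
    show "\<not> (P p q \<and> P q r \<and> P q s)"
      using forbidden_III_3[OF d WX] no unfolding P_def W by blast
    show "\<not> (P p q \<and> P q r \<and> co p \<and> co r)"
      using forbidden_II_4[OF d WX] no unfolding coP P_def W by blast
    show "\<not> (P p q \<and> P p s \<and> co p \<and> co r)"
      using forbidden_II_4'[OF d WX] no unfolding coP P_def W by blast
    show "\<not> (co p \<and> co q \<and> co r)"
      using forbidden_VI[OF d WX] no unfolding coP W by blast
  qed
  have cases: "P p q \<or> P r s \<or> (co p \<and> co q) \<or> (co r \<and> co s)"
    if "{p, q} \<in> realized R W" "{p, q, r, s} \<subseteq> W" "distinct [p, q, r, s]" for p q r s
    using pair_realized_cases[OF that(1) W[OF that(2,3)] that(3)] by (simp add: P_def co_def)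
  have in_W: "a \<in> W" "b \<in> W" "c \<in> W" "d \<in> W" by (simp_all add: W_def)
  have neq: "a \<noteq> b" "b \<noteq> a" "a \<noteq> c" "c \<noteq> a" "a \<noteq> d" "d \<noteq> a" "b \<noteq> c" "c \<noteq> b" "b \<noteq> d" "d \<noteq> b" "c \<noteq> d" "d \<noteq> c"
    using dist by auto
  have ab: "P a b \<or> P c d \<or> (co a \<and> co b) \<or> (co c \<and> co d)"
    and bc: "P b c \<or> P a d \<or> (co b \<and> co c) \<or> (co a \<and> co d)"
    and ac: "P a c \<or> P b d \<or> (co a \<and> co c) \<or> (co b \<and> co d)"
    using cases[of a b c d] cases[of b c a d] cases[of a c b d] pairs in_W neq by (simp_all add: W_def)
  note sym = P_sym[of b a] P_sym[of c a] P_sym[of d a] P_sym[of c b] P_sym[of d b] P_sym[of d c]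
  have three: "\<not> (co a \<and> co b \<and> co c)" "\<not> (co a \<and> co b \<and> co d)" "\<not> (co a \<and> co c \<and> co d)"
      "\<not> (co b \<and> co c \<and> co d)"
    using avoid(5)[of a b c d] avoid(5)[of a b d c] avoid(5)[of a c d b] avoid(5)[of b c d a] in_W neq
    by simp_all
  have triangle: "\<not> (P a b \<and> P b c \<and> P a c)" "\<not> (P a b \<and> P b d \<and> P a d)" "\<not> (P a c \<and> P c d \<and> P a d)"
      "\<not> (P b c \<and> P c d \<and> P b d)"
    using avoid(1)[of a b c d] avoid(1)[of a b d c] avoid(1)[of a c d b] avoid(1)[of b c d a] in_W neq
    by simp_all
  have star: "\<not> (P a b \<and> P a c \<and> P a d)" "\<not> (P a b \<and> P b c \<and> P b d)" "\<not> (P a c \<and> P b c \<and> P c d)"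
      "\<not> (P a d \<and> P b d \<and> P c d)"
    using avoid(2)[of b a c d] avoid(2)[of a b c d] avoid(2)[of a c b d] avoid(2)[of a d b c] in_W neq
    by (simp_all add: sym)
  \<comment> \<open>Given \<open>co p\<close> and \<open>co q\<close>, at most one of the two splits
    that separate \<open>p\<close> from \<open>q\<close> is shown by a row.\<close>
  have co_pair: "\<not> (co p \<and> co q \<and> (P p r \<or> P q s) \<and> (P p s \<or> P q r))"
    if sub: "{p, q, r, s} \<subseteq> W" and d: "distinct [p, q, r, s]" for p q r s
    using avoid(3)[of p r q s] avoid(3)[of p s q r] avoid(4)[of p r q s] avoid(4)[of q s p r]
      avoid(4)[of p s q r] avoid(4)[of q r p s] that
    by (auto simp: P_sym)
  have co6: "\<not> (co a \<and> co b \<and> (P a c \<or> P b d) \<and> (P a d \<or> P b c))"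
    "\<not> (co c \<and> co d \<and> (P a c \<or> P b d) \<and> (P a d \<or> P b c))"
    "\<not> (co b \<and> co c \<and> (P a b \<or> P c d) \<and> (P b d \<or> P a c))"
    "\<not> (co a \<and> co d \<and> (P a b \<or> P c d) \<and> (P a c \<or> P b d))"
    "\<not> (co a \<and> co c \<and> (P a b \<or> P c d) \<and> (P a d \<or> P b c))"
    "\<not> (co b \<and> co d \<and> (P a b \<or> P c d) \<and> (P b c \<or> P a d))"
    using co_pair[of a b c d] co_pair[of c d a b] co_pair[of b c a d] co_pair[of a d b c]
      co_pair[of a c b d] co_pair[of b d a c] in_W neq
    by (auto simp: sym)
  show False using ab bc ac three triangle star co6 by argo
qed


section \<open>Forbidden patterns in isolated cycles\<close>

text \<open>
  A shortest isolated cycle \<open>u\<close>, indexed periodically with period \<open>k\<close>. Since chords give shorter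
  cycles, a realized set avoiding \<open>w\<close> that is not the whole cycle has at most two, adjacent, vertices.
\<close>

locale shortest_cycle =
  fixes R :: "'a set set" and X :: "'a set" and k :: int and u :: "int \<Rightarrow> 'a" and w :: 'a
  assumes period: "u i = u j \<longleftrightarrow> k dvd i - j"
    and in_X: "u i \<in> X" "w \<in> X" and isolated: "w \<noteq> u i"
    and long: "4 \<le> k"
    and edge: "{u i, u (i + 1)} \<in> realized R (insert w (range u))"
    and no_shorter: "v ` {..n} \<subseteq> X \<Longrightarrow> y \<in> X \<Longrightarrow> int n + 1 < k \<Longrightarrow>
      \<not> isolated_cycle (realized R (insert y (v ` {..n}))) n v y"
begin

section \<open>Chords of a shortest cycle\<close>

definition W where "W = insert w (range u)"

lemma u_in_W: "u i \<in> W" "w \<in> W" by (auto simp: W_def)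

lemma u_neq: "0 < j - i \<Longrightarrow> j - i < k \<Longrightarrow> u i \<noteq> u j"
  unfolding period using zdvd_not_zless by (metis dvd_diff_commute)

lemma u_near [simp]:
  "u (i + 1) \<noteq> u i" "u (i + 2) \<noteq> u i" "u (i + 3) \<noteq> u i"
  "u (i + 2) \<noteq> u (i + 1)" "u (i + 3) \<noteq> u (i + 1)" "u (i + 3) \<noteq> u (i + 2)"
  by (rule not_sym[OF u_neq]; use long in simp)+

lemmas u_near' [simp] = u_near[THEN not_sym]

lemma u_add: "u i = u j \<Longrightarrow> u (i + c) = u (j + c)"
  by (simp add: period)

lemma edge_W: "{u i, u (i + 1)} \<in> realized R W"
  using edge by (simp add: W_def)

lemma w_neq [simp]: "u i \<noteq> w" "w \<noteq> u i"
  using isolated by metis+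

lemma W_sub_X: "W \<subseteq> X"
  using in_X by (auto simp: W_def)

lemma u_shift [simp]: "u (i + k) = u i"
  by (simp add: period)

lemma u_reduce:
  obtains j where "i \<le> j" "j < i + k" "u m = u j"
proof
  show "i \<le> i + (m - i) mod k" "i + (m - i) mod k < i + k" using long by simp_all
  have "k dvd (m - i) - (m - i) mod k" by (rule dvd_minus_mod)
  then show "u m = u (i + (m - i) mod k)" unfolding period by (simp add: algebra_simps)
qed

text \<open>The stretch from \<open>u i\<close> to \<open>u j\<close>, closed by \<open>S\<close>,
  is an isolated cycle with \<open>w\<close> outside; \<open>j - i \<le> k - 2\<close> makes it
  shorter.\<close>

lemma chord_absurd:
  assumes S: "S \<in> realized R W" "w \<notin> S" and ij: "u i \<in> S" "u j \<in> S" "2 \<le> j - i" "j - i \<le> k - 2"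
    and between: "\<And>l. i < l \<Longrightarrow> l < j \<Longrightarrow> u l \<notin> S"
  shows False
proof -
  define n where "n = nat (j - i)"
  define v where "v m = u (i + int m)" for m
  let ?W = "insert w (v ` {..n})"
  have n: "int n = j - i" using ij by (simp add: n_def)
  have sub: "?W \<subseteq> W" by (auto simp: W_def v_def)
  have inj: "v a \<noteq> v b" if "a < b" "b \<le> n" for a b
    unfolding v_def using that n ij by (intro u_neq) auto
  have "isolated_cycle (realized R ?W) n v w"
    unfolding isolated_cycle_def
  proof (intro conjI allI impI)
    show "2 \<le> n" using n ij by simp
    show "inj_on v {..n}" using inj by (metis inj_onI atMost_iff linorder_neqE_nat)
    show "w \<notin> v ` {..n}" using isolated by (auto simp: v_def)
    show "{v m, v (Suc m)} \<in> realized R ?W" if "m < n" for m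
    proof -
      have "u (i + int m + 1) = v (Suc m)" by (simp add: v_def algebra_simps)
      then have "{v m, v (Suc m)} \<in> realized R W" using edge_W[of "i + int m"] by (simp add: v_def)
      then show ?thesis by (rule realized_restrictI[OF _ sub]) (use that in auto)
    qed
    have "S \<inter> ?W = {v 0, v n}"
    proof (rule Set.set_eqI)
      fix x
      show "x \<in> S \<inter> ?W \<longleftrightarrow> x \<in> {v 0, v n}"
      proof
        assume x: "x \<in> S \<inter> ?W"
        then obtain m where m: "m \<le> n" "x = v m" using S(2) by auto
        then show "x \<in> {v 0, v n}" using between[of "i + int m"] x n by (cases "m = 0 \<or> m = n") (auto simp: v_def)
      next
        assume "x \<in> {v 0, v n}"
        moreover have "v 0 = u i" "v n = u j" using n by (simp_all add: v_def)
        moreover have "v 0 \<in> ?W" "v n \<in> ?W" by auto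
        ultimately show "x \<in> S \<inter> ?W" using ij by auto
      qed
    qed
    then show "{v 0, v n} \<in> realized R ?W" using realized_restrictI[OF S(1) sub] by simp
  qed
  moreover have "v ` {..n} \<subseteq> X" using in_X by (auto simp: v_def)
  moreover have "int n + 1 < k" using n ij by simp
  ultimately show False using no_shorter[of v n w] in_X by blast
qed

lemma interval_in_S:
  assumes S: "S \<in> realized R W" "w \<notin> S"
  shows "u i \<in> S \<Longrightarrow> u j \<in> S \<Longrightarrow> j - i \<le> k - 2 \<Longrightarrow> i \<le> l \<Longrightarrow> l \<le> j \<Longrightarrow> u l \<in> S"
proof (induction "nat (j - i)" arbitrary: i j rule: less_induct)
  case less
  show ?case
  proof (rule ccontr)
    assume l: "u l \<notin> S"
    then have il: "i < l" "l < j" using less.prems by (metis order_le_less)+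
    then obtain m where m: "i < m" "m < j" "u m \<in> S"
      using chord_absurd[OF S less.prems(1,2)] less.prems(3) by force
    show False
    proof (cases "l \<le> m")
      case True
      then show ?thesis using less.hyps[of m i] less.prems m l by auto
    next
      case False
      then show ?thesis using less.hyps[of j m] less.prems m l by auto
    qed
  qed
qed

text \<open>Both ways around the cycle between \<open>u i\<close> and \<open>u j\<close> have length
  at most \<open>k - 2\<close>, so \<open>interval_in_S\<close> fills both.\<close>

lemma nonadjacent_absurd:
  assumes S: "S \<in> realized R W" "w \<notin> S" and ij: "u i \<in> S" "u j \<in> S" "2 \<le> j - i" "j - i \<le> k - 2"
    and l: "u l \<notin> S"
  shows False
proof -
  obtain m where m: "i \<le> m" "m < i + k" "u l = u m" by (rule u_reduce)
  show False
  proof (cases "m \<le> j")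
    case True
    then show ?thesis using interval_in_S[OF S ij(1,2,4) m(1)] l m by simp
  next
    case False
    then show ?thesis using interval_in_S[OF S, of j "i + k" m] ij l m by simp
  qed
qed

lemma adjacent_only:
  assumes S: "S \<in> realized R W" "w \<notin> S" and i: "u i \<in> S" "u (i + 1) \<in> S" and l: "u l \<notin> S"
  shows "S = {u i, u (i + 1)}"
proof -
  have "x \<in> {u i, u (i + 1)}" if x: "x \<in> S" for x
  proof -
    have "x \<in> W" using x S realized_subset by blast
    then obtain m where "x = u m" using x S(2) by (auto simp: W_def)
    moreover obtain j where j: "i \<le> j" "j < i + k" "u m = u j" by (rule u_reduce)
    ultimately have xj: "x = u j" by simp
    show ?thesis
    proof (rule ccontr)
      assume "x \<notin> {u i, u (i + 1)}"
      then have "j \<noteq> i" "j \<noteq> i + 1" using xj by auto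
      then have "2 \<le> j - i" using j by simp
      then show False
        using nonadjacent_absurd[OF S i(1), of j l] nonadjacent_absurd[OF S i(2), of j l] x xj l j long
        by (cases "j - i \<le> k - 2") auto
    qed
  qed
  then show ?thesis using i by blast
qed

section \<open>The rows behind the edges of a shortest cycle\<close>

definition E where "E i = {u i, u (i + 1)}"
definition A where "A i \<longleftrightarrow> row_on R W (E i)"
definition B where "B i \<longleftrightarrow> row_on R W (W - E i)"
definition co where "co i \<longleftrightarrow> row_on R W (W - {u i})"

lemma E_W: "E i \<subseteq> W" "{u i} \<subseteq> W" by (auto simp: E_def W_def)

lemma E_shift: "u i = u j \<Longrightarrow> E i = E j"
  using u_add[of i j 1] by (simp add: E_def)

text \<open>Three vertices do not exhaust a cycle of length at least 4.\<close>

lemma small_union_absurd: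
  assumes "S \<in> realized R W" "w \<notin> S" "u i \<in> S" "u j \<in> S" "2 \<le> j - i" "j - i \<le> k - 2"
    and "S \<subseteq> {u a, u b, u c}"
  shows False
proof -
  have "\<exists>l. u l \<notin> {u a, u b, u c}"
  proof (rule ccontr)
    assume "\<not> ?thesis"
    then have "{u 0, u 1, u 2, u 3} \<subseteq> {u a, u b, u c}" by blast
    then have "card {u 0, u 1, u 2, u 3} \<le> card {u a, u b, u c}" by (intro card_mono) auto
    also have "\<dots> \<le> 3" by (simp add: card_insert_if)
    finally show False using u_near[of 0] u_near'[of 0] by (simp del: u_near u_near')
  qed
  then show False using nonadjacent_absurd[OF assms(1-6)] assms(7) by blast
qed

text \<open>Delete \<open>u (i + 1)\<close>. The two rows now miss only \<open>u i\<close> and only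
  \<open>u (i + 2)\<close>, so they cover the remaining columns and realize this pair, which bridges
  the gap.\<close>

lemma no_adjacent_B: "\<not> (B i \<and> B (i + 1))"
proof
  assume B2: "B i \<and> B (i + 1)"
  define n where "n = nat (k - 2)"
  have n: "int n = k - 2" using long by (simp add: n_def)
  \<comment> \<open>The n + 1 = k - 1 vertices from \<open>u (i + 2)\<close> around to
    \<open>u (i + k)\<close>, which is \<open>u i\<close>.\<close>
  define v where "v m = u (i + 2 + int m)" for m
  let ?W = "insert w (v ` {..n})"
  have vn: "v n = u i" using u_shift[of i] by (simp add: v_def n)
  have sub: "?W \<subseteq> W" by (auto simp: W_def v_def)
  have inj: "v a \<noteq> v b" if "a < b" "b \<le> n" for a b
    unfolding v_def using that n by (intro u_neq) auto
  have notin: "u (i + 1) \<notin> ?W"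
  proof -
    have "u (i + 1) \<noteq> v m" if "m \<le> n" for m unfolding v_def using that n by (intro u_neq) auto
    then show ?thesis using isolated[of "i + 1"] by auto
  qed
  have v0: "v 0 = u (i + 2)" by (simp add: v_def)
  have in_v: "u i \<in> ?W" "u (i + 2) \<in> ?W" unfolding vn[symmetric] v0[symmetric] by auto
  have "{u i} \<union> {u (i + 2)} \<in> realized R ?W"
  proof (rule disjoint_corows_realized)
    have "i + 1 + 1 = i + 2" by simp
    then have rows: "row_on R W (W - {u i, u (i + 1)})" "row_on R W (W - {u (i + 1), u (i + 2)})"
      using B2 unfolding B_def E_def by metis+
    show "row_on R ?W (?W - {u i})"
      by (rule row_on_restrict[OF rows(1) sub]) (use sub notin in blast)
    show "row_on R ?W (?W - {u (i + 2)})"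
      by (rule row_on_restrict[OF rows(2) sub]) (use sub notin in blast)
  qed (use in_v in auto)
  then have close: "{v 0, v n} \<in> realized R ?W" using vn v0 by (simp add: insert_commute)
  have "isolated_cycle (realized R ?W) n v w"
    unfolding isolated_cycle_def
  proof (intro conjI allI impI)
    show "2 \<le> n" using n long by simp
    show "inj_on v {..n}" using inj by (metis inj_onI atMost_iff linorder_neqE_nat)
    show "w \<notin> v ` {..n}" using isolated by (auto simp: v_def)
    show "{v m, v (Suc m)} \<in> realized R ?W" if "m < n" for m
    proof -
      have "u (i + 2 + int m + 1) = v (Suc m)" by (simp add: v_def algebra_simps)
      then have "{v m, v (Suc m)} \<in> realized R W" using edge_W[of "i + 2 + int m"] by (simp add: v_def)
      then show ?thesis by (rule realized_restrictI[OF _ sub]) (use that in auto)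
    qed
  qed (rule close)
  moreover have "v ` {..n} \<subseteq> X" using in_X by (auto simp: v_def)
  ultimately show False using no_shorter[of v n w] in_X n by simp
qed

text \<open>If the edge is an intersection of two rows, a row missing \<open>w\<close> is the edge
  itself or the whole cycle. In the latter case the complement of the other row is the cycle without
  the edge; being realized and missing \<open>w\<close>, it is a pair of adjacent vertices, whence
  \<open>k = 4\<close>. If the complement of the edge is an intersection, the rows miss one endpoint
  each unless one of them misses both.\<close>

lemma edge_cases: "A i \<or> B i \<or> (co i \<and> co (i + 1)) \<or> (k = 4 \<and> row_on R W (range u) \<and> B (i + 2))"
proof -
  have un: "u i \<noteq> u (i + 1)" using long by (intro u_neq) auto
  have meet_case: "A i \<or> (k = 4 \<and> row_on R W (range u) \<and> B (i + 2))"
    if rs: "r \<in> R" "s \<in> R" "W \<subseteq> r \<union> s" "r \<inter> s \<inter> W = E i" "w \<notin> r" for r s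
  proof (cases "r \<inter> W = E i")
    case True
    then show ?thesis using rs unfolding A_def row_on_def by blast
  next
    case False
    have E: "u i \<in> r" "u (i + 1) \<in> r" "u i \<in> s" "u (i + 1) \<in> s"
      using rs(4) by (auto simp: E_def)
    have all: "u l \<in> r" for l
      using adjacent_only[OF realized_row[OF rs(1)], of i l] False rs(5) E u_in_W by (auto simp: E_def)
    then have r: "r \<inter> W = range u" using rs(5) by (auto simp: W_def)
    have ns: "W - s = range u - E i" using rs isolated all by (auto simp: W_def E_def)
    have S: "W - s \<in> realized R W" by (rule realized_corow[OF rs(2)])
    have "w \<notin> W - s" using ns isolated by auto
    note S = S this
    have un: "u (i + 2) \<notin> E i" "u (i + 3) \<notin> E i"
      by (auto simp: E_def)
    have "k = 4"
    proof (rule ccontr)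
      assume "k \<noteq> 4"
      then have "u i \<noteq> u (i + 4)" "u (i + 1) \<noteq> u (i + 4)" using long by (intro u_neq; simp)+
      then have "u (i + 4) \<notin> E i" by (auto simp: E_def)
      then show False
        using nonadjacent_absurd[OF S, of "i + 2" "i + 4" i] un ns \<open>k \<noteq> 4\<close> long by (auto simp: E_def)
    qed
    moreover have "W - s = E (i + 2)"
      using adjacent_only[OF S, of "i + 2" i] un ns by (auto simp: E_def add.commute)
    then have "s \<inter> W = W - E (i + 2)" by blast
    ultimately show ?thesis using r rs(1,2) unfolding B_def row_on_def by blast
  qed
  from edge[of i] have "E i \<in> realized R W" by (simp add: E_def W_def)
  then show ?thesis
  proof (cases rule: realized_cases)
    case (row r)
    then show ?thesis unfolding A_def row_on_def by blast
  next
    case (corow r)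
    then show ?thesis unfolding B_def row_on_def by blast
  next
    case (meet r s)
    have "w \<notin> r \<inter> s \<inter> W" using meet(4) by (simp add: E_def)
    then have "w \<notin> r \<or> w \<notin> s" using u_in_W(2) by blast
    moreover have "W \<subseteq> s \<union> r" "s \<inter> r \<inter> W = E i" using meet(3,4) by auto
    ultimately show ?thesis using meet_case[OF meet] meet_case[OF meet(2,1)] by blast
  next
    case (comeet r s)
    have out: "x \<in> r" "x \<in> s" if "x \<in> W" "x \<notin> E i" for x using comeet(4) that by blast+
    have mem: "\<not> (u i \<in> r \<and> u i \<in> s)" "\<not> (u (i + 1) \<in> r \<and> u (i + 1) \<in> s)"
      "u i \<in> r \<or> u i \<in> s" "u (i + 1) \<in> r \<or> u (i + 1) \<in> s"
      using comeet(3,4) u_in_W by (auto simp: E_def)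
    consider "u i \<in> r" "u (i + 1) \<in> r" | "u i \<in> s" "u (i + 1) \<in> s" | "u i \<in> r" "u (i + 1) \<in> s"
      | "u i \<in> s" "u (i + 1) \<in> r" using mem by blast
    then show ?thesis
    proof cases
      case 1
      then have "s \<inter> W = W - E i" using mem out by (auto simp: E_def)
      then show ?thesis using comeet unfolding B_def row_on_def by blast
    next
      case 2
      then have "r \<inter> W = W - E i" using mem out by (auto simp: E_def)
      then show ?thesis using comeet unfolding B_def row_on_def by blast
    next
      case 3
      then have "r \<inter> W = W - {u (i + 1)}" "s \<inter> W = W - {u i}" using mem out un by (auto simp: E_def)
      then show ?thesis using comeet unfolding co_def row_on_def by blast
    next
      case 4
      then have "r \<inter> W = W - {u i}" "s \<inter> W = W - {u (i + 1)}" using mem out un by (auto simp: E_def)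
      then show ?thesis using comeet unfolding co_def row_on_def by blast
    qed
  qed
qed

lemma B_shift:
  assumes "u i = u j"
  shows "B i = B j"
  using E_shift[OF assms] by (simp add: B_def)

lemma co_shift: "u i = u j \<Longrightarrow> co i = co j"
  by (simp add: co_def)

text \<open>The two rows cover \<open>W\<close>, so the pair \<open>u i\<close>, \<open>u j\<close>
  is realized and is a chord.\<close>

lemma co_co_absurd:
  assumes "co i" "co j" "2 \<le> j - i" "j - i \<le> k - 2"
  shows False
proof -
  have "u i \<noteq> u j" using assms(3,4) by (intro u_neq) auto
  then have "{u i} \<union> {u j} \<in> realized R W"
    using assms(1,2) E_W unfolding co_def by (intro disjoint_corows_realized) auto
  then show False
    using small_union_absurd[of "{u i} \<union> {u j}" i j i j j] assms(3,4) by auto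
qed

text \<open>Otherwise the two rows cover \<open>W\<close> and realize the edge together with
  \<open>u i\<close>: three vertices, two of them not adjacent.\<close>

lemma co_B_meet:
  assumes "co i" "B j"
  shows "u i \<in> E j"
proof (rule ccontr)
  assume no: "u i \<notin> E j"
  obtain m where m: "j \<le> m" "m < j + k" "u i = u m" by (rule u_reduce)
  have "m \<noteq> j" "m \<noteq> j + 1" using no m by (auto simp: E_def)
  have real: "{u i} \<union> E j \<in> realized R W"
    using assms no E_W unfolding co_def B_def by (intro disjoint_corows_realized) auto
  have w: "w \<notin> {u i} \<union> E j" using isolated by (auto simp: E_def)
  show False
  proof (cases "m - j \<le> k - 2")
    case True
    then show ?thesis
      using small_union_absurd[OF real w, of j m i j "j + 1"] m \<open>m \<noteq> j\<close> \<open>m \<noteq> j + 1\<close> by (auto simp: E_def)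
  next
    case False
    then show ?thesis
      using small_union_absurd[OF real w, of "j + 1" m i j "j + 1"] m long by (auto simp: E_def)
  qed
qed

lemma co_pair_B:
  assumes "co i" "co (i + 1)" "B j"
  shows "u i = u j"
proof (rule ccontr)
  assume "u i \<noteq> u j"
  then have "u i = u (j + 1)" using co_B_meet[OF assms(1,3)] by (simp add: E_def)
  then have "u (i + 1) = u (j + 2)" using u_add[of i "j + 1" 1] by (simp add: add.assoc)
  then show False using co_B_meet[OF assms(2,3)] by (simp add: E_def)
qed

text \<open>Two different edges of this kind have non-adjacent endpoints, against
  \<open>co_co_absurd\<close>.\<close>

lemma co_pair_unique:
  assumes "co i" "co (i + 1)" "co j" "co (j + 1)"
  shows "u i = u j"
proof (rule ccontr)
  assume no: "u i \<noteq> u j"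
  obtain m where m: "i \<le> m" "m < i + k" "u j = u m" by (rule u_reduce)
  have "co m" "co (m + 1)" using assms(3,4) m(3) u_add[OF m(3)] co_shift by blast+
  have "m \<noteq> i" using no m by auto
  consider "m = i + 1" | "m = i + k - 1" | "2 \<le> m - i" "m - i \<le> k - 2" using m \<open>m \<noteq> i\<close> by linarith
  then show False
  proof cases
    case 1
    then show False using co_co_absurd[of i "m + 1"] assms(1) \<open>co (m + 1)\<close> long by simp
  next
    case 2
    then show False using co_co_absurd[of "i + 1" m] assms(2) \<open>co m\<close> long by simp
  next
    case 3
    then show False using co_co_absurd[of i m] assms(1) \<open>co m\<close> by simp
  qed
qed

text \<open>By \<open>no_adjacent_B\<close> the edges share no vertex. So their union is realized,
  and having non-adjacent vertices it must be the whole cycle.\<close>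

lemma two_B:
  assumes "B i" "B j" "u i \<noteq> u j"
  shows "k = 4 \<and> u j = u (i + 2)"
proof -
  obtain m where m: "i \<le> m" "m < i + k" "u j = u m" by (rule u_reduce)
  have "B m" using assms(2) m(3) B_shift by blast
  have "m \<noteq> i" using assms(3) m by auto
  moreover have "m \<noteq> i + 1" using no_adjacent_B[of i] assms(1) \<open>B m\<close> by auto
  moreover have "m \<noteq> i + k - 1"
    using no_adjacent_B[of m] assms(1) \<open>B m\<close> B_shift[of "i + k" i] by auto
  ultimately have diff: "2 \<le> m - i" "m - i \<le> k - 2" using m by linarith+
  have ne: "u i \<noteq> u m" "u i \<noteq> u (m + 1)" "u (i + 1) \<noteq> u m" "u (i + 1) \<noteq> u (m + 1)"
    using diff by (intro u_neq; simp)+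
  have real: "E i \<union> E m \<in> realized R W"
    using assms(1) \<open>B m\<close> E_W ne unfolding B_def
    by (intro disjoint_corows_realized) (auto simp: E_def)
  have all: "u l \<in> E i \<union> E m" for l
    using nonadjacent_absurd[OF real, of i m l] isolated diff by (auto simp: E_def)
  have "m = i + 2"
  proof (rule ccontr)
    assume "m \<noteq> i + 2"
    then have "u (i + 2) \<noteq> u m" "u (i + 2) \<noteq> u (m + 1)" using diff by (intro u_neq; simp)+
    then show False using all[of "i + 2"] by (auto simp: E_def)
  qed
  moreover have "k = 4"
  proof (rule ccontr)
    assume "k \<noteq> 4"
    then have "u i \<noteq> u (i + 4)" "u (i + 1) \<noteq> u (i + 4)" "u (i + 2) \<noteq> u (i + 4)" "u (i + 3) \<noteq> u (i + 4)"
      using long by (intro u_neq; simp)+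
    then show False using all[of "i + 4"] \<open>m = i + 2\<close> by (auto simp: E_def add.assoc)
  qed
  ultimately show ?thesis using m(3) by simp
qed

section \<open>Reading off the forbidden pattern\<close>

lemma four_cycle_W:
  assumes "k = 4"
  shows "range u = {u (i + 1), u (i + 2), u (i + 3), u i}" "W = {u (i + 1), u (i + 2), u (i + 3), u i, w}"
proof -
  have "u m \<in> {u (i + 1), u (i + 2), u (i + 3), u i}" for m
  proof -
    obtain j where j: "i \<le> j" "j < i + k" "u m = u j" by (rule u_reduce)
    then have "j = i \<or> j = i + 1 \<or> j = i + 2 \<or> j = i + 3" using assms by linarith
    then show ?thesis using j(3) by auto
  qed
  then show *: "range u = {u (i + 1), u (i + 2), u (i + 3), u i}" by blast
  show "W = {u (i + 1), u (i + 2), u (i + 3), u i, w}" unfolding W_def * by blast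
qed

text \<open>Column \<open>j\<close> is \<open>u (i + j)\<close> and column \<open>k + 1\<close> is
  \<open>w\<close>. Column \<open>k\<close> is thus \<open>u i\<close>, so the edge
  \<open>E i\<close> joins the columns \<open>k\<close> and 1: the choice of \<open>i\<close> puts
  the exceptional edge at the closing place.\<close>

lemma contains_cycle_pattern:
  assumes "\<And>P. P \<in> \<P> \<Longrightarrow> \<exists>T. row_on R W T \<and>
      (\<forall>j\<in>{1..nat k}. u (i + int j) \<in> T \<longleftrightarrow> j \<in> P) \<and> (w \<in> T \<longleftrightarrow> nat k + 1 \<in> P)"
  shows "contains_pattern R X (nat k + 1) \<P>"
proof -
  define g where "g j = (if j \<le> nat k then u (i + int j) else w)" for j
  have inj: "g a \<noteq> g b" if "1 \<le> a" "a < b" "b \<le> nat k + 1" for a b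
  proof (cases "b \<le> nat k")
    case True
    then have "u (i + int a) \<noteq> u (i + int b)" using that long by (intro u_neq) linarith+
    then show ?thesis using True that by (simp add: g_def)
  next
    case False
    then show ?thesis using that by (auto simp: g_def)
  qed
  have "\<exists>r\<in>R. \<forall>j\<in>{1..nat k + 1}. g j \<in> r \<longleftrightarrow> j \<in> P" if P: "P \<in> \<P>" for P
  proof -
    obtain T where T: "row_on R W T" "\<And>j. j \<in> {1..nat k} \<Longrightarrow> u (i + int j) \<in> T \<longleftrightarrow> j \<in> P"
      "w \<in> T \<longleftrightarrow> nat k + 1 \<in> P" using assms[OF P] by blast
    obtain r where r: "r \<in> R" "r \<inter> W = T" using T(1) by (auto simp: row_on_def)
    have "x \<in> r \<longleftrightarrow> x \<in> T" if "x \<in> W" for x using r(2) that by blast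
    then have "g j \<in> r \<longleftrightarrow> j \<in> P" if "j \<in> {1..nat k + 1}" for j
      using T(2)[of j] T(3) that u_in_W by (cases "j \<le> nat k") (auto simp: g_def le_Suc_eq)
    then show ?thesis using r(1) by blast
  qed
  moreover have "inj_on g {1..nat k + 1}"
  proof (rule inj_onI)
    fix a b assume "a \<in> {1..nat k + 1}" "b \<in> {1..nat k + 1}" "g a = g b"
    then show "a = b" using inj[of a b] inj[of b a] by (cases a b rule: linorder_cases) auto
  qed
  moreover have "g ` {1..nat k + 1} \<subseteq> X" using in_X by (auto simp: g_def)
  ultimately show ?thesis unfolding contains_pattern_def by blast
qed

lemma E_index:
  assumes "1 \<le> m" "m < nat k" "1 \<le> j" "j \<le> nat k"
  shows "u (i + int j) \<in> E (i + int m) \<longleftrightarrow> j \<in> {m, m + 1}"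
proof -
  have less: "u (i + int a) \<noteq> u (i + int b)" if "1 \<le> a" "a < b" "b \<le> nat k" for a b
    using that long by (intro u_neq) linarith+
  have eq: "u (i + int a) = u (i + int b) \<longleftrightarrow> a = b" if "1 \<le> a" "a \<le> nat k" "1 \<le> b" "b \<le> nat k" for a b
    using less[of a b] less[of b a] that by (cases a b rule: linorder_cases) auto
  have "i + int m + 1 = i + int (m + 1)" by simp
  then have "E (i + int m) = {u (i + int m), u (i + int (m + 1))}" by (simp only: E_def)
  then show ?thesis using eq[of j m] eq[of j "m + 1"] assms by simp
qed

lemma first_index:
  assumes "1 \<le> j" "j \<le> nat k"
  shows "u (i + int j) = u i \<longleftrightarrow> j = nat k" "u (i + int j) = u (i + 1) \<longleftrightarrow> j = 1"
proof -
  show "u (i + int j) = u i \<longleftrightarrow> j = nat k"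
  proof (cases "j = nat k")
    case True
    then show ?thesis using long by simp
  next
    case False
    then have "u i \<noteq> u (i + int j)" using assms by (intro u_neq) auto
    then show ?thesis using False by auto
  qed
  show "u (i + int j) = u (i + 1) \<longleftrightarrow> j = 1"
  proof (cases "j = 1")
    case False
    then have "u (i + 1) \<noteq> u (i + int j)" using assms by (intro u_neq) auto
    then show ?thesis using False by auto
  qed simp
qed

lemma path_rows_pattern:
  assumes "\<And>m. u m \<noteq> u i \<Longrightarrow> A m" "P \<in> path_rows (nat k)"
  shows "\<exists>T. row_on R W T \<and>
      (\<forall>j\<in>{1..nat k}. u (i + int j) \<in> T \<longleftrightarrow> j \<in> P) \<and> (w \<in> T \<longleftrightarrow> nat k + 1 \<in> P)"
proof -
  obtain m where m: "1 \<le> m" "m < nat k" "P = {m, m + 1}" using assms(2) by auto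
  have "A (i + int m)" using assms(1) first_index(1)[of m i] m by simp
  moreover have "w \<notin> E (i + int m)" using isolated by (auto simp: E_def)
  ultimately show ?thesis
    using E_index[OF m(1,2)] m by (intro exI[of _ "E (i + int m)"]) (auto simp: A_def)
qed

text \<open>The edges that are not rows decide the matrix. None gives \<open>M_I\<close> with a zero
  column, one that is the complement of a row gives \<open>M_III\<close>, and one obtained from two
  rows missing an endpoint each gives \<open>M_II (k + 1)\<close>. Two complements, or the whole
  cycle as a row, need \<open>k = 4\<close> and give the complemented \<open>M_I 4\<close> and
  \<open>M_V\<close>.\<close>

theorem forbidden: "forbidden R X"
proof -
  have nat_k: "3 \<le> nat k" using long by simp
  have Ei: "u (i + int j) \<in> E i \<longleftrightarrow> j = 1 \<or> j = nat k" if "1 \<le> j" "j \<le> nat k" for i j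
    using first_index[OF that] by (auto simp: E_def)
  consider (full) i where "k = 4" "row_on R W (range u)" "B (i + 2)"
    | (co) i where "co i" "co (i + 1)" "\<And>j. A j \<or> B j \<or> (co j \<and> co (j + 1))"
    | (AB) "\<And>j. A j \<or> B j"
    using edge_cases by blast
  then show ?thesis
  proof cases
    case full
    have noB: "\<not> B (i + 1)" "\<not> B (i + 3)"
      using no_adjacent_B[of "i + 1"] no_adjacent_B[of "i + 2"] full(3) by (auto simp: add.assoc)
    have "B (i + 1 + 2) = B (i + 3)" by (simp add: add.assoc)
    then have A1: "A (i + 1)"
      using edge_cases[of "i + 1"] noB co_pair_B[of "i + 1" "i + 2"] full(3) by auto
    have "B (i + 3 + 2) = B (i + 1)"
      using B_shift[of "i + 3 + 2" "i + 1"] full(1) by (simp add: period)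
    then have A3: "A (i + 3)"
      using edge_cases[of "i + 3"] noB co_pair_B[of "i + 3" "i + 2"] full(3) by auto
    have "u (i + 3 + 1) = u i" "i + 1 + 1 = i + 2" "i + 2 + 1 = i + 3"
      using u_shift[of i] full(1) by (simp_all add: add.assoc)
    then have E: "E (i + 1) = {u (i + 1), u (i + 2)}" "E (i + 2) = {u (i + 2), u (i + 3)}"
      "E (i + 3) = {u (i + 3), u i}" by (simp_all only: E_def)
    note W4 = four_cycle_W[OF full(1), of i]
    have co: "W - E (i + 2) = {u (i + 1), u i, w}" unfolding W4 E by auto
    show ?thesis
      by (rule forbidden_V[of "u (i + 1)" "u (i + 2)" "u (i + 3)" "u i" w, folded W4(2)])
        (use A1 A3 full(2,3) W_sub_X in \<open>auto simp: A_def B_def E co[unfolded E] W4(1)\<close>)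
  next
    case co
    \<comment> \<open>By \<open>co_pair_B\<close> and \<open>co_pair_unique\<close> no edge other
      than \<open>E i\<close> can fail to be a row.\<close>
    have A: "A m" if "u m \<noteq> u i" for m
      using co(3)[of m] co_pair_B[OF co(1,2), of m] co_pair_unique[OF co(1,2), of m] that by auto
    have "contains_pattern R X (nat k + 1) (rows_II (nat k + 1))"
    proof (rule contains_cycle_pattern[where i = i])
      fix P assume "P \<in> rows_II (nat k + 1)"
      then consider "P = {1..nat k - 1} \<union> {nat k + 1}" | "P = {2..nat k + 1}" | "P \<in> path_rows (nat k)"
        by (auto simp: rows_II_def)
      then show "\<exists>T. row_on R W T \<and> (\<forall>j\<in>{1..nat k}. u (i + int j) \<in> T \<longleftrightarrow> j \<in> P) \<and>
          (w \<in> T \<longleftrightarrow> nat k + 1 \<in> P)"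
      proof cases
        case 1
        then show ?thesis using co(1) first_index(1)[of _ i] u_in_W isolated
          by (intro exI[of _ "W - {u i}"]) (auto simp: co_def)
      next
        case 2
        then show ?thesis using co(2) first_index(2)[of _ i] u_in_W isolated nat_k
          by (intro exI[of _ "W - {u (i + 1)}"]) (auto simp: co_def)
      next
        case 3
        show ?thesis by (rule path_rows_pattern[OF A 3])
      qed
    qed
    then show ?thesis unfolding forbidden_def using nat_k by blast
  next
    case AB
    show ?thesis
    proof (cases "\<exists>i. B i")
      case False
      then have A: "A m" for m using AB by blast
      have "contains_pattern R X (nat k + 1) (rows_I (nat k))"
      proof (rule contains_cycle_pattern[where i = 0])
        fix P assume "P \<in> rows_I (nat k)"
        then consider "P = {1, nat k}" | "P \<in> path_rows (nat k)" by (auto simp: rows_I_def)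
        then show "\<exists>T. row_on R W T \<and> (\<forall>j\<in>{1..nat k}. u (0 + int j) \<in> T \<longleftrightarrow> j \<in> P) \<and>
          (w \<in> T \<longleftrightarrow> nat k + 1 \<in> P)"
        proof cases
          case 1
          have "w \<notin> E 0" using isolated by (auto simp: E_def)
          then show ?thesis using A[of 0] Ei[of _ 0] 1 long
            by (intro exI[of _ "E 0"]) (auto simp: A_def)
        next
          case 2
          show ?thesis by (rule path_rows_pattern[OF A 2])
        qed
      qed
      then show ?thesis unfolding forbidden_def using nat_k by blast
    next
      case True
      then obtain i where i: "B i" by blast
      show ?thesis
      proof (cases "\<exists>j. B j \<and> u i \<noteq> u j")
        case True
        then obtain j where j: "k = 4" "u j = u (i + 2)" "B j" using two_B[OF i] by blast
        have B2: "B (i + 2)" using B_shift[OF j(2)] j(3) by simp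
        have A1: "A (i + 1)" and A3: "A (i + 3)"
          using AB[of "i + 1"] AB[of "i + 3"] no_adjacent_B[of i] no_adjacent_B[of "i + 2"] i B2
          by (auto simp: add.assoc)
        have "u (i + 3 + 1) = u i" "i + 1 + 1 = i + 2" "i + 2 + 1 = i + 3"
          using u_shift[of i] j(1) by (simp_all add: add.assoc)
        then have E: "E (i + 1) = {u (i + 1), u (i + 2)}" "E (i + 2) = {u (i + 2), u (i + 3)}"
          "E (i + 3) = {u (i + 3), u i}" by (simp_all only: E_def)
        note W4 = four_cycle_W[OF j(1), of i]
        have co: "W - E (i + 2) = {u (i + 1), u i, w}" "W - E i = {u (i + 2), u (i + 3), w}"
          unfolding W4 E by (auto simp: E_def)
        show ?thesis
          by (rule forbidden_I_4'[of "u (i + 1)" "u (i + 2)" "u (i + 3)" "u i" w, folded W4(2)])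
            (use A1 A3 i B2 W_sub_X in \<open>auto simp: A_def B_def E co[unfolded E]\<close>)
      next
        case False
        then have A: "A m" if "u m \<noteq> u i" for m using AB[of m] that by metis
        have "contains_pattern R X (nat k + 1) (rows_III (nat k))"
        proof (rule contains_cycle_pattern[where i = i])
          fix P assume "P \<in> rows_III (nat k)"
          then consider "P = {2..nat k - 1} \<union> {nat k + 1}" | "P \<in> path_rows (nat k)"
            by (auto simp: rows_III_def)
          then show "\<exists>T. row_on R W T \<and> (\<forall>j\<in>{1..nat k}. u (i + int j) \<in> T \<longleftrightarrow> j \<in> P) \<and>
            (w \<in> T \<longleftrightarrow> nat k + 1 \<in> P)"
          proof cases
            case 1
            have "w \<notin> E i" using isolated by (auto simp: E_def)
            then show ?thesis using i Ei[of _ i] 1 u_in_W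
              by (intro exI[of _ "W - E i"]) (auto simp: B_def)
          next
            case 2
            show ?thesis by (rule path_rows_pattern[OF A 2])
          qed
        qed
        then show ?thesis unfolding forbidden_def using nat_k by blast
      qed
    qed
  qed
qed

end

text \<open>The induction hypothesis provides \<open>no_shorter\<close>. A cycle on three vertices
  leaves only four columns and is settled directly.\<close>

theorem forbidden_if_isolated_cycle:
  assumes "v ` {..n} \<subseteq> X" "w \<in> X" "isolated_cycle (realized R (insert w (v ` {..n}))) n v w"
  shows "forbidden R X"
  using assms
proof (induction n arbitrary: v w rule: less_induct)
  case (less n)
  show ?case
  proof (rule ccontr)
    assume no: "\<not> forbidden R X"
    note cyc = less.prems(3)[unfolded isolated_cycle_def]
    show False
    proof (cases "n = 2")
      case True
      have W: "insert w (v ` {..n}) = {v 0, v 1, v 2, w}"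
        using True by (auto simp: numeral_2_eq_2 atMost_Suc)
      have neq: "v 0 \<noteq> v 1" "v 0 \<noteq> v 2" "v 1 \<noteq> v 2"
        using cyc True inj_onD[of v "{..n}" 0 1] inj_onD[of v "{..n}" 0 2] inj_onD[of v "{..n}" 1 2]
        by auto
      have "v 0 \<noteq> w" "v 1 \<noteq> w" "v 2 \<noteq> w" using cyc True by auto
      moreover have "{v 0, v 1} \<in> realized R {v 0, v 1, v 2, w}" "{v 1, v 2} \<in> realized R {v 0, v 1, v 2, w}"
        "{v 0, v 2} \<in> realized R {v 0, v 1, v 2, w}"
        using cyc True unfolding W by (auto simp: numeral_2_eq_2)
      moreover have "{v 0, v 1, v 2, w} \<subseteq> X" using less.prems(1,2) unfolding W[symmetric] by blast
      ultimately show False using forbidden_four_columns[of "v 0" "v 1" "v 2" w X R] no neq by auto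
    next
      case False
      then have n: "3 \<le> n" using cyc by simp
      define k where "k = int n + 1"
      define u where "u i = v (nat (i mod k))" for i
      have k: "0 < k" "4 \<le> k" using n by (auto simp: k_def)
      have idx: "nat (i mod k) \<le> n" for i
        using pos_mod_bound[OF k(1), of i] by (simp add: k_def nat_le_iff)
      have ran: "range u = v ` {..n}"
      proof
        show "range u \<subseteq> v ` {..n}" using idx by (auto simp: u_def)
        have "v m = u (int m)" if "m \<le> n" for m using that by (simp add: u_def k_def)
        then show "v ` {..n} \<subseteq> range u" by auto
      qed
      have "shortest_cycle R X k u w"
      proof
        show "u i = u j \<longleftrightarrow> k dvd i - j" for i j
        proof -
          have "u i = u j \<longleftrightarrow> nat (i mod k) = nat (j mod k)"
            using cyc idx[of i] idx[of j] unfolding u_def inj_on_def by auto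
          also have "\<dots> \<longleftrightarrow> i mod k = j mod k" using k(1) by (simp add: eq_nat_nat_iff)
          finally show ?thesis by (simp add: mod_eq_dvd_iff)
        qed
        show "u i \<in> X" "w \<in> X" "w \<noteq> u i" for i
          using less.prems(1,2) cyc ran by (metis image_subset_iff rangeI subsetD)+
        show "4 \<le> k" by (rule k)
        show "{u i, u (i + 1)} \<in> realized R (insert w (range u))" for i
        proof (cases "i mod k = k - 1")
          case True
          then have "(i + 1) mod k = 0" by (simp add: mod_add_eq[symmetric, of i 1]) (metis True add_diff_cancel_left' diff_add_cancel mod_add_left_eq mod_self)
          then have "{u i, u (i + 1)} = {v 0, v n}" using True by (auto simp: u_def k_def)
          then show ?thesis using cyc ran by simp
        next
          case False
          then have lt: "i mod k < k - 1" using pos_mod_bound[OF k(1), of i] by simp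
          have "(i + 1) mod k = (i mod k + 1) mod k" by (simp add: mod_simps)
          also have "\<dots> = i mod k + 1" using lt k by (intro mod_pos_pos_trivial) simp_all
          finally have "nat ((i + 1) mod k) = Suc (nat (i mod k))" using k(1) by (simp add: nat_add_distrib)
          moreover have "nat (i mod k) < n" using lt k by (simp add: k_def nat_less_iff)
          ultimately show ?thesis using cyc ran by (simp add: u_def)
        qed
        show "\<not> isolated_cycle (realized R (insert y (x ` {..m}))) m x y"
          if "x ` {..m} \<subseteq> X" "y \<in> X" "int m + 1 < k" for x m y
          using less.IH[of m x y] that no by (auto simp: k_def)
      qed
      then have "forbidden R X" by (rule shortest_cycle.forbidden)
      then show False using no by simp
    qed
  qed
qed


section \<open>Forbidden patterns in crossed blocks\<close>

lemma isolated_four_cycle: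
  assumes "distinct [a, b, c, d, w]"
    and "{a, b} \<in> \<F>" "{b, c} \<in> \<F>" "{c, d} \<in> \<F>" "{a, d} \<in> \<F>"
  shows "isolated_cycle \<F> 3 ((!) [a, b, c, d]) w" "(!) [a, b, c, d] ` {..3} = {a, b, c, d}"
proof -
  have idx: "{..3::nat} = {0, 1, 2, 3}" by auto
  show img: "(!) [a, b, c, d] ` {..3} = {a, b, c, d}" unfolding idx by simp
  have "m = 0 \<or> m = 1 \<or> m = 2" if "m < 3" for m :: nat using that by linarith
  then have "{[a, b, c, d] ! m, [a, b, c, d] ! Suc m} \<in> \<F>" if "m < 3" for m
    using that assms by fastforce
  moreover have "inj_on ((!) [a, b, c, d]) {..3}"
    using assms(1) unfolding idx by (auto simp: inj_on_def)
  ultimately show "isolated_cycle \<F> 3 ((!) [a, b, c, d]) w"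
    using assms unfolding isolated_cycle_def img by auto
qed

lemma isolated_three_cycle:
  assumes "distinct [a, b, c, w]" and "{a, b} \<in> \<F>" "{b, c} \<in> \<F>" "{a, c} \<in> \<F>"
  shows "isolated_cycle \<F> 2 ((!) [a, b, c]) w" "(!) [a, b, c] ` {..2} = {a, b, c}"
proof -
  have idx: "{..2::nat} = {0, 1, 2}" by auto
  show img: "(!) [a, b, c] ` {..2} = {a, b, c}" unfolding idx by simp
  have "m = 0 \<or> m = 1" if "m < 2" for m :: nat using that by linarith
  then have "{[a, b, c] ! m, [a, b, c] ! Suc m} \<in> \<F>" if "m < 2" for m
    using that assms by fastforce
  moreover have "inj_on ((!) [a, b, c]) {..2}"
    using assms(1) unfolding idx by (auto simp: inj_on_def)
  ultimately show "isolated_cycle \<F> 2 ((!) [a, b, c]) w"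
    using assms unfolding isolated_cycle_def img by auto
qed

lemma forbidden_if_four_cycle:
  assumes "distinct [a, b, c, d, w]" "{a, b, c, d, w} \<subseteq> X"
    and "{a, b} \<in> realized R {a, b, c, d, w}" "{b, c} \<in> realized R {a, b, c, d, w}"
      "{c, d} \<in> realized R {a, b, c, d, w}" "{a, d} \<in> realized R {a, b, c, d, w}"
  shows "forbidden R X"
proof -
  have "insert w {a, b, c, d} = {a, b, c, d, w}" by auto
  then show ?thesis
    using forbidden_if_isolated_cycle[of "(!) [a, b, c, d]" 3 X w R] isolated_four_cycle[OF assms(1,3-6)] assms(2)
    by simp
qed

text \<open>The assumptions are invariant under permuting the blocks and, by taking the complement
  of the crossing set, under exchanging all \<open>x\<close> with all \<open>y\<close>. Facts are
  proved in one position and transported by \<open>flip\<close>, \<open>swap\<close> and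
  \<open>rotate\<close>.\<close>

locale pattern_free_blocks =
  fixes R :: "'a set set" and X W :: "'a set" and x1 y1 x2 y2 x3 y3 :: 'a
  assumes W: "W = {x1, y1, x2, y2, x3, y3}" and W_sub: "W \<subseteq> X"
    and dist: "distinct [x1, y1, x2, y2, x3, y3]"
    and block1: "{x1, y1} \<in> realized R W" and block2: "{x2, y2} \<in> realized R W"
    and block3: "{x3, y3} \<in> realized R W" and crossing: "{x1, x2, x3} \<in> realized R W"
    and free: "\<not> forbidden R X"
begin

lemma flip: "pattern_free_blocks R X W y1 x1 y2 x2 y3 x3"
proof
  show "W = {y1, x1, y2, x2, y3, x3}" using W by auto
  have "W - {x1, x2, x3} = {y1, y2, y3}" using W dist by auto
  then show "{y1, y2, y3} \<in> realized R W" using realized_compl[OF crossing] by simp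
qed (use W_sub dist block1 block2 block3 free in \<open>auto simp: insert_commute\<close>)

lemma swap: "pattern_free_blocks R X W x1 y1 x3 y3 x2 y2"
proof
  show "W = {x1, y1, x3, y3, x2, y2}" using W by auto
qed (use W_sub dist block1 block2 block3 crossing free in \<open>auto simp: insert_commute\<close>)

lemma rotate: "pattern_free_blocks R X W x2 y2 x3 y3 x1 y1"
proof
  show "W = {x2, y2, x3, y3, x1, y1}" using W by auto
qed (use W_sub dist block1 block2 block3 crossing free in \<open>auto simp: insert_commute\<close>)

lemma crossing_compl: "{y1, y2, y3} \<in> realized R W"
  using pattern_free_blocks.crossing[OF flip] .

text \<open>\<open>S\<close>, the third block and the complement of the crossing set join
  \<open>y2\<close>, \<open>x3\<close> and \<open>y3\<close> pairwise, and none of them contains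
  \<open>x1\<close>.\<close>

lemma triangle_absurd:
  assumes "S \<in> realized R W" "x1 \<notin> S" "y2 \<in> S" "x3 \<in> S" "y3 \<notin> S"
  shows False
proof -
  have sub: "{y2, x3, y3, x1} \<subseteq> W" using W by auto
  have "forbidden R X"
  proof (rule forbidden_four_columns[of y2 x3 y3 x1])
    show "{y2, x3} \<in> realized R {y2, x3, y3, x1}"
      by (rule realized_restrictI[OF assms(1) sub]) (use assms in auto)
    show "{x3, y3} \<in> realized R {y2, x3, y3, x1}"
      by (rule realized_restrictI[OF block3 sub]) (use dist in auto)
    show "{y2, y3} \<in> realized R {y2, x3, y3, x1}"
      by (rule realized_restrictI[OF crossing_compl sub]) (use dist in auto)
  qed (use dist sub W_sub in auto)
  then show False using free by simp
qed

text \<open>The second and third block are joined by \<open>S\<close> at \<open>x2\<close>,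
  \<open>x3\<close> and by the complement of the crossing set at \<open>y2\<close>,
  \<open>y3\<close>, with \<open>x1\<close> outside.\<close>

lemma four_cycle_absurd:
  assumes "S \<in> realized R W" "x1 \<notin> S" "x2 \<in> S" "x3 \<in> S" "y2 \<notin> S" "y3 \<notin> S"
  shows False
proof -
  have sub: "{y2, x2, x3, y3, x1} \<subseteq> W" using W by auto
  have "forbidden R X"
  proof (rule forbidden_if_four_cycle[of y2 x2 x3 y3 x1])
    show "{y2, x2} \<in> realized R {y2, x2, x3, y3, x1}"
      by (rule realized_restrictI[OF block2 sub]) (use dist in auto)
    show "{x2, x3} \<in> realized R {y2, x2, x3, y3, x1}"
      by (rule realized_restrictI[OF assms(1) sub]) (use assms in auto)
    show "{x3, y3} \<in> realized R {y2, x2, x3, y3, x1}"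
      by (rule realized_restrictI[OF block3 sub]) (use dist in auto)
    show "{y2, y3} \<in> realized R {y2, x2, x3, y3, x1}"
      by (rule realized_restrictI[OF crossing_compl sub]) (use dist in auto)
  qed (use dist sub W_sub in auto)
  then show False using free by simp
qed

text \<open>Each \<open>x\<close> lies in exactly one of the two rows. A row with all three
  \<open>y\<close> and exactly one \<open>x\<close> has two \<open>x\<close> in its complement,
  against \<open>four_cycle_absurd\<close>. So one row takes all three \<open>x\<close>, and the
  other is the set of the \<open>y\<close>.\<close>

lemma crossing_meet:
  assumes "r \<in> R" "s \<in> R" "W \<subseteq> r \<union> s" "r \<inter> s \<inter> W = {y1, y2, y3}"
  shows "row_on R W {y1, y2, y3}"
proof -
  have y: "y1 \<in> r" "y2 \<in> r" "y3 \<in> r" "y1 \<in> s" "y2 \<in> s" "y3 \<in> s" using assms(4) by auto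
  have x: "x1 \<in> r \<longleftrightarrow> x1 \<notin> s" "x2 \<in> r \<longleftrightarrow> x2 \<notin> s" "x3 \<in> r \<longleftrightarrow> x3 \<notin> s"
  proof -
    have "z \<in> r \<longleftrightarrow> z \<notin> s" if "z \<in> W" "z \<notin> {y1, y2, y3}" for z using assms(3,4) that by blast
    moreover have "x1 \<in> W" "x2 \<in> W" "x3 \<in> W" by (simp_all add: W)
    moreover have "x1 \<notin> {y1, y2, y3}" "x2 \<notin> {y1, y2, y3}" "x3 \<notin> {y1, y2, y3}" using dist by auto
    ultimately show "x1 \<in> r \<longleftrightarrow> x1 \<notin> s" "x2 \<in> r \<longleftrightarrow> x2 \<notin> s" "x3 \<in> r \<longleftrightarrow> x3 \<notin> s" by blast+
  qed
  interpret q: pattern_free_blocks R X W x2 y2 x3 y3 x1 y1 by (rule rotate)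
  interpret q2: pattern_free_blocks R X W x3 y3 x1 y1 x2 y2 by (rule q.rotate)
  have in_W: "x1 \<in> W" "x2 \<in> W" "x3 \<in> W" by (simp_all add: W)
  have not_one: "\<not> (x1 \<in> t \<and> x2 \<notin> t \<and> x3 \<notin> t)" "\<not> (x2 \<in> t \<and> x3 \<notin> t \<and> x1 \<notin> t)"
    "\<not> (x3 \<in> t \<and> x1 \<notin> t \<and> x2 \<notin> t)"
    if t: "t \<in> R" and y: "y1 \<in> t" "y2 \<in> t" "y3 \<in> t" for t
    using four_cycle_absurd[OF realized_corow[OF t]] q.four_cycle_absurd[OF realized_corow[OF t]]
      q2.four_cycle_absurd[OF realized_corow[OF t]] y in_W by blast+
  have "x1 \<in> r \<and> x2 \<in> r \<and> x3 \<in> r \<or> x1 \<in> s \<and> x2 \<in> s \<and> x3 \<in> s"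
    using not_one[OF assms(1) y(1-3)] not_one[OF assms(2) y(4-6)] x by blast
  then have "s \<inter> W = {y1, y2, y3} \<or> r \<inter> W = {y1, y2, y3}" using x y W by auto
  then show ?thesis using assms(1,2) unfolding row_on_def by blast
qed

lemma crossing_row: "row_on R W {x1, x2, x3} \<or> row_on R W {y1, y2, y3}"
proof -
  have compl: "W - {x1, x2, x3} = {y1, y2, y3}" using W dist by auto
  from crossing show ?thesis
  proof (cases rule: realized_cases)
    case (row r)
    then show ?thesis unfolding row_on_def by blast
  next
    case (corow r)
    then show ?thesis unfolding row_on_def compl by blast
  next
    case (meet r s)
    then show ?thesis using pattern_free_blocks.crossing_meet[OF flip] by blast
  next
    case (comeet r s)
    then show ?thesis using crossing_meet unfolding compl by blast
  qed
qed

text \<open>Taken together: a realized set that misses the first block and meets both others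
  contains both of them.\<close>

lemma closed_pairs:
  assumes "S \<in> realized R W" "x1 \<notin> S" "y1 \<notin> S"
  shows "y2 \<in> S \<Longrightarrow> x3 \<in> S \<Longrightarrow> y3 \<in> S" "y3 \<in> S \<Longrightarrow> x2 \<in> S \<Longrightarrow> y2 \<in> S"
    "x2 \<in> S \<Longrightarrow> y3 \<in> S \<Longrightarrow> x3 \<in> S" "x3 \<in> S \<Longrightarrow> y2 \<in> S \<Longrightarrow> x2 \<in> S"
    "x2 \<in> S \<Longrightarrow> x3 \<in> S \<Longrightarrow> y2 \<in> S \<or> y3 \<in> S" "y2 \<in> S \<Longrightarrow> y3 \<in> S \<Longrightarrow> x2 \<in> S \<or> x3 \<in> S"
  using triangle_absurd[OF assms(1,2)] four_cycle_absurd[OF assms(1,2)]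
    pattern_free_blocks.triangle_absurd[OF swap assms(1,2)]
    pattern_free_blocks.triangle_absurd[OF flip assms(1,3)]
    pattern_free_blocks.four_cycle_absurd[OF flip assms(1,3)]
    pattern_free_blocks.triangle_absurd[OF pattern_free_blocks.swap[OF flip] assms(1,3)]
  by blast+

text \<open>If the block is an intersection of two rows, their complements share out the other two
  blocks, and by \<open>closed_pairs\<close> neither of these is split. If the complement of the
  block is an intersection, the rows cannot miss \<open>x1\<close> and \<open>y1\<close> separately:
  one of them, with the row given by \<open>crossing_row\<close>, would realize \<open>x2\<close>,
  \<open>x3\<close> or \<open>y2\<close>, \<open>y3\<close>.\<close>

lemma block_row:
  "row_on R W {x1, y1} \<or> row_on R W (W - {x1, y1}) \<or>
    (row_on R W (W - {x2, y2}) \<and> row_on R W (W - {x3, y3}))"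
  using block1
proof (cases rule: realized_cases)
  case (row r)
  then show ?thesis unfolding row_on_def by blast
next
  case (corow r)
  then show ?thesis unfolding row_on_def by blast
next
  case (meet r s)
  have in_W: "x2 \<in> W" "y2 \<in> W" "x3 \<in> W" "y3 \<in> W" by (simp_all add: W)
  have mem: "x1 \<in> r" "y1 \<in> r" "x1 \<in> s" "y1 \<in> s" using meet(4) by auto
  have out: "x2 \<in> r \<longleftrightarrow> x2 \<notin> s" "y2 \<in> r \<longleftrightarrow> y2 \<notin> s" "x3 \<in> r \<longleftrightarrow> x3 \<notin> s" "y3 \<in> r \<longleftrightarrow> y3 \<notin> s"
  proof -
    have "z \<in> r \<longleftrightarrow> z \<notin> s" if "z \<in> W" "z \<notin> {x1, y1}" for z using meet(3,4) that by blast
    moreover have "x2 \<notin> {x1, y1}" "y2 \<notin> {x1, y1}" "x3 \<notin> {x1, y1}" "y3 \<notin> {x1, y1}" using dist by auto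
    ultimately show "x2 \<in> r \<longleftrightarrow> x2 \<notin> s" "y2 \<in> r \<longleftrightarrow> y2 \<notin> s" "x3 \<in> r \<longleftrightarrow> x3 \<notin> s" "y3 \<in> r \<longleftrightarrow> y3 \<notin> s"
      using in_W by blast+
  qed
  have closed: "y2 \<notin> t \<longrightarrow> x3 \<notin> t \<longrightarrow> y3 \<notin> t" "y3 \<notin> t \<longrightarrow> x2 \<notin> t \<longrightarrow> y2 \<notin> t"
    "x2 \<notin> t \<longrightarrow> y3 \<notin> t \<longrightarrow> x3 \<notin> t" "x3 \<notin> t \<longrightarrow> y2 \<notin> t \<longrightarrow> x2 \<notin> t"
    "x2 \<notin> t \<longrightarrow> x3 \<notin> t \<longrightarrow> y2 \<notin> t \<or> y3 \<notin> t" "y2 \<notin> t \<longrightarrow> y3 \<notin> t \<longrightarrow> x2 \<notin> t \<or> x3 \<notin> t"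
    if t: "t \<in> R" and "x1 \<in> t" "y1 \<in> t" for t
  proof -
    have "x1 \<notin> W - t" "y1 \<notin> W - t" using that by auto
    note c = closed_pairs[OF realized_corow[OF t] this]
    show "y2 \<notin> t \<longrightarrow> x3 \<notin> t \<longrightarrow> y3 \<notin> t" "y3 \<notin> t \<longrightarrow> x2 \<notin> t \<longrightarrow> y2 \<notin> t"
      "x2 \<notin> t \<longrightarrow> y3 \<notin> t \<longrightarrow> x3 \<notin> t" "x3 \<notin> t \<longrightarrow> y2 \<notin> t \<longrightarrow> x2 \<notin> t"
      "x2 \<notin> t \<longrightarrow> x3 \<notin> t \<longrightarrow> y2 \<notin> t \<or> y3 \<notin> t" "y2 \<notin> t \<longrightarrow> y3 \<notin> t \<longrightarrow> x2 \<notin> t \<or> x3 \<notin> t"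
      using c in_W by blast+
  qed
  have same: "x2 \<in> r \<longleftrightarrow> y2 \<in> r" "x3 \<in> r \<longleftrightarrow> y3 \<in> r"
    using closed[OF meet(1) mem(1,2)] closed[OF meet(2) mem(3,4)] out by blast+
  consider "x2 \<in> r" "x3 \<in> r" | "x2 \<notin> r" "x3 \<notin> r" | "x2 \<in> r" "x3 \<notin> r" | "x2 \<notin> r" "x3 \<in> r" by blast
  then show ?thesis
  proof cases
    case 1
    then have "s \<inter> W = {x1, y1}" using same out mem W by auto
    then show ?thesis using meet unfolding row_on_def by blast
  next
    case 2
    then have "r \<inter> W = {x1, y1}" using same out mem W by auto
    then show ?thesis using meet unfolding row_on_def by blast
  next
    case 3
    then have "s \<inter> W = W - {x2, y2}" "r \<inter> W = W - {x3, y3}" using same out mem dist unfolding W by auto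
    then show ?thesis using meet unfolding row_on_def by blast
  next
    case 4
    then have "r \<inter> W = W - {x2, y2}" "s \<inter> W = W - {x3, y3}" using same out mem dist unfolding W by auto
    then show ?thesis using meet unfolding row_on_def by blast
  qed
next
  case (comeet r s)
  have out: "z \<in> r" "z \<in> s" if "z \<in> W" "z \<noteq> x1" "z \<noteq> y1" for z using comeet(4) that by blast+
  have "x1 \<in> W" "y1 \<in> W" "x1 \<notin> W - {x1, y1}" "y1 \<notin> W - {x1, y1}" by (simp_all add: W)
  then have mem: "x1 \<in> r \<longleftrightarrow> x1 \<notin> s" "y1 \<in> r \<longleftrightarrow> y1 \<notin> s" using comeet(3,4) by blast+
  have single: False if "row_on R W (W - {x1})" "row_on R W (W - {y1})"
    using crossing_row
  proof
    assume "row_on R W {x1, x2, x3}"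
    moreover have "W - {y1, y2, y3} = {x1, x2, x3}" using W dist by auto
    ultimately have "{x1} \<union> {y1, y2, y3} \<in> realized R W"
      using that(1) W dist by (intro disjoint_corows_realized) auto
    then have "W - ({x1} \<union> {y1, y2, y3}) \<in> realized R W" by (rule realized_compl)
    moreover have "W - ({x1} \<union> {y1, y2, y3}) = {x2, x3}" using W dist by auto
    ultimately have "{x2, x3} \<in> realized R W" by simp
    then show False by (rule four_cycle_absurd) (use dist in auto)
  next
    assume "row_on R W {y1, y2, y3}"
    moreover have "W - {x1, x2, x3} = {y1, y2, y3}" using W dist by auto
    ultimately have "{y1} \<union> {x1, x2, x3} \<in> realized R W"
      using that(2) W dist by (intro disjoint_corows_realized) auto
    then have "W - ({y1} \<union> {x1, x2, x3}) \<in> realized R W" by (rule realized_compl)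
    moreover have "W - ({y1} \<union> {x1, x2, x3}) = {y2, y3}" using W dist by auto
    ultimately have "{y2, y3} \<in> realized R W" by simp
    then show False by (rule pattern_free_blocks.four_cycle_absurd[OF flip]) (use dist in auto)
  qed
  consider "x1 \<in> r" "y1 \<in> r" | "x1 \<in> s" "y1 \<in> s" | "x1 \<in> r" "y1 \<in> s" | "x1 \<in> s" "y1 \<in> r" using mem by blast
  then show ?thesis
  proof cases
    case 1
    then have "s \<inter> W = W - {x1, y1}" using mem out by blast
    then show ?thesis using comeet unfolding row_on_def by blast
  next
    case 2
    then have "r \<inter> W = W - {x1, y1}" using mem out by blast
    then show ?thesis using comeet unfolding row_on_def by blast
  next
    case 3
    then have "s \<inter> W = W - {x1}" "r \<inter> W = W - {y1}" using mem out dist by auto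
    then show ?thesis using single comeet unfolding row_on_def by blast
  next
    case 4
    then have "r \<inter> W = W - {x1}" "s \<inter> W = W - {y1}" using mem out dist by auto
    then show ?thesis using single comeet unfolding row_on_def by blast
  qed
qed

text \<open>Without \<open>x1\<close> and \<open>x2\<close> the three rows miss one column each,
  namely \<open>y1\<close>, \<open>y2\<close> and \<open>x3\<close>, and share
  \<open>y3\<close>.\<close>

lemma two_corows_absurd:
  assumes "row_on R W (W - {x1, y1})" "row_on R W (W - {x2, y2})" "row_on R W {y1, y2, y3}"
  shows False
proof -
  have sub: "{y1, y2, x3, y3} \<subseteq> W" using W by auto
  have "forbidden R X"
  proof (rule forbidden_VI[of y1 y2 x3 y3])
    show "row_on R {y1, y2, x3, y3} {y1, y2, y3}"
      by (rule row_on_restrict[OF assms(3) sub]) (use dist in auto)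
    show "row_on R {y1, y2, x3, y3} {y2, x3, y3}"
      by (rule row_on_restrict[OF assms(1) sub]) (use dist W in auto)
    show "row_on R {y1, y2, x3, y3} {y1, x3, y3}"
      by (rule row_on_restrict[OF assms(2) sub]) (use dist W in auto)
  qed (use dist sub W_sub in auto)
  then show False using free by simp
qed

lemma no_two_corows: "\<not> (row_on R W (W - {x1, y1}) \<and> row_on R W (W - {x2, y2}))"
proof
  assume co: "row_on R W (W - {x1, y1}) \<and> row_on R W (W - {x2, y2})"
  from crossing_row show False
  proof
    assume "row_on R W {x1, x2, x3}"
    then show False
      using co by (intro pattern_free_blocks.two_corows_absurd[OF flip]) (simp_all add: insert_commute)
  next
    assume "row_on R W {y1, y2, y3}"
    then show False using co two_corows_absurd by blast
  qed
qed

text \<open>Without \<open>y1\<close> the row missing the first block becomes the row of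
  \<open>M_V\<close> with four ones.\<close>

lemma one_corow_absurd:
  assumes "row_on R W (W - {x1, y1})" "row_on R W {x2, y2}" "row_on R W {x3, y3}" "row_on R W {x1, x2, x3}"
  shows False
proof -
  have sub: "{x2, y2, y3, x3, x1} \<subseteq> W" using W by auto
  have "forbidden R X"
  proof (rule forbidden_V[of x2 y2 y3 x3 x1])
    show "row_on R {x2, y2, y3, x3, x1} {x2, y2}"
      by (rule row_on_restrict[OF assms(2) sub]) (use dist in auto)
    show "row_on R {x2, y2, y3, x3, x1} {x2, y2, y3, x3}"
      by (rule row_on_restrict[OF assms(1) sub]) (use dist W in auto)
    show "row_on R {x2, y2, y3, x3, x1} {y3, x3}"
      by (rule row_on_restrict[OF assms(3) sub]) (use dist W in auto)
    show "row_on R {x2, y2, y3, x3, x1} {x2, x3, x1}"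
      by (rule row_on_restrict[OF assms(4) sub]) (use dist W in auto)
  qed (use dist sub W_sub in auto)
  then show False using free by simp
qed

lemma one_corow_row_absurd:
  assumes "row_on R W (W - {x1, y1})" "row_on R W {x2, y2}" "row_on R W {x3, y3}"
  shows False
  using crossing_row
proof
  assume "row_on R W {y1, y2, y3}"
  then show False
    using assms by (intro pattern_free_blocks.one_corow_absurd[OF flip]) (simp_all add: insert_commute)
next
  assume "row_on R W {x1, x2, x3}"
  then show False using assms one_corow_absurd by blast
qed

lemma rows_absurd:
  assumes "row_on R W {x1, y1}" "row_on R W {x2, y2}" "row_on R W {x3, y3}" "row_on R W {x1, x2, x3}"
  shows False
proof -
  have "W = {y1, x1, y2, x2, y3, x3}" using W by auto
  then have "forbidden R X"
    using forbidden_IV[of y1 x1 y2 x2 y3 x3 X R] assms dist W_sub by (auto simp: insert_commute)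
  then show False using free by simp
qed

text \<open>By \<open>no_two_corows\<close> the last alternative of \<open>block_row\<close> is
  void, and at most one block is the complement of a row. If one is, \<open>M_V\<close> occurs; if
  none is, \<open>M_IV\<close> does.\<close>

lemma absurd: False
proof -
  interpret r: pattern_free_blocks R X W x2 y2 x3 y3 x1 y1 by (rule rotate)
  interpret r2: pattern_free_blocks R X W x3 y3 x1 y1 x2 y2 by (rule r.rotate)
  have all_rows: "\<not> (row_on R W {x1, y1} \<and> row_on R W {x2, y2} \<and> row_on R W {x3, y3})"
    using rows_absurd pattern_free_blocks.rows_absurd[OF flip] crossing_row by (auto simp: insert_commute)
  show False
    using block_row r.block_row r2.block_row no_two_corows r.no_two_corows r2.no_two_corows all_rows
      one_corow_row_absurd r.one_corow_row_absurd r2.one_corow_row_absurd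
    by blast
qed

end

theorem forbidden_if_crossed_blocks:
  assumes "{x1, y1, x2, y2, x3, y3} \<subseteq> X"
    and "crossed_blocks (realized R {x1, y1, x2, y2, x3, y3}) x1 y1 x2 y2 x3 y3"
  shows "forbidden R X"
proof (rule ccontr)
  assume "\<not> forbidden R X"
  then have "pattern_free_blocks R X {x1, y1, x2, y2, x3, y3} x1 y1 x2 y2 x3 y3"
    using assms unfolding pattern_free_blocks_def crossed_blocks_def by blast
  then show False by (rule pattern_free_blocks.absurd)
qed


section \<open>Arcs of a circular order\<close>

text \<open>No two elements alternate with two non-elements around the circle. Formulated without
  end points, the notion passes to complements and to subsets of the columns at once.\<close>

definition arc :: "('a \<Rightarrow> nat) \<Rightarrow> 'a set \<Rightarrow> 'a set \<Rightarrow> bool" where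
  "arc pos X S \<longleftrightarrow> (\<forall>x\<in>X \<inter> S. \<forall>z\<in>X \<inter> S. \<forall>y\<in>X - S. \<forall>v\<in>X - S.
     pos x < pos y \<longrightarrow> pos y < pos z \<longrightarrow> \<not> (pos v < pos x \<or> pos z < pos v))"

lemma arcD:
  "arc pos X S \<Longrightarrow> x \<in> X \<Longrightarrow> y \<in> X \<Longrightarrow> z \<in> X \<Longrightarrow> v \<in> X \<Longrightarrow> x \<in> S \<Longrightarrow> z \<in> S \<Longrightarrow> y \<notin> S \<Longrightarrow> v \<notin> S \<Longrightarrow>
    pos x < pos y \<Longrightarrow> pos y < pos z \<Longrightarrow> pos v < pos x \<or> pos z < pos v \<Longrightarrow> False"
  unfolding arc_def by blast

lemma arc_compl: "arc pos X S \<Longrightarrow> arc pos X (X - S)"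
  unfolding arc_def by blast

lemma arc_cong: "X \<inter> S = X \<inter> T \<Longrightarrow> arc pos X S \<longleftrightarrow> arc pos X T"
  unfolding arc_def by blast

lemma arc_restrict: "arc pos X S \<Longrightarrow> W \<subseteq> X \<Longrightarrow> arc pos W (S \<inter> W)"
  unfolding arc_def by blast

text \<open>Suppose that \<open>y\<close>, not in \<open>S\<close>, and \<open>v\<close> separate
  \<open>x\<close> from \<open>z\<close> on the circle. As \<open>S\<close> is an arc,
  \<open>v\<close> is in \<open>S\<close>, hence not in \<open>T\<close>, and \<open>d\<close> lies
  on the same side as \<open>y\<close>. Then \<open>d\<close> and \<open>v\<close> separate
  \<open>x\<close> from \<open>z\<close> for \<open>T\<close>.\<close>

lemma arc_Int:
  assumes S: "arc pos X S" and T: "arc pos X T" and d: "d \<in> X" "d \<notin> S" "d \<notin> T" and inj: "inj_on pos X"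
  shows "arc pos X (S \<inter> T)"
proof -
  have half: False
    if S: "arc pos X S" and T: "arc pos X T" and d: "d \<notin> S" "d \<notin> T"
      and X: "x \<in> X" "y \<in> X" "z \<in> X" "v \<in> X" and mem: "x \<in> S" "x \<in> T" "z \<in> S" "z \<in> T" "y \<notin> S" "v \<notin> S \<or> v \<notin> T"
      and pos: "pos x < pos y" "pos y < pos z" "pos v < pos x \<or> pos z < pos v" for S T x y z v
  proof -
    have "v \<in> S" using arcD[OF S X(1-4) mem(1,3,5) _ pos] by blast
    then have "v \<notin> T" using mem by blast
    have "d \<noteq> x" "d \<noteq> z" using d mem by auto
    then have "pos d \<noteq> pos x" "pos d \<noteq> pos z" using inj \<open>d \<in> X\<close> X by (auto dest: inj_onD)
    moreover have "\<not> (pos d < pos x \<or> pos z < pos d)"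
      using arcD[OF S X(1-3) \<open>d \<in> X\<close> mem(1,3,5) d(1) pos(1,2)] by blast
    ultimately have "pos x < pos d" "pos d < pos z" by auto
    then show False using arcD[OF T X(1) \<open>d \<in> X\<close> X(3,4) mem(2,4) d(2) \<open>v \<notin> T\<close> _ _ pos(3)] by blast
  qed
  show ?thesis
    unfolding arc_def using half[OF S T d(2,3)] half[OF T S d(3,2)] by blast
qed

text \<open>Cut the circle at \<open>w\<close> and let \<open>v m\<close> come first among the
  cycle. The arc joining it to the later of its two neighbours misses \<open>w\<close> and would
  have to contain the earlier one.\<close>

lemma arcs_no_isolated_cycle:
  assumes inj: "inj_on pos (insert w (v ` {..n}))"
    and arcs: "\<And>S. S \<in> \<F> \<Longrightarrow> arc pos (insert w (v ` {..n})) S"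
  shows "\<not> isolated_cycle \<F> n v w"
proof
  assume cyc: "isolated_cycle \<F> n v w"
  let ?W = "insert w (v ` {..n})"
  have n: "2 \<le> n" and injv: "inj_on v {..n}" and w: "w \<notin> v ` {..n}"
    and edges: "\<And>i. i < n \<Longrightarrow> {v i, v (Suc i)} \<in> \<F>" "{v 0, v n} \<in> \<F>"
    using cyc unfolding isolated_cycle_def by auto
  define N where "N = Suc (Max (pos ` ?W))"
  have N: "pos x < N" if "x \<in> ?W" for x
    unfolding N_def using that by (intro le_imp_less_Suc Max_ge) auto
  \<comment> \<open>Positions counted from \<open>w\<close> on: \<open>N\<close> exceeds all
    positions, so whatever does not follow \<open>w\<close> is moved behind the rest.\<close>
  define rot where "rot x = (if pos w < pos x then pos x else pos x + N)" for x
  obtain m where m: "m \<le> n" "\<And>i. i \<le> n \<Longrightarrow> rot (v m) \<le> rot (v i)"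
    using ex_has_least_nat[of "\<lambda>i. i \<le> n" 0 "\<lambda>i. rot (v i)"] by auto
  have key: False
    if ab: "a \<le> n" "b \<le> n" "a \<noteq> m" "b \<noteq> m" "rot (v a) < rot (v b)" "{v m, v b} \<in> \<F>" for a b
  proof -
    have neq: "v a \<noteq> v m" "v b \<noteq> v m" "v a \<noteq> v b"
      using ab m injv by (auto dest: inj_onD)
    have in_W: "v a \<in> ?W" "v b \<in> ?W" "v m \<in> ?W" "w \<in> ?W" using ab m by auto
    have wn: "w \<noteq> v a" "w \<noteq> v b" "w \<noteq> v m" using w ab m by auto
    have pos_neq: "pos (v a) \<noteq> pos (v m)" "pos (v b) \<noteq> pos (v m)" "pos (v a) \<noteq> pos (v b)"
      "pos w \<noteq> pos (v a)" "pos w \<noteq> pos (v b)" "pos w \<noteq> pos (v m)"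
      using neq wn in_W by (simp_all add: inj_on_eq_iff[OF inj])
    have le: "rot (v m) \<le> rot (v a)" "rot (v m) \<le> rot (v b)" using m ab by blast+
    have arc: "arc pos ?W {v m, v b}" using arcs ab by blast
    note less_N = N[OF in_W(1)] N[OF in_W(2)] N[OF in_W(3)]
    \<comment> \<open>The four rotations of the cyclic order \<open>w\<close>, \<open>v m\<close>,
      \<open>v a\<close>, \<open>v b\<close>.\<close>
    consider "pos w < pos (v m)" "pos (v m) < pos (v a)" "pos (v a) < pos (v b)"
      | "pos (v b) < pos w" "pos w < pos (v m)" "pos (v m) < pos (v a)"
      | "pos (v a) < pos (v b)" "pos (v b) < pos w" "pos w < pos (v m)"
      | "pos (v m) < pos (v a)" "pos (v a) < pos (v b)" "pos (v b) < pos w"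
    proof (cases "pos w < pos (v m)")
      case wm: True
      show ?thesis
      proof (cases "pos w < pos (v a)")
        case True
        then have "pos (v m) < pos (v a)" using wm le pos_neq by (simp add: rot_def)
        moreover have "pos (v a) < pos (v b) \<or> pos (v b) < pos w"
          using True ab(5) pos_neq by (simp add: rot_def split: if_splits)
        ultimately show ?thesis using that wm by blast
      next
        case False
        then have "\<not> pos w < pos (v b)" using ab(5) less_N by (simp add: rot_def split: if_splits)
        moreover have "pos (v a) < pos (v b)" using False calculation ab(5) by (simp add: rot_def)
        ultimately show ?thesis using that wm pos_neq by (meson linorder_neqE_nat)
      qed
    next
      case False
      then have "\<not> pos w < pos (v a)" "\<not> pos w < pos (v b)"
        using le less_N by (simp_all add: rot_def split: if_splits)
      moreover have "pos (v m) < pos (v a)" "pos (v a) < pos (v b)"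
        using False calculation le(1) ab(5) pos_neq by (simp_all add: rot_def)
      ultimately show ?thesis using that pos_neq by (meson linorder_neqE_nat)
    qed
    then show False
    proof cases
      case 1
      then show ?thesis using arcD[OF arc, of "v m" "v a" "v b" w] in_W neq wn by auto
    next
      case 2
      then show ?thesis using arcD[OF arc, of "v b" w "v m" "v a"] in_W neq wn by auto
    next
      case 3
      then show ?thesis using arcD[OF arc, of "v b" w "v m" "v a"] in_W neq wn by auto
    next
      case 4
      then show ?thesis using arcD[OF arc, of "v m" "v a" "v b" w] in_W neq wn by auto
    qed
  qed
  define a where "a = (if m = n then 0 else Suc m)"
  define b where "b = (if m = 0 then n else m - 1)"
  have ab: "a \<le> n" "b \<le> n" "a \<noteq> m" "b \<noteq> m" "a \<noteq> b" using n m(1) by (auto simp: a_def b_def)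
  have ea: "{v m, v a} \<in> \<F>" using edges m(1) by (cases "m = n") (auto simp: a_def insert_commute)
  have eb: "{v m, v b} \<in> \<F>"
    using edges(1)[of "m - 1"] edges(2) m(1) by (cases "m = 0") (auto simp: b_def insert_commute)
  have "rot (v a) \<noteq> rot (v b)"
  proof
    assume eq: "rot (v a) = rot (v b)"
    have "pos (v a) < N" "pos (v b) < N" using N ab by auto
    then have "pos (v a) = pos (v b)" using eq unfolding rot_def by (auto split: if_splits)
    then have "v a = v b" using inj ab by (auto dest: inj_onD)
    then show False using injv ab by (auto dest: inj_onD)
  qed
  then show False using key[of a b] key[of b a] ab ea eb by linarith
qed

text \<open>The crossing arc and the complement of a block both miss the \<open>y\<close> of that
  block, so by \<open>arc_Int\<close> they meet in an arc, which is a pair of \<open>x\<close>. The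
  three pairs form a triangle with \<open>y1\<close> outside.\<close>

lemma arcs_no_crossed_blocks:
  assumes inj: "inj_on pos {x1, y1, x2, y2, x3, y3}"
    and arcs: "\<And>S. S \<in> \<F> \<Longrightarrow> arc pos {x1, y1, x2, y2, x3, y3} S"
  shows "\<not> crossed_blocks \<F> x1 y1 x2 y2 x3 y3"
proof
  assume cb: "crossed_blocks \<F> x1 y1 x2 y2 x3 y3"
  let ?W = "{x1, y1, x2, y2, x3, y3}"
  have dist: "distinct [x1, y1, x2, y2, x3, y3]" using cb by (simp add: crossed_blocks_def)
  have arc: "arc pos ?W {x1, y1}" "arc pos ?W {x2, y2}" "arc pos ?W {x3, y3}" "arc pos ?W {x1, x2, x3}"
    using cb arcs by (auto simp: crossed_blocks_def)
  have pair: "arc pos {x1, x2, x3, y1} S"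
    if "S = {x1, x2, x3} \<inter> (?W - {x, y})" "arc pos ?W {x, y}" "y \<in> ?W" "y \<notin> {x1, x2, x3}" for x y S
  proof -
    have "arc pos ?W S"
      unfolding that(1) by (rule arc_Int[OF arc(4) arc_compl[OF that(2)] that(3,4) _ inj]) simp
    then have "arc pos {x1, x2, x3, y1} (S \<inter> {x1, x2, x3, y1})" by (rule arc_restrict) auto
    then show ?thesis using arc_cong[of "{x1, x2, x3, y1}" S "S \<inter> {x1, x2, x3, y1}" pos] by auto
  qed
  have "{x1, x2} = {x1, x2, x3} \<inter> (?W - {x3, y3})" "{x2, x3} = {x1, x2, x3} \<inter> (?W - {x1, y1})"
    "{x1, x3} = {x1, x2, x3} \<inter> (?W - {x2, y2})" using dist by auto
  note eqs = this
  have "y1 \<notin> {x1, x2, x3}" "y2 \<notin> {x1, x2, x3}" "y3 \<notin> {x1, x2, x3}" using dist by auto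
  then have pairs: "arc pos {x1, x2, x3, y1} {x1, x2}" "arc pos {x1, x2, x3, y1} {x2, x3}"
    "arc pos {x1, x2, x3, y1} {x1, x3}"
    using pair[OF eqs(1) arc(3)] pair[OF eqs(2) arc(1)] pair[OF eqs(3) arc(2)] by blast+
  have "isolated_cycle (Collect (arc pos {x1, x2, x3, y1})) 2 ((!) [x1, x2, x3]) y1"
    and img: "(!) [x1, x2, x3] ` {..2} = {x1, x2, x3}"
    using isolated_three_cycle[of x1 x2 x3 y1 "Collect (arc pos {x1, x2, x3, y1})"] pairs dist by auto
  moreover have "insert y1 {x1, x2, x3} = {x1, x2, x3, y1}" by auto
  moreover have "inj_on pos {x1, x2, x3, y1}" using inj by (rule inj_on_subset) auto
  ultimately show False
    using arcs_no_isolated_cycle[of pos y1 "(!) [x1, x2, x3]" 2 "Collect (arc pos {x1, x2, x3, y1})"]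
    by simp
qed

section \<open>Orders in which rows and their intersections are arcs\<close>

definition circular_arcs :: "'a set set \<Rightarrow> 'a set \<Rightarrow> ('a \<Rightarrow> nat) \<Rightarrow> bool" where
  "circular_arcs R X pos \<longleftrightarrow> inj_on pos X \<and> (\<forall>r\<in>R. \<forall>s\<in>R. arc pos X r \<and> arc pos X (r \<inter> s))"

lemma circular_arcs_realized:
  assumes arcs: "circular_arcs R X pos" and W: "W \<subseteq> X" and S: "S \<in> realized R W"
  shows "arc pos W S"
proof -
  have row: "arc pos W (r \<inter> W)" "arc pos W (W - r \<inter> W)" if "r \<in> R" for r
    using arcs that W arc_restrict arc_compl unfolding circular_arcs_def by blast+
  have meet: "arc pos W (r \<inter> s \<inter> W)" "arc pos W (W - r \<inter> s \<inter> W)" if "r \<in> R" "s \<in> R" for r s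
    using arcs that W arc_restrict arc_compl unfolding circular_arcs_def by blast+
  have co: "S = W - T" if "T = W - S" for T using realized_subset[OF S] that by blast
  from S show ?thesis
  proof (cases rule: realized_cases)
    case (row r)
    then show ?thesis using \<open>\<And>r. r \<in> R \<Longrightarrow> arc pos W (r \<inter> W)\<close> by blast
  next
    case (corow r)
    show ?thesis unfolding co[OF corow(2)] using corow(1) by (rule row)
  next
    case (meet r s)
    then show ?thesis using \<open>\<And>r s. r \<in> R \<Longrightarrow> s \<in> R \<Longrightarrow> arc pos W (r \<inter> s \<inter> W)\<close> by blast
  next
    case (comeet r s)
    show ?thesis unfolding co[OF comeet(4)] using comeet(1,2) by (rule meet)
  qed
qed

lemma circular_arcs_no_cycle:
  assumes "circular_arcs R X pos" "insert w (v ` {..n}) \<subseteq> X"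
  shows "\<not> isolated_cycle (realized R (insert w (v ` {..n}))) n v w"
proof (rule arcs_no_isolated_cycle)
  show "inj_on pos (insert w (v ` {..n}))"
    using assms inj_on_subset unfolding circular_arcs_def by blast
qed (rule circular_arcs_realized[OF assms])

lemma circular_arcs_no_blocks:
  assumes "circular_arcs R X pos" "{x1, y1, x2, y2, x3, y3} \<subseteq> X"
  shows "\<not> crossed_blocks (realized R {x1, y1, x2, y2, x3, y3}) x1 y1 x2 y2 x3 y3"
proof (rule arcs_no_crossed_blocks)
  have "inj_on pos X" using assms(1) by (simp add: circular_arcs_def)
  then show "inj_on pos {x1, y1, x2, y2, x3, y3}" using assms(2) by (rule inj_on_subset)
qed (rule circular_arcs_realized[OF assms])

text \<open>Shared by the three infinite families: columns 1 to \<open>k\<close> form a cycle with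
  column \<open>k + 1\<close> outside. The families differ in how the closing pair is
  realized.\<close>

lemma circular_arcs_no_long_pattern:
  fixes g :: "nat \<Rightarrow> 'a" and k :: nat
  assumes arcs: "circular_arcs R X pos" and k: "3 \<le> k"
    and g: "inj_on g {1..k + 1}" "g ` {1..k + 1} \<subseteq> X"
    and path: "\<And>i. i \<in> {1..k - 1} \<Longrightarrow> {g i, g (i + 1)} \<in> realized R (g ` {1..k + 1})"
    and close: "{g 1, g k} \<in> realized R (g ` {1..k + 1})"
  shows False
proof -
  define v where "v i = g (i + 1)" for i
  have "(\<lambda>i. i + 1) ` {..k - 1} = {1..k}"
    using k image_add_atLeastAtMost'[of 1 0 "k - 1"] by (simp add: atMost_atLeast0)
  then have "v ` {..k - 1} = g ` {1..k}" unfolding v_def by (metis image_image)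
  moreover have "{1..k + 1} = insert (k + 1) {1..k}" by auto
  ultimately have W: "insert (g (k + 1)) (v ` {..k - 1}) = g ` {1..k + 1}" by simp
  have "isolated_cycle (realized R (g ` {1..k + 1})) (k - 1) v (g (k + 1))"
    unfolding isolated_cycle_def
  proof (intro conjI allI impI)
    show "inj_on v {..k - 1}"
    proof (rule inj_onI)
      fix i j assume "i \<in> {..k - 1}" "j \<in> {..k - 1}" "v i = v j"
      then show "i = j" using inj_onD[OF g(1), of "i + 1" "j + 1"] k by (simp add: v_def)
    qed
    show "g (k + 1) \<notin> v ` {..k - 1}"
    proof
      assume "g (k + 1) \<in> v ` {..k - 1}"
      then obtain i where i: "i \<le> k - 1" "g (k + 1) = g (i + 1)" by (auto simp: v_def)
      then have "k + 1 = i + 1" using k by (intro inj_onD[OF g(1) i(2)]) simp_all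
      then show False using i k by simp
    qed
    show "{v i, v (Suc i)} \<in> realized R (g ` {1..k + 1})" if "i < k - 1" for i
      using path[of "i + 1"] that by (simp add: v_def)
    show "{v 0, v (k - 1)} \<in> realized R (g ` {1..k + 1})" using close k by (simp add: v_def)
  qed (use k in simp)
  then show False
    using circular_arcs_no_cycle[OF arcs, of "g (k + 1)" v "k - 1"] g(2) unfolding W by blast
qed

lemma circular_arcs_no_four_pattern:
  fixes g :: "nat \<Rightarrow> 'a"
  assumes arcs: "circular_arcs R X pos" and g: "inj_on g {1..5}" "g ` {1..5} \<subseteq> X"
    and edges: "{g 1, g 2} \<in> realized R (g ` {1..5})" "{g 2, g 3} \<in> realized R (g ` {1..5})"
      "{g 3, g 4} \<in> realized R (g ` {1..5})" "{g 1, g 4} \<in> realized R (g ` {1..5})"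
  shows False
proof (rule circular_arcs_no_long_pattern[OF arcs, of 4 g])
  have eq: "{1..4 + 1} = {1..5::nat}" by simp
  show "inj_on g {1..4 + 1}" "g ` {1..4 + 1} \<subseteq> X" "{g 1, g 4} \<in> realized R (g ` {1..4 + 1})"
    unfolding eq by (fact g edges)+
  show "{g i, g (i + 1)} \<in> realized R (g ` {1..4 + 1})" if "i \<in> {1..4 - 1}" for i
  proof -
    have "i = 1 \<or> i = 2 \<or> i = 3" using that by auto
    then show ?thesis unfolding eq using edges by (auto simp: numeral_2_eq_2[symmetric])
  qed
qed simp

lemma contains_pattern_rows:
  assumes "contains_pattern R X n \<P>"
  shows "\<exists>g. inj_on g {1..n} \<and> g ` {1..n} \<subseteq> X \<and>
    (\<forall>P\<in>\<P>. row_on R (g ` {1..n}) (g ` (P \<inter> {1..n})))"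
proof -
  obtain g where g: "inj_on g {1..n}" "g ` {1..n} \<subseteq> X"
    "\<forall>P\<in>\<P>. \<exists>r\<in>R. \<forall>j\<in>{1..n}. g j \<in> r \<longleftrightarrow> j \<in> P"
    using assms unfolding contains_pattern_def by blast
  have "row_on R (g ` {1..n}) (g ` (P \<inter> {1..n}))" if P: "P \<in> \<P>" for P
  proof -
    obtain r where r: "r \<in> R" "\<forall>j\<in>{1..n}. g j \<in> r \<longleftrightarrow> j \<in> P" using g(3) P by blast
    then have "r \<inter> g ` {1..n} = g ` (P \<inter> {1..n})" by blast
    then show ?thesis using r(1) unfolding row_on_def by blast
  qed
  then show ?thesis using g(1,2) by blast
qed

lemma corow_pattern:
  assumes "inj_on g {1..n}" "row_on R (g ` {1..n}) (g ` (P \<inter> {1..n}))" "Q = {1..n} - P"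
  shows "row_on R (g ` {1..n}) (g ` {1..n} - g ` Q)"
proof -
  have "g ` {1..n} - g ` Q = g ` ({1..n} - Q)"
    using inj_on_image_set_diff[OF assms(1), of "{1..n}" Q] assms(3) by auto
  moreover have "{1..n} - Q = P \<inter> {1..n}" using assms(3) by auto
  ultimately show ?thesis using assms(2) by simp
qed

text \<open>\<open>M_IV\<close> consists of crossed blocks; every other pattern contains an isolated
  cycle. Pairs that are not rows are complements of rows or stem from two rows with disjoint
  complements.\<close>

lemma not_forbidden_if_circular_arcs:
  assumes arcs: "circular_arcs R X pos"
  shows "\<not> forbidden R X"
proof
  have path: "{g i, g (i + 1)} \<in> realized R (g ` {1..k + 1})"
    if rows: "\<And>P. P \<in> path_rows k \<Longrightarrow> row_on R (g ` {1..k + 1}) (g ` (P \<inter> {1..k + 1}))"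
      and i: "i \<in> {1..k - 1}" for g :: "nat \<Rightarrow> 'a" and k i
  proof -
    have "g ` ({i, i + 1} \<inter> {1..k + 1}) = {g i, g (i + 1)}" using i by auto
    then show ?thesis using row_on_realized[OF rows[of "{i, i + 1}"]] i by auto
  qed
  assume "forbidden R X"
  then consider k where "3 \<le> k" "contains_pattern R X (k + 1) (rows_I k)"
    | k where "3 \<le> k" "contains_pattern R X (k + 1) (rows_III k)"
    | k where "3 \<le> k" "contains_pattern R X (k + 1) (rows_II (k + 1))"
    | "contains_pattern R X 5 {{1, 2}, {1, 4, 5}, {3, 4}, {2, 3, 5}}"
    | "contains_pattern R X 4 {{1, 2}, {1, 4}, {1, 2, 4}, {2, 3, 4}}"
    | "contains_pattern R X 6 {{1, 2}, {3, 4}, {5, 6}, {2, 4, 6}}"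
    | "contains_pattern R X 5 {{1, 2}, {1, 2, 3, 4}, {3, 4}, {1, 4, 5}}"
    | "contains_pattern R X 4 {{1, 2, 4}, {2, 3, 4}, {1, 3, 4}}"
    unfolding forbidden_def by blast
  then show False
  proof cases
    case (1 k)
    from contains_pattern_rows[OF 1(2)] obtain g :: "nat \<Rightarrow> 'a" where g0: "inj_on g {1..k + 1}" "g ` {1..k + 1} \<subseteq> X"
      "\<forall>P\<in>rows_I k. row_on R (g ` {1..k + 1}) (g ` (P \<inter> {1..k + 1}))" by blast
    note g = g0(1,2) bspec[OF g0(3)]
    have "row_on R (g ` {1..k + 1}) (g ` ({1, k} \<inter> {1..k + 1}))" by (rule g(3)) (simp add: rows_I_def)
    moreover have "g ` ({1, k} \<inter> {1..k + 1}) = {g 1, g k}" using 1(1) by auto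
    ultimately have "{g 1, g k} \<in> realized R (g ` {1..k + 1})" using row_on_realized by metis
    then show False
      using circular_arcs_no_long_pattern[OF arcs 1(1) g(1,2)] path g(3) by (auto simp: rows_I_def)
  next
    case (2 k)
    from contains_pattern_rows[OF 2(2)] obtain g :: "nat \<Rightarrow> 'a" where g0: "inj_on g {1..k + 1}" "g ` {1..k + 1} \<subseteq> X"
      "\<forall>P\<in>rows_III k. row_on R (g ` {1..k + 1}) (g ` (P \<inter> {1..k + 1}))" by blast
    note g = g0(1,2) bspec[OF g0(3)]
    have "row_on R (g ` {1..k + 1}) (g ` {1..k + 1} - g ` {1, k})"
      by (rule corow_pattern[OF g(1) g(3)[of "{2..k - 1} \<union> {k + 1}"]]) (use 2(1) in \<open>auto simp: rows_III_def\<close>)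
    then have "g ` {1, k} \<in> realized R (g ` {1..k + 1})"
      using 2(1) by (intro corow_on_realized) auto
    then show False
      using circular_arcs_no_long_pattern[OF arcs 2(1) g(1,2)] path g(3) by (auto simp: rows_III_def)
  next
    case (3 k)
    from contains_pattern_rows[OF 3(2)] obtain g :: "nat \<Rightarrow> 'a" where g0: "inj_on g {1..k + 1}" "g ` {1..k + 1} \<subseteq> X"
      "\<forall>P\<in>rows_II (k + 1). row_on R (g ` {1..k + 1}) (g ` (P \<inter> {1..k + 1}))" by blast
    note g = g0(1,2) bspec[OF g0(3)]
    have "row_on R (g ` {1..k + 1}) (g ` {1..k + 1} - g ` {k})"
      by (rule corow_pattern[OF g(1) g(3)[of "{1..k - 1} \<union> {k + 1}"]]) (use 3(1) in \<open>auto simp: rows_II_def\<close>)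
    moreover have "row_on R (g ` {1..k + 1}) (g ` {1..k + 1} - g ` {1})"
      by (rule corow_pattern[OF g(1) g(3)[of "{2..k + 1}"]]) (use 3(1) in \<open>auto simp: rows_II_def\<close>)
    moreover have "g 1 \<noteq> g k" using inj_onD[OF g(1), of 1 k] 3(1) by auto
    ultimately have "g ` {1} \<union> g ` {k} \<in> realized R (g ` {1..k + 1})"
      using 3(1) by (intro disjoint_corows_realized) auto
    then have "{g 1, g k} \<in> realized R (g ` {1..k + 1})" by (simp add: insert_commute)
    then show False
      using circular_arcs_no_long_pattern[OF arcs 3(1) g(1,2)] path g(3) by (auto simp: rows_II_def)
  next
    case 4
    from contains_pattern_rows[OF this] obtain g :: "nat \<Rightarrow> 'a" where g0: "inj_on g {1..5}" "g ` {1..5} \<subseteq> X"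
      "\<forall>P\<in>{{1, 2}, {1, 4, 5}, {3, 4}, {2, 3, 5}}. row_on R (g ` {1..5}) (g ` (P \<inter> {1..5}))" by blast
    note g = g0(1,2) bspec[OF g0(3)]
    let ?W = "g ` {1..5}"
    have "row_on R ?W (?W - g ` {2, 3})"
      by (rule corow_pattern[OF g(1) g(3)[of "{1, 4, 5}"]]) (auto simp: atLeastAtMost_5)
    moreover have "row_on R ?W (?W - g ` {1, 4})"
      by (rule corow_pattern[OF g(1) g(3)[of "{2, 3, 5}"]]) (auto simp: atLeastAtMost_5)
    moreover have "row_on R ?W {g 1, g 2}" "row_on R ?W {g 3, g 4}"
      using g(3)[of "{1, 2}"] g(3)[of "{3, 4}"] by (simp_all add: atLeastAtMost_5)
    ultimately have "{g 1, g 2} \<in> realized R ?W" "{g 2, g 3} \<in> realized R ?W" "{g 3, g 4} \<in> realized R ?W"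
      "{g 1, g 4} \<in> realized R ?W"
      using row_on_realized[of R ?W] corow_on_realized[of R ?W "g ` {2, 3}"] corow_on_realized[of R ?W "g ` {1, 4}"]
      by (simp_all add: atLeastAtMost_5)
    then show False by (rule circular_arcs_no_four_pattern[OF arcs g(1,2)])
  next
    case 5
    from contains_pattern_rows[OF this] obtain g :: "nat \<Rightarrow> 'a" where g0: "inj_on g {1..4}" "g ` {1..4} \<subseteq> X"
      "\<forall>P\<in>{{1, 2}, {1, 4}, {1, 2, 4}, {2, 3, 4}}. row_on R (g ` {1..4}) (g ` (P \<inter> {1..4}))" by blast
    note g = g0(1,2) bspec[OF g0(3)]
    let ?W = "g ` {1..4}"
    have W: "?W = {g 1, g 2, g 3, g 4}" unfolding atLeastAtMost_4 by simp
    have dist: "distinct [g 1, g 2, g 4, g 3]" using g(1) unfolding atLeastAtMost_4 by auto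
    \<comment> \<open>The rows missing 3 and missing 1 realize the pair 1, 3 and thus its complement
      2, 4: a triangle on 1, 2, 4 with 3 outside.\<close>
    have "row_on R ?W (?W - g ` {3})"
      by (rule corow_pattern[OF g(1) g(3)[of "{1, 2, 4}"]]) (auto simp: atLeastAtMost_4)
    moreover have "row_on R ?W (?W - g ` {1})"
      by (rule corow_pattern[OF g(1) g(3)[of "{2, 3, 4}"]]) (auto simp: atLeastAtMost_4)
    ultimately have "g ` {3} \<union> g ` {1} \<in> realized R ?W"
      using dist by (intro disjoint_corows_realized) auto
    then have "?W - (g ` {3} \<union> g ` {1}) \<in> realized R ?W" by (rule realized_compl)
    moreover have "?W - (g ` {3} \<union> g ` {1}) = {g 2, g 4}" using dist unfolding W by auto
    ultimately have "{g 2, g 4} \<in> realized R ?W" by simp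
    moreover have "{g 1, g 2} \<in> realized R ?W" "{g 1, g 4} \<in> realized R ?W"
      using row_on_realized[OF g(3)[of "{1, 2}"]] row_on_realized[OF g(3)[of "{1, 4}"]]
      by (simp_all add: atLeastAtMost_4)
    ultimately have "isolated_cycle (realized R ?W) 2 ((!) [g 1, g 2, g 4]) (g 3)"
      "(!) [g 1, g 2, g 4] ` {..2} = {g 1, g 2, g 4}"
      using isolated_three_cycle[OF dist] by blast+
    moreover have "insert (g 3) {g 1, g 2, g 4} = ?W" unfolding W by auto
    ultimately show False
      using circular_arcs_no_cycle[OF arcs, of "g 3" "(!) [g 1, g 2, g 4]" 2] g(2) by simp
  next
    case 6
    from contains_pattern_rows[OF this] obtain g :: "nat \<Rightarrow> 'a" where g0: "inj_on g {1..6}" "g ` {1..6} \<subseteq> X"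
      "\<forall>P\<in>{{1, 2}, {3, 4}, {5, 6}, {2, 4, 6}}. row_on R (g ` {1..6}) (g ` (P \<inter> {1..6}))" by blast
    note g = g0(1,2) bspec[OF g0(3)]
    let ?W = "{g 2, g 1, g 4, g 3, g 6, g 5}"
    have W: "g ` {1..6} = ?W" unfolding atLeastAtMost_6 by auto
    have dist: "distinct [g 2, g 1, g 4, g 3, g 6, g 5]" using g(1) unfolding atLeastAtMost_6 by auto
    have "{g 2, g 1} \<in> realized R ?W" "{g 4, g 3} \<in> realized R ?W" "{g 6, g 5} \<in> realized R ?W"
      "{g 2, g 4, g 6} \<in> realized R ?W"
      using row_on_realized[OF g(3)[of "{1, 2}"]] row_on_realized[OF g(3)[of "{3, 4}"]]
        row_on_realized[OF g(3)[of "{5, 6}"]] row_on_realized[OF g(3)[of "{2, 4, 6}"]]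
      unfolding W by (simp_all add: atLeastAtMost_6 insert_commute)
    then have "crossed_blocks (realized R ?W) (g 2) (g 1) (g 4) (g 3) (g 6) (g 5)"
      unfolding crossed_blocks_def using dist by simp
    then show False using circular_arcs_no_blocks[OF arcs] g(2) W by metis
  next
    case 7
    from contains_pattern_rows[OF this] obtain g :: "nat \<Rightarrow> 'a" where g0: "inj_on g {1..5}" "g ` {1..5} \<subseteq> X"
      "\<forall>P\<in>{{1, 2}, {1, 2, 3, 4}, {3, 4}, {1, 4, 5}}. row_on R (g ` {1..5}) (g ` (P \<inter> {1..5}))" by blast
    note g = g0(1,2) bspec[OF g0(3)]
    let ?W = "g ` {1..5}"
    have W: "?W = {g 1, g 2, g 3, g 4, g 5}" unfolding atLeastAtMost_5 by simp
    have dist: "distinct [g 1, g 2, g 3, g 4, g 5]" using g(1) unfolding atLeastAtMost_5 by auto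
    \<comment> \<open>The complements 2, 3 and 5 of two rows are disjoint and leave the pair 1, 4,
      which closes the cycle 1, 2, 3, 4 with 5 outside.\<close>
    have co23: "row_on R ?W (?W - g ` {2, 3})"
      by (rule corow_pattern[OF g(1) g(3)[of "{1, 4, 5}"]]) (auto simp: atLeastAtMost_5)
    moreover have "row_on R ?W (?W - g ` {5})"
      by (rule corow_pattern[OF g(1) g(3)[of "{1, 2, 3, 4}"]]) (auto simp: atLeastAtMost_5)
    ultimately have "g ` {2, 3} \<union> g ` {5} \<in> realized R ?W"
      using dist by (intro disjoint_corows_realized) auto
    then have "?W - (g ` {2, 3} \<union> g ` {5}) \<in> realized R ?W" by (rule realized_compl)
    moreover have "?W - (g ` {2, 3} \<union> g ` {5}) = {g 1, g 4}" using dist unfolding W by auto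
    ultimately have "{g 1, g 4} \<in> realized R ?W" by simp
    moreover have "{g 1, g 2} \<in> realized R ?W" "{g 3, g 4} \<in> realized R ?W"
      using row_on_realized[OF g(3)[of "{1, 2}"]] row_on_realized[OF g(3)[of "{3, 4}"]]
      by (simp_all add: atLeastAtMost_5)
    moreover have "{g 2, g 3} \<in> realized R ?W"
      using corow_on_realized[OF co23] by (simp add: atLeastAtMost_5)
    ultimately show False by (intro circular_arcs_no_four_pattern[OF arcs g(1,2)])
  next
    case 8
    from contains_pattern_rows[OF this] obtain g :: "nat \<Rightarrow> 'a" where g0: "inj_on g {1..4}" "g ` {1..4} \<subseteq> X"
      "\<forall>P\<in>{{1, 2, 4}, {2, 3, 4}, {1, 3, 4}}. row_on R (g ` {1..4}) (g ` (P \<inter> {1..4}))" by blast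
    note g = g0(1,2) bspec[OF g0(3)]
    let ?W = "g ` {1..4}"
    have W: "?W = {g 1, g 2, g 3, g 4}" unfolding atLeastAtMost_4 by simp
    have dist: "distinct [g 1, g 2, g 3, g 4]" using g(1) unfolding atLeastAtMost_4 by auto
    have co: "row_on R ?W (?W - g ` {3})" "row_on R ?W (?W - g ` {1})" "row_on R ?W (?W - g ` {2})"
      by (rule corow_pattern[OF g(1) g(3)[of "{1, 2, 4}"]] corow_pattern[OF g(1) g(3)[of "{2, 3, 4}"]]
          corow_pattern[OF g(1) g(3)[of "{1, 3, 4}"]]; auto simp: atLeastAtMost_4)+
    have pair: "{g i, g j} \<in> realized R ?W"
      if "row_on R ?W (?W - g ` {i})" "row_on R ?W (?W - g ` {j})" "i \<in> {1..4}" "j \<in> {1..4}" "g i \<noteq> g j" for i j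
      using disjoint_corows_realized[OF that(1,2)] that(3-5) by (simp add: insert_commute)
    have "{g 1, g 2} \<in> realized R ?W" "{g 2, g 3} \<in> realized R ?W" "{g 1, g 3} \<in> realized R ?W"
      using pair[OF co(2,3)] pair[OF co(3,1)] pair[OF co(2,1)] dist by simp_all
    with isolated_three_cycle[OF dist] have "isolated_cycle (realized R ?W) 2 ((!) [g 1, g 2, g 3]) (g 4)"
      "(!) [g 1, g 2, g 3] ` {..2} = {g 1, g 2, g 3}"
      by blast+
    moreover have "insert (g 4) {g 1, g 2, g 3} = ?W" unfolding W by auto
    ultimately show False
      using circular_arcs_no_cycle[OF arcs, of "g 4" "(!) [g 1, g 2, g 3]" 2] g(2) by simp
  qed
qed

lemma circular_arcs_if_not_forbidden:
  assumes fin: "finite X" and free: "\<not> forbidden R X"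
  shows "\<exists>pos. circular_arcs R X pos"
proof (cases "X = {}")
  case True
  then show ?thesis by (auto simp: circular_arcs_def arc_def)
next
  case False
  then obtain c where c: "c \<in> X" by blast
  have trace: "trace (realized R X) W \<subseteq> realized R W" if "W \<subseteq> X" for W
    using realized_restrict that unfolding trace_def by blast
  interpret cycle_free X "realized R X"
  proof
    show "S \<subseteq> X" if "S \<in> realized R X" for S using that by (rule realized_subset)
    show "X - S \<in> realized R X" if "S \<in> realized R X" for S using that by (rule realized_compl)
    show "\<not> isolated_cycle (trace (realized R X) (insert w (v ` {..n}))) n v w"
      if "v ` {..n} \<subseteq> X" "w \<in> X" for v n w
    proof
      assume "isolated_cycle (trace (realized R X) (insert w (v ` {..n}))) n v w"
      then have "isolated_cycle (realized R (insert w (v ` {..n}))) n v w"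
        using trace[of "insert w (v ` {..n})"] that unfolding isolated_cycle_def by blast
      then show False using forbidden_if_isolated_cycle[OF that] free by blast
    qed
    show "\<not> crossed_blocks (trace (realized R X) {x1, y1, x2, y2, x3, y3}) x1 y1 x2 y2 x3 y3"
      if "{x1, y1, x2, y2, x3, y3} \<subseteq> X" for x1 y1 x2 y2 x3 y3
    proof
      assume "crossed_blocks (trace (realized R X) {x1, y1, x2, y2, x3, y3}) x1 y1 x2 y2 x3 y3"
      then have "crossed_blocks (realized R {x1, y1, x2, y2, x3, y3}) x1 y1 x2 y2 x3 y3"
        using trace[OF that] unfolding crossed_blocks_def by blast
      then show False using forbidden_if_crossed_blocks[OF that] free by blast
    qed
  qed
  have "consecutive_ones (X - {c}) {S \<in> realized R X. c \<notin> S}"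
  proof (rule consecutive_ones_if_no_asteroidal)
    show "\<not> asteroidal {S \<in> realized R X. c \<notin> S} x y z"
      if "x \<in> X - {c}" "y \<in> X - {c}" "z \<in> X - {c}" for x y z
      using that c by (intro not_asteroidal) auto
  qed (use fin realized_subset in auto)
  then obtain p where p: "inj_on p (X - {c})" "\<And>S. S \<in> realized R X \<Longrightarrow> c \<notin> S \<Longrightarrow> consecutive p (X - {c}) S"
    unfolding consecutive_ones_def by blast
  \<comment> \<open>The cut column gets position 0, before all others, so a set missing it is an arc
    once it is consecutive among the rest.\<close>
  define pos where "pos y = (if y = c then 0 else Suc (p y))" for y
  have inj: "inj_on pos X"
    using p(1) unfolding inj_on_def pos_def by auto
  have off: "arc pos X S" if S: "S \<in> realized R X" "c \<notin> S" for S
    unfolding arc_def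
  proof (intro ballI impI)
    fix x z y v assume A: "x \<in> X \<inter> S" "z \<in> X \<inter> S" "y \<in> X - S" "v \<in> X - S" "pos x < pos y" "pos y < pos z"
    have "x \<noteq> c" "z \<noteq> c" using A S(2) by auto
    moreover have "y \<noteq> c" using A(5) by (auto simp: pos_def)
    ultimately have "y \<in> S"
      using consecutiveD[OF p(2)[OF S], of x y z] A by (auto simp: pos_def)
    then show "\<not> (pos v < pos x \<or> pos z < pos v)" using A by blast
  qed
  have real: "arc pos X S" if S: "S \<in> realized R X" for S
  proof (cases "c \<in> S")
    case True
    then have "arc pos X (X - (X - S))" using off[of "X - S"] realized_compl[OF S] arc_compl by blast
    then show ?thesis using arc_cong[of X S "X - (X - S)" pos] by auto
  qed (rule off[OF S])
  have row: "arc pos X r" if "r \<in> R" for r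
    using real[OF realized_row[OF that]] arc_cong[of X r "r \<inter> X" pos] by auto
  have "arc pos X (r \<inter> s)" if rs: "r \<in> R" "s \<in> R" for r s
  proof (cases "X \<subseteq> r \<union> s")
    case True
    have "arc pos X (X - (X - r \<inter> s))"
      using real[OF realized_compl[OF realized_comeet[OF rs True]]] .
    then show ?thesis using arc_cong[of X "r \<inter> s" "X - (X - r \<inter> s)" pos] by auto
  next
    case False
    then show ?thesis using arc_Int[OF row[OF rs(1)] row[OF rs(2)] _ _ _ inj] by blast
  qed
  then show ?thesis using inj row unfolding circular_arcs_def by blast
qed

theorem circular_arcs_iff: "finite X \<Longrightarrow> (\<exists>pos. circular_arcs R X pos) \<longleftrightarrow> \<not> forbidden R X"
  using circular_arcs_if_not_forbidden not_forbidden_if_circular_arcs by blast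


section \<open>Matrices\<close>

definition rows_of :: "bit mat \<Rightarrow> nat set set" where
  "rows_of M = row_set M ` {..<dim_row M}"

section \<open>Configurations as row patterns\<close>

lemma inj_on_pick: "finite S \<Longrightarrow> inj_on (pick S) {..<card S}"
  by (rule linorder_inj_onI) (use pick_mono_le in \<open>force+\<close>)

lemma inj_on_pick_permutes:
  assumes "finite S" "p permutes {..<card S}"
  shows "inj_on (\<lambda>i. pick S (p i)) {..<card S}"
  using comp_inj_on[where f = p and g = "pick S" and A = "{..<card S}"] permutes_inj_on[OF assms(2)]
    inj_on_pick[OF assms(1)] permutes_image[OF assms(2)] by (simp add: comp_def)

text \<open>\<open>pick\<close> lists a set in increasing order, so the permutation sends
  \<open>i\<close> to the rank of \<open>h i\<close>.\<close>

lemma permutation_to_pick: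
  assumes h: "inj_on h {..<n::nat}"
  shows "\<exists>p. p permutes {..<n} \<and> (\<forall>i<n. pick (h ` {..<n}) (p i) = h i)"
proof -
  let ?I = "h ` {..<n}"
  define p where "p i = (if i < n then card {a \<in> ?I. a < h i} else i)" for i
  have pick: "pick ?I (p i) = h i" if "i < n" for i
    using pick_card_in_set[of "h i" ?I] that by (simp add: p_def)
  have "p i < n" if "i < n" for i
  proof -
    have "card {a \<in> ?I. a < h i} < card ?I"
      using that by (intro psubset_card_mono) auto
    also have "\<dots> = n" using card_image[OF h] by simp
    finally show ?thesis using that by (simp add: p_def)
  qed
  moreover have "inj_on p {..<n}"
    using pick h by (metis (no_types, lifting) inj_on_def lessThan_iff)
  ultimately have "bij_betw p {..<n} {..<n}"
    by (metis (no_types, lifting) bij_betw_def endo_inj_surj finite_lessThan image_subsetI lessThan_iff)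
  then have "p permutes {..<n}"
    by (rule bij_imp_permutes) (simp add: p_def)
  then show ?thesis using pick by blast
qed

text \<open>Selecting and then permuting rows and columns amounts to two injections:
  \<open>pick\<close> after the permutation in one direction, image and ranks in the other.\<close>

lemma contains_configuration_iff:
  "contains_configuration M F \<longleftrightarrow>
     (\<exists>h g. inj_on h {..<dim_row F} \<and> h ` {..<dim_row F} \<subseteq> {..<dim_row M} \<and>
        inj_on g {..<dim_col F} \<and> g ` {..<dim_col F} \<subseteq> {..<dim_col M} \<and>
        (\<forall>i<dim_row F. \<forall>j<dim_col F. F $$ (i, j) = M $$ (h i, g j)))"
    (is "_ \<longleftrightarrow> ?R")
proof
  assume "contains_configuration M F"
  then obtain I J p q where I: "I \<subseteq> {..<dim_row M}" and J: "J \<subseteq> {..<dim_col M}"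
    and p: "p permutes {..<dim_row (submatrix M I J)}" and q: "q permutes {..<dim_col (submatrix M I J)}"
    and F: "F = permute_mat p q (submatrix M I J)"
    unfolding contains_configuration_def by blast
  have fin: "finite I" "finite J" using I J finite_subset by blast+
  have "{i. i < dim_row M \<and> i \<in> I} = I" "{j. j < dim_col M \<and> j \<in> J} = J" using I J by auto
  then have dims: "dim_row (submatrix M I J) = card I" "dim_col (submatrix M I J) = card J"
    and idx: "\<And>i j. i < card I \<Longrightarrow> j < card J \<Longrightarrow> submatrix M I J $$ (i, j) = M $$ (pick I i, pick J j)"
    using submatrix_index[of _ M I _ J] by (simp_all add: dim_submatrix)
  have dF: "dim_row F = card I" "dim_col F = card J" unfolding F permute_mat_def by (simp_all add: dims)
  have pi: "p i < card I" if "i < card I" for i using permutes_in_image[OF p, of i] that dims by simp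
  have qj: "q j < card J" if "j < card J" for j using permutes_in_image[OF q, of j] that dims by simp
  show ?R
  proof (rule exI[of _ "\<lambda>i. pick I (p i)"], rule exI[of _ "\<lambda>j. pick J (q j)"], intro conjI allI impI)
    show "inj_on (\<lambda>i. pick I (p i)) {..<dim_row F}"
      using inj_on_pick_permutes[OF fin(1)] p unfolding dF dims by blast
    show "inj_on (\<lambda>j. pick J (q j)) {..<dim_col F}"
      using inj_on_pick_permutes[OF fin(2)] q unfolding dF dims by blast
    show "(\<lambda>i. pick I (p i)) ` {..<dim_row F} \<subseteq> {..<dim_row M}"
      using pi pick_in_set_le I unfolding dF by blast
    show "(\<lambda>j. pick J (q j)) ` {..<dim_col F} \<subseteq> {..<dim_col M}"
      using qj pick_in_set_le J unfolding dF by blast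
    fix i j assume "i < dim_row F" "j < dim_col F"
    then show "F $$ (i, j) = M $$ (pick I (p i), pick J (q j))"
      using idx pi qj unfolding dF F permute_mat_def by (simp add: dims)
  qed
next
  assume ?R
  then obtain h g where h: "inj_on h {..<dim_row F}" "h ` {..<dim_row F} \<subseteq> {..<dim_row M}"
    and g: "inj_on g {..<dim_col F}" "g ` {..<dim_col F} \<subseteq> {..<dim_col M}"
    and F: "\<forall>i<dim_row F. \<forall>j<dim_col F. F $$ (i, j) = M $$ (h i, g j)" by blast
  define I where "I = h ` {..<dim_row F}"
  define J where "J = g ` {..<dim_col F}"
  obtain p where p: "p permutes {..<dim_row F}" "\<forall>i<dim_row F. pick I (p i) = h i"
    using permutation_to_pick[OF h(1)] unfolding I_def by blast
  obtain q where q: "q permutes {..<dim_col F}" "\<forall>j<dim_col F. pick J (q j) = g j"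
    using permutation_to_pick[OF g(1)] unfolding J_def by blast
  have "{i. i < dim_row M \<and> i \<in> I} = I" "{j. j < dim_col M \<and> j \<in> J} = J"
    using h(2) g(2) unfolding I_def J_def by auto
  moreover have "card I = dim_row F" "card J = dim_col F"
    unfolding I_def J_def using card_image[OF h(1)] card_image[OF g(1)] by simp_all
  ultimately have dims: "dim_row (submatrix M I J) = dim_row F" "dim_col (submatrix M I J) = dim_col F"
    and idx: "\<And>i j. i < dim_row F \<Longrightarrow> j < dim_col F \<Longrightarrow> submatrix M I J $$ (i, j) = M $$ (pick I i, pick J j)"
    using submatrix_index[of _ M I _ J] by (simp_all add: dim_submatrix)
  have "F = permute_mat p q (submatrix M I J)"
  proof (rule eq_matI)
    fix i j assume "i < dim_row (permute_mat p q (submatrix M I J))" "j < dim_col (permute_mat p q (submatrix M I J))"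
    then have ij: "i < dim_row F" "j < dim_col F" by (simp_all add: permute_mat_def dims)
    then have "p i < dim_row F" "q j < dim_col F"
      using permutes_in_image[OF p(1), of i] permutes_in_image[OF q(1), of j] by simp_all
    then show "F $$ (i, j) = permute_mat p q (submatrix M I J) $$ (i, j)"
      using F[rule_format, OF ij] idx[of "p i" "q j"] p(2) q(2) ij by (simp add: permute_mat_def dims)
  qed (simp_all add: permute_mat_def dims)
  moreover have "I \<subseteq> {..<dim_row M}" "J \<subseteq> {..<dim_col M}" using h(2) g(2) by (simp_all add: I_def J_def)
  moreover have "p permutes {..<dim_row (submatrix M I J)}" "q permutes {..<dim_col (submatrix M I J)}"
    using p(1) q(1) by (simp_all add: dims)
  ultimately show "contains_configuration M F" unfolding contains_configuration_def by blast
qed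

lemma inj_on_Suc: "inj_on g {1..n} \<Longrightarrow> inj_on (\<lambda>j. g (j + 1)) {..<n::nat}"
proof (rule inj_onI)
  fix x y assume "inj_on g {1..n}" "x \<in> {..<n}" "y \<in> {..<n}" "g (x + 1) = g (y + 1)"
  then have "x + 1 = y + 1" by (intro inj_onD[of g "{1..n}"]) simp_all
  then show "x = y" by simp
qed

text \<open>Equal rows of \<open>M\<close> are a single element of \<open>rows_of M\<close>.
  Distinctness of the patterns ensures that the rows found for them have different indices in
  \<open>M\<close>.\<close>

lemma contains_configuration_row_sets:
  assumes distinct: "inj_on (\<lambda>i. P i \<inter> {1..n}) {1..m}"
  shows "contains_configuration M (mat_of_row_sets m n P) \<longleftrightarrow>
    contains_pattern (rows_of M) {..<dim_col M} n (P ` {1..m})"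
proof
  assume "contains_configuration M (mat_of_row_sets m n P)"
  then obtain h g where h: "h ` {..<m} \<subseteq> {..<dim_row M}"
    and g: "inj_on g {..<n}" "g ` {..<n} \<subseteq> {..<dim_col M}"
    and eq: "\<And>i j. i < m \<Longrightarrow> j < n \<Longrightarrow> mat_of_row_sets m n P $$ (i, j) = M $$ (h i, g j)"
    unfolding contains_configuration_iff by (auto simp: mat_of_row_sets_def)
  have pred: "j - 1 < n" "Suc (j - 1) = j" if "j \<in> {1..n}" for j :: nat using that by auto
  have inj: "inj_on (\<lambda>j. g (j - 1)) {1..n}"
  proof (rule inj_onI)
    fix x y assume xy: "x \<in> {1..n}" "y \<in> {1..n}" "g (x - 1) = g (y - 1)"
    have "x - 1 = y - 1"
      by (rule inj_onD[OF g(1) xy(3)]) (use pred(1)[OF xy(1)] pred(1)[OF xy(2)] in simp_all)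
    moreover have "1 \<le> x" "1 \<le> y" using xy(1,2) by simp_all
    ultimately show "x = y" by linarith
  qed
  have "\<exists>r\<in>rows_of M. \<forall>j\<in>{1..n}. g (j - 1) \<in> r \<longleftrightarrow> j \<in> P i" if i: "i \<in> {1..m}" for i
  proof (intro bexI ballI)
    have im: "i - 1 < m" "Suc (i - 1) = i" using i by auto
    show "row_set M (h (i - 1)) \<in> rows_of M" using h im by (auto simp: rows_of_def)
    fix j assume j: "j \<in> {1..n}"
    have "(M $$ (h (i - 1), g (j - 1)) = 1) = (j \<in> P i)"
      using eq[OF im(1) pred(1)[OF j]] im pred[OF j] by (auto simp: mat_of_row_sets_def split: if_splits)
    then show "g (j - 1) \<in> row_set M (h (i - 1)) \<longleftrightarrow> j \<in> P i"
      using g(2) pred(1)[OF j] by (auto simp: row_set_def)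
  qed
  moreover have "(\<lambda>j. g (j - 1)) ` {1..n} \<subseteq> {..<dim_col M}" using g(2) pred(1) by blast
  ultimately show "contains_pattern (rows_of M) {..<dim_col M} n (P ` {1..m})"
    unfolding contains_pattern_def using inj by blast
next
  assume "contains_pattern (rows_of M) {..<dim_col M} n (P ` {1..m})"
  then obtain g where g: "inj_on g {1..n}" "g ` {1..n} \<subseteq> {..<dim_col M}"
    and rows: "\<forall>i\<in>{1..m}. \<exists>r\<in>rows_of M. \<forall>j\<in>{1..n}. g j \<in> r \<longleftrightarrow> j \<in> P i"
    unfolding contains_pattern_def by auto
  have "\<forall>i\<in>{1..m}. \<exists>k<dim_row M. \<forall>j\<in>{1..n}. g j \<in> row_set M k \<longleftrightarrow> j \<in> P i"
    using rows by (auto simp: rows_of_def)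
  then obtain h where h: "\<And>i. i \<in> {1..m} \<Longrightarrow> h i < dim_row M \<and> (\<forall>j\<in>{1..n}. g j \<in> row_set M (h i) \<longleftrightarrow> j \<in> P i)"
    using bchoice[of "{1..m}" "\<lambda>i k. k < dim_row M \<and> (\<forall>j\<in>{1..n}. g j \<in> row_set M k \<longleftrightarrow> j \<in> P i)"] by blast
  have "inj_on h {1..m}"
  proof (rule inj_onI)
    fix a b assume ab: "a \<in> {1..m}" "b \<in> {1..m}" "h a = h b"
    then have "P a \<inter> {1..n} = P b \<inter> {1..n}" using h[of a] h[of b] by auto
    then show "a = b" using inj_onD[OF distinct] ab by blast
  qed
  then have "inj_on (\<lambda>i. h (i + 1)) {..<m}" by (rule inj_on_Suc)
  moreover have "inj_on (\<lambda>j. g (j + 1)) {..<n}" by (rule inj_on_Suc[OF g(1)])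
  moreover have "(\<lambda>i. h (i + 1)) ` {..<m} \<subseteq> {..<dim_row M}"
  proof (rule image_subsetI)
    fix i assume "i \<in> {..<m}"
    then have "i + 1 \<in> {1..m}" by simp
    then show "h (i + 1) \<in> {..<dim_row M}" using h by blast
  qed
  moreover have g_less: "g (j + 1) < dim_col M" if "j < n" for j
  proof -
    have "j + 1 \<in> {1..n}" using that by simp
    then show ?thesis using g(2) by blast
  qed
  then have "(\<lambda>j. g (j + 1)) ` {..<n} \<subseteq> {..<dim_col M}" by blast
  moreover have "mat_of_row_sets m n P $$ (i, j) = M $$ (h (i + 1), g (j + 1))" if ij: "i < m" "j < n" for i j
  proof -
    have "M $$ (h (i + 1), g (j + 1)) = 1 \<longleftrightarrow> j + 1 \<in> P (i + 1)"
      using h[of "i + 1"] ij g_less[OF ij(2)] by (auto simp: row_set_def)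
    then show ?thesis using ij by (cases "M $$ (h (i + 1), g (j + 1))") (auto simp: mat_of_row_sets_def)
  qed
  moreover have "dim_row (mat_of_row_sets m n P) = m" "dim_col (mat_of_row_sets m n P) = n"
    by (simp_all add: mat_of_row_sets_def)
  ultimately show "contains_configuration M (mat_of_row_sets m n P)"
    unfolding contains_configuration_iff by metis
qed

section \<open>The members of the forbidden list\<close>

lemma lessThan_cases:
  "i < 3 \<Longrightarrow> i = 0 \<or> i = 1 \<or> i = (2::nat)"
  "i < 4 \<Longrightarrow> i = 0 \<or> i = 1 \<or> i = 2 \<or> i = (3::nat)"
  "i < 5 \<Longrightarrow> i = 0 \<or> i = 1 \<or> i = 2 \<or> i = 3 \<or> i = (4::nat)"
  "i < 6 \<Longrightarrow> i = 0 \<or> i = 1 \<or> i = 2 \<or> i = 3 \<or> i = 4 \<or> i = (5::nat)"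
  by linarith+

lemma configuration_row_list:
  assumes "dim_row F = length Ps" "dim_col F = n" "distinct Ps" "\<forall>P\<in>set Ps. P \<subseteq> {1..n}"
    and "\<And>i j. i < length Ps \<Longrightarrow> j < n \<Longrightarrow> F $$ (i, j) = (if j + 1 \<in> Ps ! i then 1 else 0)"
  shows "contains_configuration M F \<longleftrightarrow> contains_pattern (rows_of M) {..<dim_col M} n (set Ps)"
proof -
  have "F = mat_of_row_sets (length Ps) n (\<lambda>i. Ps ! (i - 1))"
    by (rule eq_matI) (use assms in \<open>auto simp: mat_of_row_sets_def\<close>)
  moreover have "inj_on (\<lambda>i. Ps ! (i - 1) \<inter> {1..n}) {1..length Ps}"
  proof (rule inj_onI)
    fix x y assume xy: "x \<in> {1..length Ps}" "y \<in> {1..length Ps}" "Ps ! (x - 1) \<inter> {1..n} = Ps ! (y - 1) \<inter> {1..n}"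
    then have less: "x - 1 < length Ps" "y - 1 < length Ps" by auto
    then have "Ps ! (x - 1) \<subseteq> {1..n}" "Ps ! (y - 1) \<subseteq> {1..n}" using assms(4) by auto
    then have "Ps ! (x - 1) = Ps ! (y - 1)" using xy(3) by (simp add: Int_absorb2)
    then have "x - 1 = y - 1" using nth_eq_iff_index_eq[OF assms(3) less] by blast
    then show "x = y" using xy by auto
  qed
  moreover have "(\<lambda>i. Ps ! (i - 1)) ` {1..length Ps} = set Ps"
  proof -
    have "(\<lambda>i. Ps ! (i - 1)) ` {1..length Ps} = (\<lambda>i. Ps ! (i - 1)) ` Suc ` {..<length Ps}"
      by (simp add: image_Suc_lessThan)
    also have "\<dots> = set Ps" by (simp add: image_image set_conv_nth) blast
    finally show ?thesis .
  qed
  ultimately show ?thesis using contains_configuration_row_sets by metis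
qed

lemma pair_eq: "{x, x + 1} = {y, y + 1} \<longleftrightarrow> x = (y::nat)"
  by (auto simp: doubleton_eq_iff)

text \<open>The appended zero column is column \<open>k + 1\<close>, which lies in no row set. For
  \<open>3 \<le> k\<close> the closing row differs from all pairs of consecutive columns.\<close>

lemma configuration_I:
  assumes "3 \<le> k"
  shows "contains_configuration M (append_zero_col (M_I k)) \<longleftrightarrow>
    contains_pattern (rows_of M) {..<dim_col M} (k + 1) (rows_I k)"
proof -
  let ?P = "\<lambda>i. if i \<le> k - 1 then {i, i + 1} else {1, k}"
  have mat: "append_zero_col (M_I k) = mat_of_row_sets k (k + 1) ?P"
    by (rule eq_matI) (auto simp: append_zero_col_def M_I_def mat_of_row_sets_def)
  have inj: "inj_on (\<lambda>i. ?P i \<inter> {1..k + 1}) {1..k}"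
  proof (rule inj_onI)
    fix x y assume xy: "x \<in> {1..k}" "y \<in> {1..k}" "?P x \<inter> {1..k + 1} = ?P y \<inter> {1..k + 1}"
    have "?P x \<subseteq> {1..k + 1}" "?P y \<subseteq> {1..k + 1}" using xy assms by auto
    then have eq: "?P x = ?P y" using xy(3) by (simp add: Int_absorb2)
    have "z \<le> k - 1 \<longleftrightarrow> z \<noteq> k" "{z, z + 1} \<noteq> {1, k}" if "z \<in> {1..k}" for z
      using that assms by (auto simp: doubleton_eq_iff)
    then show "x = y" using eq xy(1,2) pair_eq[of x y] by (cases "x = k"; cases "y = k") (simp_all, metis+)
  qed
  have img: "?P ` {1..k} = rows_I k"
  proof -
    have "{1..k} = insert k {1..k - 1}" using assms by auto
    then show ?thesis unfolding rows_I_def using assms by auto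
  qed
  show ?thesis
    unfolding mat contains_configuration_row_sets[OF inj] img by (rule refl)
qed

lemma configuration_III:
  assumes "3 \<le> k"
  shows "contains_configuration M (M_III k) \<longleftrightarrow>
    contains_pattern (rows_of M) {..<dim_col M} (k + 1) (rows_III k)"
proof -
  let ?P = "\<lambda>i. if i \<le> k - 1 then {i, i + 1} else {2..k - 1} \<union> {k + 1}"
  have inj: "inj_on (\<lambda>i. ?P i \<inter> {1..k + 1}) {1..k}"
  proof (rule inj_onI)
    fix x y assume xy: "x \<in> {1..k}" "y \<in> {1..k}" "?P x \<inter> {1..k + 1} = ?P y \<inter> {1..k + 1}"
    have "?P x \<subseteq> {1..k + 1}" "?P y \<subseteq> {1..k + 1}" using xy assms by auto
    then have eq: "?P x = ?P y" using xy(3) by (simp add: Int_absorb2)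
    have "(k + 1 \<in> ?P x) = (x = k)" "(k + 1 \<in> ?P y) = (y = k)" using xy(1,2) assms by auto
    then have "x = k \<longleftrightarrow> y = k" using eq by blast
    moreover have "z \<le> k - 1" if "z \<in> {1..k}" "z \<noteq> k" for z using that by auto
    ultimately show "x = y" using eq xy(1,2) pair_eq[of x y] by (cases "x = k") simp_all
  qed
  have img: "?P ` {1..k} = rows_III k"
  proof -
    have "{1..k} = insert k {1..k - 1}" using assms by auto
    then show ?thesis unfolding rows_III_def using assms by auto
  qed
  show ?thesis
    unfolding M_III_def contains_configuration_row_sets[OF inj] img by (rule refl)
qed

lemma configuration_II:
  assumes "3 \<le> k"
  shows "contains_configuration M (M_II (k + 1)) \<longleftrightarrow>
    contains_pattern (rows_of M) {..<dim_col M} (k + 1) (rows_II (k + 1))"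
proof -
  let ?P = "\<lambda>i. if i \<le> k + 1 - 2 then {i, i + 1} else if i = k + 1 - 1 then {1..k + 1 - 2} \<union> {k + 1} else {2..k + 1}"
  have inj: "inj_on (\<lambda>i. ?P i \<inter> {1..k + 1}) {1..k + 1}"
  proof (rule inj_onI)
    fix x y assume xy: "x \<in> {1..k + 1}" "y \<in> {1..k + 1}" "?P x \<inter> {1..k + 1} = ?P y \<inter> {1..k + 1}"
    have "?P x \<subseteq> {1..k + 1}" "?P y \<subseteq> {1..k + 1}" using xy assms by auto
    then have eq: "?P x = ?P y" using xy(3) by (simp add: Int_absorb2)
    \<comment> \<open>Column \<open>k + 1\<close> tells the last two rows from the pairs, and column
      \<open>k\<close> tells these two apart.\<close>
    have "(k + 1 \<in> ?P x) = (k \<le> x)" "(k + 1 \<in> ?P y) = (k \<le> y)"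
      "(k \<in> ?P x) = (k - 1 \<le> x \<and> x \<noteq> k)" "(k \<in> ?P y) = (k - 1 \<le> y \<and> y \<noteq> k)"
      using xy(1,2) assms by auto
    then have k: "k \<le> x \<longleftrightarrow> k \<le> y" "k - 1 \<le> x \<and> x \<noteq> k \<longleftrightarrow> k - 1 \<le> y \<and> y \<noteq> k"
      using eq by blast+
    show "x = y"
    proof (cases "k \<le> x")
      case True
      then show ?thesis using k xy(1,2) by auto
    next
      case False
      then have "x \<le> k + 1 - 2" "y \<le> k + 1 - 2" using k(1) assms by auto
      then show ?thesis using eq pair_eq[of x y] by simp
    qed
  qed
  have img: "?P ` {1..k + 1} = rows_II (k + 1)"
  proof -
    have "{1..k + 1} = insert (k + 1) (insert k {1..k - 1})" using assms by auto
    then show ?thesis unfolding rows_II_def using assms by auto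
  qed
  show ?thesis
    unfolding M_II_def contains_configuration_row_sets[OF inj] img by (rule refl)
qed

lemma configuration_0101:
  "contains_configuration M (complement_rows [0, 1, 0, 1] (append_zero_col (M_I 4))) \<longleftrightarrow>
    contains_pattern (rows_of M) {..<dim_col M} 5 {{1, 2}, {1, 4, 5}, {3, 4}, {2, 3, 5}}"
proof -
  have "contains_configuration M (complement_rows [0, 1, 0, 1] (append_zero_col (M_I 4))) \<longleftrightarrow>
    contains_pattern (rows_of M) {..<dim_col M} 5 (set [{1, 2}, {1, 4, 5}, {3, 4}, {2, 3, 5}])"
  proof (rule configuration_row_list)
    show "distinct [{1, 2}, {1, 4, 5}, {3, 4}, {2, 3, 5::nat}]" by (simp add: set_eq_subset)
  next
    fix i j :: nat assume "i < length [{1, 2}, {1, 4, 5}, {3, 4}, {2, 3, 5::nat}]" "j < 5"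
    then have "i < 4" "j < 5" by simp_all
    from lessThan_cases(2)[OF this(1)] lessThan_cases(3)[OF this(2)]
    show "complement_rows [0, 1, 0, 1] (append_zero_col (M_I 4)) $$ (i, j) =
        (if j + 1 \<in> [{1, 2}, {1, 4, 5}, {3, 4}, {2, 3, 5}] ! i then 1 else 0)"
      by (elim disjE; simp add: complement_rows_def append_zero_col_def M_I_def mat_of_row_sets_def)
  qed (simp_all add: complement_rows_def append_zero_col_def M_I_def mat_of_row_sets_def)
  then show ?thesis by simp
qed

lemma configuration_0100:
  "contains_configuration M (complement_rows [0, 1, 0, 0] (M_II 4)) \<longleftrightarrow>
    contains_pattern (rows_of M) {..<dim_col M} 4 {{1, 2}, {1, 4}, {1, 2, 4}, {2, 3, 4}}"
proof -
  have "contains_configuration M (complement_rows [0, 1, 0, 0] (M_II 4)) \<longleftrightarrow>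
    contains_pattern (rows_of M) {..<dim_col M} 4 (set [{1, 2}, {1, 4}, {1, 2, 4}, {2, 3, 4}])"
  proof (rule configuration_row_list)
    show "distinct [{1, 2}, {1, 4}, {1, 2, 4}, {2, 3, 4::nat}]" by (simp add: set_eq_subset)
  next
    fix i j :: nat assume "i < length [{1, 2}, {1, 4}, {1, 2, 4}, {2, 3, 4::nat}]" "j < 4"
    then have "i < 4" "j < 4" by simp_all
    from lessThan_cases(2)[OF this(1)] lessThan_cases(2)[OF this(2)]
    show "complement_rows [0, 1, 0, 0] (M_II 4) $$ (i, j) =
        (if j + 1 \<in> [{1, 2}, {1, 4}, {1, 2, 4}, {2, 3, 4}] ! i then 1 else 0)"
      by (elim disjE; simp add: complement_rows_def M_II_def mat_of_row_sets_def)
  qed (simp_all add: complement_rows_def M_II_def mat_of_row_sets_def)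
  then show ?thesis by simp
qed

lemma configuration_IV:
  "contains_configuration M M_IV \<longleftrightarrow>
    contains_pattern (rows_of M) {..<dim_col M} 6 {{1, 2}, {3, 4}, {5, 6}, {2, 4, 6}}"
proof -
  have "contains_configuration M M_IV \<longleftrightarrow>
    contains_pattern (rows_of M) {..<dim_col M} 6 (set [{1, 2}, {3, 4}, {5, 6}, {2, 4, 6}])"
  proof (rule configuration_row_list)
    show "distinct [{1, 2}, {3, 4}, {5, 6}, {2, 4, 6::nat}]" by (simp add: set_eq_subset)
  next
    fix i j :: nat assume "i < length [{1, 2}, {3, 4}, {5, 6}, {2, 4, 6::nat}]" "j < 6"
    then have "i < 4" "j < 6" by simp_all
    from lessThan_cases(2)[OF this(1)] lessThan_cases(4)[OF this(2)]
    show "M_IV $$ (i, j) = (if j + 1 \<in> [{1, 2}, {3, 4}, {5, 6}, {2, 4, 6}] ! i then 1 else 0)"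
      by (elim disjE; simp add: M_IV_def mat_of_rows_list_def)
  qed (simp_all add: M_IV_def mat_of_rows_list_def)
  then show ?thesis by simp
qed

lemma configuration_V:
  "contains_configuration M M_V \<longleftrightarrow>
    contains_pattern (rows_of M) {..<dim_col M} 5 {{1, 2}, {1, 2, 3, 4}, {3, 4}, {1, 4, 5}}"
proof -
  have "contains_configuration M M_V \<longleftrightarrow>
    contains_pattern (rows_of M) {..<dim_col M} 5 (set [{1, 2}, {1, 2, 3, 4}, {3, 4}, {1, 4, 5}])"
  proof (rule configuration_row_list)
    show "distinct [{1, 2}, {1, 2, 3, 4}, {3, 4}, {1, 4, 5::nat}]" by (simp add: set_eq_subset)
  next
    fix i j :: nat assume "i < length [{1, 2}, {1, 2, 3, 4}, {3, 4}, {1, 4, 5::nat}]" "j < 5"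
    then have "i < 4" "j < 5" by simp_all
    from lessThan_cases(2)[OF this(1)] lessThan_cases(3)[OF this(2)]
    show "M_V $$ (i, j) = (if j + 1 \<in> [{1, 2}, {1, 2, 3, 4}, {3, 4}, {1, 4, 5}] ! i then 1 else 0)"
      by (elim disjE; simp add: M_V_def mat_of_rows_list_def)
  qed (simp_all add: M_V_def mat_of_rows_list_def)
  then show ?thesis by simp
qed

lemma configuration_VI:
  "contains_configuration M M_VI \<longleftrightarrow>
    contains_pattern (rows_of M) {..<dim_col M} 4 {{1, 2, 4}, {2, 3, 4}, {1, 3, 4}}"
proof -
  have "contains_configuration M M_VI \<longleftrightarrow>
    contains_pattern (rows_of M) {..<dim_col M} 4 (set [{1, 2, 4}, {2, 3, 4}, {1, 3, 4}])"
  proof (rule configuration_row_list)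
    show "distinct [{1, 2, 4}, {2, 3, 4}, {1, 3, 4::nat}]" by (simp add: set_eq_subset)
  next
    fix i j :: nat assume "i < length [{1, 2, 4}, {2, 3, 4}, {1, 3, 4::nat}]" "j < 4"
    then have "i < 3" "j < 4" by simp_all
    from lessThan_cases(1)[OF this(1)] lessThan_cases(2)[OF this(2)]
    show "M_VI $$ (i, j) = (if j + 1 \<in> [{1, 2, 4}, {2, 3, 4}, {1, 3, 4}] ! i then 1 else 0)"
      by (elim disjE; simp add: M_VI_def mat_of_rows_list_def)
  qed (simp_all add: M_VI_def mat_of_rows_list_def)
  then show ?thesis by simp
qed

lemma contains_forbidden_iff:
  "(\<exists>F\<in>F_IcircR. contains_configuration M F) \<longleftrightarrow> forbidden (rows_of M) {..<dim_col M}"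
  unfolding F_IcircR_def forbidden_def
  by (simp add: bex_Un configuration_0101 configuration_0100 configuration_IV configuration_V configuration_VI
      configuration_I configuration_II[simplified] configuration_III[simplified] conj_disj_distribL)
    (use configuration_I configuration_II configuration_III in force)

text \<open>For an arc with no gap between its least and greatest elements, these are the end
  points. Otherwise let \<open>y\<close> be a column in such a gap: every column beyond the extremes
  belongs to \<open>S\<close>, and the neighbours of \<open>y\<close> in \<open>S\<close> bound a
  segment that wraps around.\<close>

lemma circular_interval_iff_arc:
  assumes fin: "finite X" and S: "S \<subseteq> X" and inj: "inj_on pos X"
    and r: "\<And>x y. x \<in> X \<Longrightarrow> y \<in> X \<Longrightarrow> (x, y) \<in> r \<longleftrightarrow> pos x \<le> pos y"
  shows "circular_interval X r S \<longleftrightarrow> arc pos X S"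
proof
  assume "circular_interval X r S"
  then consider "S = {}" | a b where "a \<in> X" "b \<in> X" "S = circular_segment X r a b"
    unfolding circular_interval_def by blast
  then show "arc pos X S"
  proof cases
    case 1
    then show ?thesis by (simp add: arc_def)
  next
    case (2 a b)
    have mem: "x \<in> S \<longleftrightarrow> (if pos a \<le> pos b then pos a \<le> pos x \<and> pos x \<le> pos b else pos x \<le> pos b \<or> pos a \<le> pos x)"
      if "x \<in> X" for x
      unfolding 2(3) circular_segment_def using r 2(1,2) that by auto
    show ?thesis
      unfolding arc_def
    proof (intro ballI impI)
      fix x z y v assume A: "x \<in> X \<inter> S" "z \<in> X \<inter> S" "y \<in> X - S" "v \<in> X - S" "pos x < pos y" "pos y < pos z"
      then show "\<not> (pos v < pos x \<or> pos z < pos v)"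
        using mem[of x] mem[of y] mem[of z] mem[of v] by (cases "pos a \<le> pos b") auto
    qed
  qed
next
  assume arc: "arc pos X S"
  show "circular_interval X r S"
  proof (cases "S = {}")
    case True
    then show ?thesis by (simp add: circular_interval_def)
  next
    case False
    have finS: "finite S" using fin S finite_subset by blast
    have least: "\<exists>a\<in>T. \<forall>x\<in>T. pos a \<le> pos x" if "T \<noteq> {}" for T :: "'a set"
      using that ex_has_least_nat[of "\<lambda>x. x \<in> T" _ pos] by blast
    have greatest: "\<exists>b\<in>T. \<forall>x\<in>T. pos x \<le> pos b" if "T \<noteq> {}" "T \<subseteq> S" for T
      using that finite_subset[OF _ finS] Max_ge[of "pos ` T"] Max_in[of "pos ` T"]
      by (metis (no_types, lifting) finite_imageI image_iff image_is_empty)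
    obtain lo where lo: "lo \<in> S" "\<And>x. x \<in> S \<Longrightarrow> pos lo \<le> pos x" using least[OF False] by blast
    obtain hi where hi: "hi \<in> S" "\<And>x. x \<in> S \<Longrightarrow> pos x \<le> pos hi" using greatest[OF False] by blast
    show ?thesis
    proof (cases "\<exists>y\<in>X - S. pos lo < pos y \<and> pos y < pos hi")
      case False
      have "x \<in> S" if "x \<in> X" "pos lo \<le> pos x" "pos x \<le> pos hi" for x
        using False that lo(1) hi(1) S inj_onD[OF inj, of x lo] inj_onD[OF inj, of x hi]
        by (metis DiffI le_neq_implies_less subsetD)
      moreover have "lo \<in> X" "hi \<in> X" using lo(1) hi(1) S by blast+
      moreover have "pos lo \<le> pos hi" using lo(2)[OF hi(1)] .
      ultimately have "x \<in> S \<longleftrightarrow> x \<in> circular_segment X r lo hi" for x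
        unfolding circular_segment_def using r lo(2)[of x] hi(2)[of x] S by auto
      then have "S = circular_segment X r lo hi" by blast
      then show ?thesis using lo(1) hi(1) S unfolding circular_interval_def by blast
    next
      case True
      then obtain y where y: "y \<in> X" "y \<notin> S" "pos lo < pos y" "pos y < pos hi" by blast
      obtain b where b: "b \<in> S" "pos b < pos y" "\<And>x. x \<in> S \<Longrightarrow> pos x < pos y \<Longrightarrow> pos x \<le> pos b"
        using greatest[of "{x \<in> S. pos x < pos y}"] lo(1) y(3) by blast
      obtain a where a: "a \<in> S" "pos y < pos a" "\<And>x. x \<in> S \<Longrightarrow> pos y < pos x \<Longrightarrow> pos a \<le> pos x"
        using least[of "{x \<in> S. pos y < pos x}"] hi(1) y(4) by blast
      have outside: "v \<in> S" if v: "v \<in> X" "pos v < pos lo \<or> pos hi < pos v" for v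
      proof (rule ccontr)
        assume "v \<notin> S"
        then show False using arcD[OF arc, of lo y hi v] v lo(1) hi(1) y S by blast
      qed
      have "pos lo \<le> pos v" "pos v \<le> pos hi" if "v \<in> X" for v
        using outside[OF that] lo(2)[of v] hi(2)[of v] by force+
      note range = this
      have "x \<in> S \<longleftrightarrow> pos x \<le> pos b \<or> pos a \<le> pos x" if x: "x \<in> X" for x
      proof
        assume "x \<in> S"
        moreover have "pos x \<noteq> pos y" using \<open>x \<in> S\<close> y inj_onD[OF inj, of x y] x by blast
        ultimately show "pos x \<le> pos b \<or> pos a \<le> pos x" using a(3) b(3) by (meson linorder_neqE_nat)
      next
        assume xab: "pos x \<le> pos b \<or> pos a \<le> pos x"
        show "x \<in> S"
        proof (rule ccontr)
          assume xS: "x \<notin> S"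
          have ne: "pos x \<noteq> pos s" if "s \<in> S" for s
            using that xS x S inj_onD[OF inj, of x s] by blast
          have "pos lo < pos x" "pos x < pos hi"
            using range[OF x] ne[OF lo(1)] ne[OF hi(1)] by auto
          then have "pos x < pos b \<Longrightarrow> False" "pos a < pos x \<Longrightarrow> False"
            using arcD[OF arc, of lo x b y] arcD[OF arc, of a x hi y] lo(1) hi(1) a b x xS y S by blast+
          then show False using xab ne[OF a(1)] ne[OF b(1)] by force
        qed
      qed
      \<comment> \<open>\<open>b\<close> precedes \<open>a\<close>, so the wrapping clause of
        \<open>circular_segment\<close> applies.\<close>
      moreover have "(a, b) \<notin> r" using r[of a b] a b S by auto
      ultimately have "S = circular_segment X r a b"
        unfolding circular_segment_def using r a(1) b(1) S by auto
      then show ?thesis using a(1) b(1) S unfolding circular_interval_def by blast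
    qed
  qed
qed

section \<open>Linear orders as injective positions\<close>

lemma linear_order_position:
  assumes "linear_order_on X r" "finite X"
  obtains pos :: "'a \<Rightarrow> nat" where "inj_on pos X"
    "\<And>x y. x \<in> X \<Longrightarrow> y \<in> X \<Longrightarrow> (x, y) \<in> r \<longleftrightarrow> pos x \<le> pos y"
proof -
  have r: "refl_on X r" "trans r" "antisym r" "total_on X r"
    using assms(1) unfolding linear_order_on_def partial_order_on_def preorder_on_def by blast+
  define pos where "pos x = card {z \<in> X. (z, x) \<in> r}" for x
  have mono: "pos x \<le> pos y" if "(x, y) \<in> r" for x y
    unfolding pos_def using assms(2) that transD[OF r(2)] by (intro card_mono) auto
  have strict: "pos x < pos y" if "(x, y) \<in> r" "x \<noteq> y" "x \<in> X" "y \<in> X" for x y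
  proof -
    have "(y, x) \<notin> r" using antisymD[OF r(3)] that by blast
    moreover have "(y, y) \<in> r" using refl_onD[OF r(1)] that by blast
    moreover have "{z \<in> X. (z, x) \<in> r} \<subseteq> {z \<in> X. (z, y) \<in> r}"
      using transD[OF r(2) _ that(1)] by blast
    ultimately have "{z \<in> X. (z, x) \<in> r} \<subset> {z \<in> X. (z, y) \<in> r}" using that(4) by blast
    then show ?thesis unfolding pos_def using assms(2) by (intro psubset_card_mono) simp_all
  qed
  have total: "(x, y) \<in> r \<or> (y, x) \<in> r" if "x \<in> X" "y \<in> X" for x y
    using that r(4) refl_onD[OF r(1)] unfolding total_on_def by metis
  show thesis
  proof
    show "inj_on pos X" using strict total by (metis inj_onI less_irrefl)
    show "(x, y) \<in> r \<longleftrightarrow> pos x \<le> pos y" if "x \<in> X" "y \<in> X" for x y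
      using mono strict total that by (metis leD)
  qed
qed

lemma position_linear_order:
  fixes pos :: "'a \<Rightarrow> nat"
  assumes "inj_on pos X"
  shows "linear_order_on X {(x, y). x \<in> X \<and> y \<in> X \<and> pos x \<le> pos y}"
  unfolding linear_order_on_def partial_order_on_def preorder_on_def
  by (auto simp: refl_on_def trans_def antisym_def total_on_def intro: inj_onD[OF assms])

lemma I_circular_iff: "I_circular M \<longleftrightarrow> (\<exists>pos. circular_arcs (rows_of M) {..<dim_col M} pos)"
proof -
  let ?X = "{..<dim_col M}"
  have sub: "row_set M i \<subseteq> ?X" "row_set M i \<inter> row_set M j \<subseteq> ?X" for i j by (auto simp: row_set_def)
  show ?thesis
  proof
    assume "I_circular M"
    then obtain r where r: "linear_order_on ?X r"
      "\<And>i. i < dim_row M \<Longrightarrow> circular_interval ?X r (row_set M i)"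
      "\<And>i j. i < dim_row M \<Longrightarrow> j < dim_row M \<Longrightarrow> circular_interval ?X r (row_set M i \<inter> row_set M j)"
      unfolding I_circular_def by blast
    obtain pos :: "nat \<Rightarrow> nat" where pos: "inj_on pos ?X"
      "\<And>x y. x \<in> ?X \<Longrightarrow> y \<in> ?X \<Longrightarrow> (x, y) \<in> r \<longleftrightarrow> pos x \<le> pos y"
      using linear_order_position[OF r(1)] by blast
    have "circular_arcs (rows_of M) ?X pos"
      using r(2,3) pos(1) circular_interval_iff_arc[OF _ sub(1) pos] circular_interval_iff_arc[OF _ sub(2) pos]
      unfolding circular_arcs_def rows_of_def by auto
    then show "\<exists>pos. circular_arcs (rows_of M) ?X pos" by blast
  next
    assume "\<exists>pos. circular_arcs (rows_of M) ?X pos"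
    then obtain pos where pos: "circular_arcs (rows_of M) ?X pos" by blast
    then have inj: "inj_on pos ?X" by (simp add: circular_arcs_def)
    let ?r = "{(x, y). x \<in> ?X \<and> y \<in> ?X \<and> pos x \<le> pos y}"
    have r: "(x, y) \<in> ?r \<longleftrightarrow> pos x \<le> pos y" if "x \<in> ?X" "y \<in> ?X" for x y using that by simp
    show "I_circular M"
      unfolding I_circular_def
      using pos position_linear_order[OF inj] circular_interval_iff_arc[OF _ sub(1) inj r]
        circular_interval_iff_arc[OF _ sub(2) inj r]
      unfolding circular_arcs_def rows_of_def by (intro exI[of _ ?r]) auto
  qed
qed

theorem theorem3p14:
  fixes M :: "bit mat"
  shows "I_circular M \<longleftrightarrow> (\<forall>F\<in>F_IcircR. \<not> contains_configuration M F)"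
  using I_circular_iff circular_arcs_iff[of "{..<dim_col M}" "rows_of M"] contains_forbidden_iff[of M]
  by blast

end
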